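(* Let $\mathbb{K}$ be a field of characteristic zero, $G$ an abelian group, $\varepsilon$ an antisymmetric bicharacter on $G$ with values in $\mathbb{K}^\times$, and $V$ a $G$-graded $\mathbb{K}$-vector space with $\varepsilon$-symmetric algebra $S(V)$. The isomorphism classes of objects of the category $\mathfrak{R}_{gr}(S(V))$ are in one-to-one correspondence with pairs $(L,[\omega])$, where $L$ is a $G$-graded $\varepsilon$-Lie algebra structure on the graded space $V$ and $[\omega]$ is an element of $\mathrm{H}^2_{gr}(L,\mathbb{K})$. Moreover, if $\omega$ is a cocycle in the cohomology class $[\omega]$, then $(U_\omega(L),\varphi_\omega)$ is an object in the isomorphism class determined by $(L,[\omega])$.
   Context: $G$ is written multiplicatively with identity $e$; algebras are associative and unital; for homogeneous $a$, $|a|\in G$ denotes its degree. An antisymmetric bicharacter is a map $\varepsilon:G\times G\to\mathbb{K}^\times$ with $\varepsilon(g,h)\varepsilon(h,g)=1$, $\varepsilon(g,hk)=\varepsilon(g,h)\varepsilon(g,k)$, $\varepsilon(gh,k)=\varepsilon(g,k)\varepsilon(h,k)$. A $G$-graded $\varepsilon$-Lie algebra (color Lie algebra) is a $G$-graded $\mathbb{K}$-space $L=\bigoplus_{g\in G}L_g$ with a bilinear bracket such that $[L_g,L_h]\subseteq L_{gh}$, $[a,b]=-\varepsilon(|a|,|b|)[b,a]$ and $\varepsilon(|c|,|a|)[a,[b,c]]+\varepsilon(|a|,|b|)[b,[c,a]]+\varepsilon(|b|,|c|)[c,[a,b]]=0$ for homogeneous $a,b,c$. $\mathrm{Z}^2_{gr}(L,\mathbb{K})$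 is the space of scalar graded 2-cocycles of degree zero: bilinear maps $\omega:L\times L\to\mathbb{K}$ with $\omega(L_g,L_h)=0$ unless $gh=e$, $\omega(x,y)=-\varepsilon(|x|,|y|)\omega(y,x)$, and $\varepsilon(|z|,|x|)\omega(x,[y,z])+\varepsilon(|x|,|y|)\omega(y,[z,x])+\varepsilon(|y|,|z|)\omega(z,[x,y])=0$ for homogeneous $x,y,z$. $\mathrm{H}^2_{gr}(L,\mathbb{K})$ is the quotient of $\mathrm{Z}^2_{gr}(L,\mathbb{K})$ by the subspace of coboundaries $(x,y)\mapsto f([x,y])$, where $f:L\to\mathbb{K}$ is linear with $f(L_g)=0$ for $g\neq e$. The generalized enveloping algebra $U_\omega(L)$ is the quotient of the tensor algebra $T(L)$ by the $G$-graded two-sided ideal generated by all $v_1\otimes v_2-\varepsilon(|v_1|,|v_2|)v_2\otimes v_1-[v_1,v_2]-\omega(v_1,v_2)$ with $v_1,v_2\in L$ homogeneous. It is $G$-graded and filtered by the images $U_{n,\omega}(L)$ of the tensors of order $\le n$, $n\geq 0$ (with $U_{-1,\omega}(L)=0$). Its associated graded algebra is $G_\omega(L)=\bigoplus_{n\ge0}U_{n,\omega}(L)/U_{n-1,\omega}(L)$, which is $\mathbb{Z}\times G$-graded. The $\varepsilon$-symmetric algebra $S(V)$ is the quotient of $T(V)$ by the ideal generated by all $a\otimes b-\varepsilon(|a|,|b|)b\otimes a$, $a,b\in V$ homogeneous; it is $\mathbb{Z}\times G$-graded. If $L$ is an $\varepsilon$-Lie algebra structure on $V$, $\varphi_\omega:S(V)=S(L)\to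 G_\omega(L)$ is the unique algebra homomorphism sending $x\in L$ to the class of its image in $U_{1,\omega}(L)/U_{0,\omega}(L)$. Category $\mathfrak{R}_{gr}(S(V))$: objects are pairs $(A,\varphi_A)$ where $A=\bigcup_{n\ge0}F_nA$ is a $G$-graded, positively filtered algebra (filtration $F_0A\subseteq F_1A\subseteq\cdots$ by $G$-graded subspaces with $F_mA\cdot F_nA\subseteq F_{m+n}A$, $F_{-1}A=0$) and $\varphi_A:S(V)\to G(A)=\bigoplus_n F_nA/F_{n-1}A$ is an isomorphism of $G\times\mathbb{Z}$-graded algebras. A morphism $\Psi:(A,\varphi_A)\to(B,\varphi_B)$ is a $G$-graded, filtered algebra homomorphism $\Psi:A\to B$ whose induced map $G(\Psi):G(A)\to G(B)$ satisfies $G(\Psi)\circ\varphi_A=\varphi_B$. *)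

theory Defs
  imports Complex_Main "HOL-Algebra.QuotRing" "HOL-Algebra.Module" "HOL-Library.Poly_Mapping"
begin

text \<open>
  Conventions. The field \<open>\<bbbK>\<close> is a type \<open>'k\<close> of class \<open>field\<close> and the abelian grading group is a type
  \<open>'g\<close> of class \<open>ab_group_add\<close>, hence written additively (\<open>0\<close> is the identity \<open>e\<close>, \<open>g + h\<close> is \<open>gh\<close>).
  The graded space \<open>V\<close> is the whole of a type \<open>'v\<close>, with scalar multiplication \<open>scale\<close> and
  homogeneous components \<open>V g\<close>. Algebras are records with explicit carriers, because quotients
  by ideals depending on parameters have to be formed.
\<close>

section \<open>Algebras over a field, graded and filtered\<close>

text \<open>Associative unital, not necessarily commutative, algebras (\<^locale>\<open>algebra\<close> is commutative).\<close>

locale k_algebra = ring A for A :: "('k::field, 'a, 'm) module_scheme" (structure) +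
  assumes smult_closed: "x \<in> carrier A \<Longrightarrow> c \<odot> x \<in> carrier A"
    and smult_add_left: "x \<in> carrier A \<Longrightarrow> (c + d) \<odot> x = c \<odot> x \<oplus> d \<odot> x"
    and smult_add_right: "x \<in> carrier A \<Longrightarrow> y \<in> carrier A \<Longrightarrow> c \<odot> (x \<oplus> y) = c \<odot> x \<oplus> c \<odot> y"
    and smult_smult: "x \<in> carrier A \<Longrightarrow> (c * d) \<odot> x = c \<odot> (d \<odot> x)"
    and smult_one: "x \<in> carrier A \<Longrightarrow> 1 \<odot> x = x"
    and smult_mult_left: "x \<in> carrier A \<Longrightarrow> y \<in> carrier A \<Longrightarrow> (c \<odot> x) \<otimes> y = c \<odot> (x \<otimes> y)"
    and smult_mult_right: "x \<in> carrier A \<Longrightarrow> y \<in> carrier A \<Longrightarrow> x \<otimes> (c \<odot> y) = c \<odot> (x \<otimes> y)"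

definition alg_hom :: "('k, 'a, 'm) module_scheme \<Rightarrow> ('k, 'b, 'n) module_scheme \<Rightarrow> ('a \<Rightarrow> 'b) set" where
  "alg_hom A B =
     {h \<in> ring_hom A B. \<forall>c. \<forall>x\<in>carrier A. h (c \<odot>\<^bsub>A\<^esub> x) = c \<odot>\<^bsub>B\<^esub> h x}"

definition linear_subspace :: "('k, 'a, 'm) module_scheme \<Rightarrow> 'a set \<Rightarrow> bool" where
  "linear_subspace A W \<longleftrightarrow>
     W \<subseteq> carrier A \<and> \<zero>\<^bsub>A\<^esub> \<in> W \<and> (\<forall>x\<in>W. \<forall>y\<in>W. x \<oplus>\<^bsub>A\<^esub> y \<in> W) \<and> (\<forall>c. \<forall>x\<in>W. c \<odot>\<^bsub>A\<^esub> x \<in> W)"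

definition linear_span :: "('k, 'a, 'm) module_scheme \<Rightarrow> 'a set \<Rightarrow> 'a set" where
  "linear_span A S = \<Inter>{W. linear_subspace A W \<and> S \<subseteq> W}"

definition quotient_algebra :: "('k, 'a, 'm) module_scheme \<Rightarrow> 'a set \<Rightarrow> ('k, 'a set) module" where
  "quotient_algebra A I =
     \<lparr>carrier = carrier (A Quot I), mult = mult (A Quot I), one = one (A Quot I),
      zero = zero (A Quot I), add = add (A Quot I),
      smult = (\<lambda>c X. \<Union>x\<in>X. I +>\<^bsub>A\<^esub> (c \<odot>\<^bsub>A\<^esub> x))\<rparr>"

text \<open>\<open>homog\<close> is the grading, \<open>filt\<close> the positive filtration \<open>F\<^sub>0 \<subseteq> F\<^sub>1 \<subseteq> \<dots>\<close>.\<close>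

record ('k, 'a, 'g) graded_filtered = "('k, 'a) module" +
  homog :: "'g \<Rightarrow> 'a set"
  filt :: "nat \<Rightarrow> 'a set"

definition homogeneous_decomposition ::
    "('k, 'a, 'm) module_scheme \<Rightarrow> ('g \<Rightarrow> 'a set) \<Rightarrow> 'a \<Rightarrow> ('g \<Rightarrow> 'a) \<Rightarrow> bool" where
  "homogeneous_decomposition A H x f \<longleftrightarrow>
     (\<forall>g. f g \<in> H g) \<and> finite {g. f g \<noteq> \<zero>\<^bsub>A\<^esub>} \<and> x = (\<Oplus>\<^bsub>A\<^esub>g\<in>{g. f g \<noteq> \<zero>\<^bsub>A\<^esub>}. f g)"

text \<open>\<open>A = \<Oplus>\<^sub>g A\<^sub>g\<close> with \<open>A\<^sub>g A\<^sub>h \<subseteq> A\<^sub>g\<^sub>h\<close>.\<close>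

definition graded_algebra :: "('k::field, 'a, 'g::ab_group_add, 'm) graded_filtered_scheme \<Rightarrow> bool" where
  "graded_algebra A \<longleftrightarrow> k_algebra A \<and>
     (\<forall>g. linear_subspace A (homog A g)) \<and>
     (\<forall>x\<in>carrier A. \<exists>!f. homogeneous_decomposition A (homog A) x f) \<and>
     (\<forall>g h. \<forall>x\<in>homog A g. \<forall>y\<in>homog A h. x \<otimes>\<^bsub>A\<^esub> y \<in> homog A (g + h))"

definition graded_subspace :: "('k, 'a, 'g, 'm) graded_filtered_scheme \<Rightarrow> 'a set \<Rightarrow> bool" where
  "graded_subspace A W \<longleftrightarrow> linear_subspace A W \<and>
     (\<forall>x\<in>W. \<exists>f. homogeneous_decomposition A (\<lambda>g. homog A g \<inter> W) x f)"

text \<open>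
  The condition \<open>1 \<in> F\<^sub>0\<close> is not listed: it holds whenever the associated graded algebra below has
  the class of \<open>1\<close> in degree \<open>0\<close> as an element, in particular for every object of the category.
\<close>

definition graded_filtered_algebra ::
    "('k::field, 'a, 'g::ab_group_add, 'm) graded_filtered_scheme \<Rightarrow> bool" where
  "graded_filtered_algebra A \<longleftrightarrow> graded_algebra A \<and>
     (\<forall>n. graded_subspace A (filt A n)) \<and>
     (\<forall>n. filt A n \<subseteq> filt A (Suc n)) \<and>
     (\<forall>m n. \<forall>x\<in>filt A m. \<forall>y\<in>filt A n. x \<otimes>\<^bsub>A\<^esub> y \<in> filt A (m + n)) \<and>
     carrier A = (\<Union>n. filt A n)"

section \<open>The associated graded algebra\<close>

definition filt_pred :: "('k, 'a, 'g, 'm) graded_filtered_scheme \<Rightarrow> nat \<Rightarrow> 'a set" where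
  "filt_pred A n = (case n of 0 \<Rightarrow> {\<zero>\<^bsub>A\<^esub>} | Suc m \<Rightarrow> filt A m)"

text \<open>
  \<open>G(A) = \<Oplus>\<^sub>n F\<^sub>n / F\<^sub>n\<^sub>-\<^sub>1\<close>: its elements are the finitely supported families of cosets, the zero of
  the \<open>n\<close>-th summand being the coset \<open>filt_pred A n\<close>.
\<close>

definition assoc_graded :: "('k, 'a, 'g, 'm) graded_filtered_scheme \<Rightarrow> ('k, nat \<Rightarrow> 'a set) module" where
  "assoc_graded A =
     \<lparr>carrier = {f. (\<forall>n. \<exists>x\<in>filt A n. f n = filt_pred A n +>\<^bsub>A\<^esub> x) \<and> finite {n. f n \<noteq> filt_pred A n}},
      mult = (\<lambda>f h n. \<Union>x\<in>Pi {..n} f. \<Union>y\<in>Pi {..n} h.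
                filt_pred A n +>\<^bsub>A\<^esub> (\<Oplus>\<^bsub>A\<^esub>i\<in>{..n}. x i \<otimes>\<^bsub>A\<^esub> y (n - i))),
      one = (\<lambda>n. if n = 0 then filt_pred A 0 +>\<^bsub>A\<^esub> \<one>\<^bsub>A\<^esub> else filt_pred A n),
      zero = filt_pred A,
      add = (\<lambda>f h n. f n <+>\<^bsub>A\<^esub> h n),
      smult = (\<lambda>c f n. \<Union>x\<in>f n. filt_pred A n +>\<^bsub>A\<^esub> (c \<odot>\<^bsub>A\<^esub> x))\<rparr>"

definition gr_class :: "('k, 'a, 'g, 'm) graded_filtered_scheme \<Rightarrow> nat \<Rightarrow> 'a \<Rightarrow> nat \<Rightarrow> 'a set" where
  "gr_class A n x = (\<lambda>m. if m = n then filt_pred A n +>\<^bsub>A\<^esub> x else filt_pred A m)"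

definition assoc_graded_homog ::
    "('k, 'a, 'g, 'm) graded_filtered_scheme \<Rightarrow> nat \<Rightarrow> 'g \<Rightarrow> (nat \<Rightarrow> 'a set) set" where
  "assoc_graded_homog A n g = gr_class A n ` (filt A n \<inter> homog A g)"

text \<open>The map \<open>G(\<Psi>)\<close> induced by a filtered homomorphism \<open>\<Psi>\<close> into \<open>B\<close>.\<close>

definition assoc_graded_map ::
    "('k, 'b, 'g, 'm) graded_filtered_scheme \<Rightarrow> ('a \<Rightarrow> 'b) \<Rightarrow> (nat \<Rightarrow> 'a set) \<Rightarrow> nat \<Rightarrow> 'b set" where
  "assoc_graded_map B \<Psi> f = (\<lambda>n. \<Union>x\<in>f n. filt_pred B n +>\<^bsub>B\<^esub> \<Psi> x)"

section \<open>Color Lie algebras and their cohomology\<close>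

definition antisymmetric_bicharacter :: "('g::ab_group_add \<Rightarrow> 'g \<Rightarrow> 'k::field) \<Rightarrow> bool" where
  "antisymmetric_bicharacter \<epsilon> \<longleftrightarrow>
     (\<forall>g h. \<epsilon> g h \<noteq> 0) \<and>
     (\<forall>g h. \<epsilon> g h * \<epsilon> h g = 1) \<and>
     (\<forall>g h k. \<epsilon> g (h + k) = \<epsilon> g h * \<epsilon> g k) \<and>
     (\<forall>g h k. \<epsilon> (g + h) k = \<epsilon> g k * \<epsilon> h k)"

definition graded_vector_space ::
    "('k::field \<Rightarrow> 'v::ab_group_add \<Rightarrow> 'v) \<Rightarrow> ('g \<Rightarrow> 'v set) \<Rightarrow> bool" where
  "graded_vector_space scale V \<longleftrightarrow> vector_space scale \<and>
     (\<forall>g. Modules.module.subspace scale (V g)) \<and>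
     (\<forall>x. \<exists>!f. (\<forall>g. f g \<in> V g) \<and> finite {g. f g \<noteq> 0} \<and> x = (\<Sum>g\<in>{g. f g \<noteq> 0}. f g))"

definition bilinear_map ::
    "('k::field \<Rightarrow> 'v::ab_group_add \<Rightarrow> 'v) \<Rightarrow> ('k \<Rightarrow> 'w::ab_group_add \<Rightarrow> 'w) \<Rightarrow> ('v \<Rightarrow> 'v \<Rightarrow> 'w) \<Rightarrow> bool" where
  "bilinear_map scale scale' b \<longleftrightarrow>
     (\<forall>x. Vector_Spaces.linear scale scale' (b x)) \<and>
     (\<forall>y. Vector_Spaces.linear scale scale' (\<lambda>x. b x y))"

context
  fixes \<epsilon> :: "'g::ab_group_add \<Rightarrow> 'g \<Rightarrow> 'k::field"
    and scale :: "'k \<Rightarrow> 'v::ab_group_add \<Rightarrow> 'v"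
    and V :: "'g \<Rightarrow> 'v set"
begin

text \<open>The brackets \<open>L\<close> which make the graded space \<open>V\<close> an \<open>\<epsilon>\<close>-Lie algebra.\<close>

definition color_Lie_structures :: "('v \<Rightarrow> 'v \<Rightarrow> 'v) set" where
  "color_Lie_structures = {L. bilinear_map scale scale L \<and>
     (\<forall>g h. \<forall>a\<in>V g. \<forall>b\<in>V h. L a b \<in> V (g + h)) \<and>
     (\<forall>g h. \<forall>a\<in>V g. \<forall>b\<in>V h. L a b = - scale (\<epsilon> g h) (L b a)) \<and>
     (\<forall>g h k. \<forall>a\<in>V g. \<forall>b\<in>V h. \<forall>c\<in>V k.
        scale (\<epsilon> k g) (L a (L b c)) + scale (\<epsilon> g h) (L b (L c a)) + scale (\<epsilon> h k) (L c (L a b)) = 0)}"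

definition Z2_gr :: "('v \<Rightarrow> 'v \<Rightarrow> 'v) \<Rightarrow> ('v \<Rightarrow> 'v \<Rightarrow> 'k) set" where
  "Z2_gr L = {\<omega>. bilinear_map scale (*) \<omega> \<and>
     (\<forall>g h. g + h \<noteq> 0 \<longrightarrow> (\<forall>x\<in>V g. \<forall>y\<in>V h. \<omega> x y = 0)) \<and>
     (\<forall>g h. \<forall>x\<in>V g. \<forall>y\<in>V h. \<omega> x y = - \<epsilon> g h * \<omega> y x) \<and>
     (\<forall>g h k. \<forall>x\<in>V g. \<forall>y\<in>V h. \<forall>z\<in>V k.
        \<epsilon> k g * \<omega> x (L y z) + \<epsilon> g h * \<omega> y (L z x) + \<epsilon> h k * \<omega> z (L x y) = 0)}"

definition B2_gr :: "('v \<Rightarrow> 'v \<Rightarrow> 'v) \<Rightarrow> ('v \<Rightarrow> 'v \<Rightarrow> 'k) set" where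
  "B2_gr L = {(\<lambda>x y. f (L x y)) |f.
     Vector_Spaces.linear scale (*) f \<and> (\<forall>g. g \<noteq> 0 \<longrightarrow> (\<forall>x\<in>V g. f x = 0))}"

definition cohomologous :: "('v \<Rightarrow> 'v \<Rightarrow> 'v) \<Rightarrow> (('v \<Rightarrow> 'v \<Rightarrow> 'k) \<times> ('v \<Rightarrow> 'v \<Rightarrow> 'k)) set" where
  "cohomologous L = {(\<omega>, \<omega>'). \<omega> \<in> Z2_gr L \<and> \<omega>' \<in> Z2_gr L \<and> (\<lambda>x y. \<omega> x y - \<omega>' x y) \<in> B2_gr L}"

definition H2_gr :: "('v \<Rightarrow> 'v \<Rightarrow> 'v) \<Rightarrow> ('v \<Rightarrow> 'v \<Rightarrow> 'k) set set" where
  "H2_gr L = Z2_gr L // cohomologous L"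

definition H2_class :: "('v \<Rightarrow> 'v \<Rightarrow> 'v) \<Rightarrow> ('v \<Rightarrow> 'v \<Rightarrow> 'k) \<Rightarrow> ('v \<Rightarrow> 'v \<Rightarrow> 'k) set" where
  "H2_class L \<omega> = cohomologous L `` {\<omega>}"

end

section \<open>Tensor algebra, symmetric algebra, generalized enveloping algebra\<close>

text \<open>
  Words form the free monoid, so that \<^typ>\<open>'v list \<Rightarrow>\<^sub>0 'k\<close> is the free algebra on the set \<open>'v\<close>.
  The tensor algebra of the vector space \<open>'v\<close> is its quotient by the relations expressing that the
  inclusion of \<open>'v\<close> is linear.
\<close>

instantiation list :: (type) monoid_add
begin

definition zero_list :: "'a list" where "zero_list = []"

definition plus_list :: "'a list \<Rightarrow> 'a list \<Rightarrow> 'a list" where "plus_list = (@)"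

instance by standard (simp_all add: zero_list_def plus_list_def)

end

definition free_algebra :: "('k::field, 'v list \<Rightarrow>\<^sub>0 'k) module" where
  "free_algebra = \<lparr>carrier = UNIV, mult = (*), one = 1, zero = 0, add = (+),
     smult = (\<lambda>c p. Poly_Mapping.single 0 c * p)\<rparr>"

type_synonym ('v, 'k) tensors = "('v list \<Rightarrow>\<^sub>0 'k) set"

context
  fixes scale :: "'k::field \<Rightarrow> 'v::ab_group_add \<Rightarrow> 'v"
begin

definition linearity_ideal :: "('v list \<Rightarrow>\<^sub>0 'k) set" where
  "linearity_ideal = genideal free_algebra
     ({Poly_Mapping.single [v + w] 1 - Poly_Mapping.single [v] 1 - Poly_Mapping.single [w] 1 |v w. True}
      \<union> {Poly_Mapping.single [scale c v] 1 - Poly_Mapping.single [v] c |c v. True})"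

definition tensor_algebra :: "('k, ('v, 'k) tensors) module" where
  "tensor_algebra = quotient_algebra free_algebra linearity_ideal"

text \<open>The pure tensor \<open>v\<^sub>1 \<otimes> \<dots> \<otimes> v\<^sub>n\<close>; in particular \<open>pure_tensor [v]\<close> is the image of \<open>v\<close>.\<close>

definition pure_tensor :: "'v list \<Rightarrow> ('v, 'k) tensors" where
  "pure_tensor vs = linearity_ideal +>\<^bsub>free_algebra\<^esub> Poly_Mapping.single vs 1"

definition tensors_upto :: "nat \<Rightarrow> ('v, 'k) tensors set" where
  "tensors_upto n = linear_span tensor_algebra {pure_tensor vs |vs. length vs \<le> n}"

end

context
  fixes \<epsilon> :: "'g::ab_group_add \<Rightarrow> 'g \<Rightarrow> 'k::field"
    and scale :: "'k \<Rightarrow> 'v::ab_group_add \<Rightarrow> 'v"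
    and V :: "'g \<Rightarrow> 'v set"
begin

definition tensors_bihomog :: "nat \<Rightarrow> 'g \<Rightarrow> ('v, 'k) tensors set" where
  "tensors_bihomog n g = linear_span (tensor_algebra scale)
     {pure_tensor scale vs |vs gs. length vs = n \<and> list_all2 (\<lambda>v h. v \<in> V h) vs gs \<and> sum_list gs = g}"

definition tensors_homog :: "'g \<Rightarrow> ('v, 'k) tensors set" where
  "tensors_homog g = linear_span (tensor_algebra scale)
     {pure_tensor scale vs |vs gs. list_all2 (\<lambda>v h. v \<in> V h) vs gs \<and> sum_list gs = g}"

text \<open>The element \<open>a \<otimes> b - \<epsilon>(g,h) b \<otimes> a\<close> for \<open>a, b\<close> of degrees \<open>g, h\<close>.\<close>

definition color_commutator :: "'g \<Rightarrow> 'g \<Rightarrow> 'v \<Rightarrow> 'v \<Rightarrow> ('v, 'k) tensors" where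
  "color_commutator g h a b =
     (let T = tensor_algebra scale; \<iota> = (\<lambda>v. pure_tensor scale [v])
      in (\<iota> a \<otimes>\<^bsub>T\<^esub> \<iota> b) \<ominus>\<^bsub>T\<^esub> \<epsilon> g h \<odot>\<^bsub>T\<^esub> (\<iota> b \<otimes>\<^bsub>T\<^esub> \<iota> a))"

definition sym_ideal :: "('v, 'k) tensors set" where
  "sym_ideal = genideal (tensor_algebra scale) {color_commutator g h a b |g h a b. a \<in> V g \<and> b \<in> V h}"

definition sym_algebra :: "('k, ('v, 'k) tensors set) module" where
  "sym_algebra = quotient_algebra (tensor_algebra scale) sym_ideal"

definition sym_proj :: "('v, 'k) tensors \<Rightarrow> ('v, 'k) tensors set" where
  "sym_proj t = sym_ideal +>\<^bsub>tensor_algebra scale\<^esub> t"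

definition sym_homog :: "nat \<Rightarrow> 'g \<Rightarrow> ('v, 'k) tensors set set" where
  "sym_homog n g = sym_proj ` tensors_bihomog n g"

definition env_ideal :: "('v \<Rightarrow> 'v \<Rightarrow> 'v) \<Rightarrow> ('v \<Rightarrow> 'v \<Rightarrow> 'k) \<Rightarrow> ('v, 'k) tensors set" where
  "env_ideal L \<omega> = (let T = tensor_algebra scale in genideal T
     {(color_commutator g h a b \<ominus>\<^bsub>T\<^esub> pure_tensor scale [L a b]) \<ominus>\<^bsub>T\<^esub> \<omega> a b \<odot>\<^bsub>T\<^esub> \<one>\<^bsub>T\<^esub> |g h a b.
        a \<in> V g \<and> b \<in> V h})"

definition env_proj ::
    "('v \<Rightarrow> 'v \<Rightarrow> 'v) \<Rightarrow> ('v \<Rightarrow> 'v \<Rightarrow> 'k) \<Rightarrow> ('v, 'k) tensors \<Rightarrow> ('v, 'k) tensors set" where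
  "env_proj L \<omega> t = env_ideal L \<omega> +>\<^bsub>tensor_algebra scale\<^esub> t"

text \<open>\<open>U\<^sub>\<omega>(L)\<close> with its grading and filtration.\<close>

definition env_algebra ::
    "('v \<Rightarrow> 'v \<Rightarrow> 'v) \<Rightarrow> ('v \<Rightarrow> 'v \<Rightarrow> 'k) \<Rightarrow> ('k, ('v, 'k) tensors set, 'g) graded_filtered" where
  "env_algebra L \<omega> = (let Q = quotient_algebra (tensor_algebra scale) (env_ideal L \<omega>) in
     \<lparr>carrier = carrier Q, mult = mult Q, one = one Q, zero = zero Q, add = add Q, smult = smult Q,
      homog = (\<lambda>g. env_proj L \<omega> ` tensors_homog g),
      filt = (\<lambda>n. env_proj L \<omega> ` tensors_upto scale n)\<rparr>)"

text \<open>
  \<open>\<phi>\<^sub>\<omega>\<close>. Restricting to functions that are \<open>undefined\<close> outside the carrier makes it unique as a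
  HOL function.
\<close>

definition env_phi ::
    "('v \<Rightarrow> 'v \<Rightarrow> 'v) \<Rightarrow> ('v \<Rightarrow> 'v \<Rightarrow> 'k) \<Rightarrow> ('v, 'k) tensors set \<Rightarrow> nat \<Rightarrow> ('v, 'k) tensors set set" where
  "env_phi L \<omega> = (THE \<phi>.
     \<phi> \<in> alg_hom sym_algebra (assoc_graded (env_algebra L \<omega>)) \<and>
     \<phi> \<in> extensional (carrier sym_algebra) \<and>
     (\<forall>x. \<phi> (sym_proj (pure_tensor scale [x])) =
          gr_class (env_algebra L \<omega>) 1 (env_proj L \<omega> (pure_tensor scale [x]))))"

section \<open>The category \<open>\<RR>\<^sub>g\<^sub>r(S(V))\<close>\<close>

definition R_objects ::
    "(('k, 'a, 'g) graded_filtered \<times> (('v, 'k) tensors set \<Rightarrow> nat \<Rightarrow> 'a set)) set" where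
  "R_objects = {(A, \<phi>). graded_filtered_algebra A \<and>
     \<phi> \<in> alg_hom sym_algebra (assoc_graded A) \<and>
     bij_betw \<phi> (carrier sym_algebra) (carrier (assoc_graded A)) \<and>
     (\<forall>n g. \<phi> ` sym_homog n g = assoc_graded_homog A n g)}"

definition R_morphisms ::
    "('k, 'a, 'g) graded_filtered \<times> (('v, 'k) tensors set \<Rightarrow> nat \<Rightarrow> 'a set) \<Rightarrow>
     ('k, 'b, 'g) graded_filtered \<times> (('v, 'k) tensors set \<Rightarrow> nat \<Rightarrow> 'b set) \<Rightarrow> ('a \<Rightarrow> 'b) set" where
  "R_morphisms X Y = (case (X, Y) of ((A, \<phi>\<^sub>A), (B, \<phi>\<^sub>B)) \<Rightarrow>
     {\<Psi> \<in> alg_hom A B.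
        (\<forall>g. \<Psi> ` homog A g \<subseteq> homog B g) \<and>
        (\<forall>n. \<Psi> ` filt A n \<subseteq> filt B n) \<and>
        (\<forall>s\<in>carrier sym_algebra. assoc_graded_map B \<Psi> (\<phi>\<^sub>A s) = \<phi>\<^sub>B s)})"

definition R_isomorphic ::
    "('k, 'a, 'g) graded_filtered \<times> (('v, 'k) tensors set \<Rightarrow> nat \<Rightarrow> 'a set) \<Rightarrow>
     ('k, 'b, 'g) graded_filtered \<times> (('v, 'k) tensors set \<Rightarrow> nat \<Rightarrow> 'b set) \<Rightarrow> bool" where
  "R_isomorphic X Y \<longleftrightarrow> (\<exists>\<Psi>\<in>R_morphisms X Y. \<exists>\<Psi>'\<in>R_morphisms Y X.
     (\<forall>x\<in>carrier (fst X). \<Psi>' (\<Psi> x) = x) \<and> (\<forall>y\<in>carrier (fst Y). \<Psi> (\<Psi>' y) = y))"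

definition R_iso_classes ::
    "(('k, 'a, 'g) graded_filtered \<times> (('v, 'k) tensors set \<Rightarrow> nat \<Rightarrow> 'a set)) set set" where
  "R_iso_classes = R_objects // {(X, Y). X \<in> R_objects \<and> Y \<in> R_objects \<and> R_isomorphic X Y}"

end

end

theory Submission
  imports Defs
begin

text \<open>
  An object \<open>(A, \<phi>)\<close> is generated by lifts \<open>s v \<in> F\<^sub>1 A\<close> of the vectors \<open>v\<close>. As \<open>S(V)\<close> is color
  commutative, the color commutator of \<open>s a\<close> and \<open>s b\<close> lies in \<open>F\<^sub>1 A = s V \<oplus> \<bbbK> 1\<close>, which defines a
  bracket \<open>L\<close> and a form \<open>\<omega>\<close>; the Jacobi identity and the cocycle condition express the associativity
  of \<open>A\<close>. Another lift differs from \<open>s\<close> by a linear form on \<open>V\<^sub>e\<close>, which changes \<open>\<omega>\<close> by a coboundary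
  and leaves \<open>L\<close> fixed.

  That \<open>U\<^sub>\<omega>(L)\<close> is an object is the Poincare-Birkhoff-Witt theorem, proved by Bergman's method: over an
  ordered homogeneous basis, words are reduced to nondecreasing words without repeated odd letters,
  and the ways of reducing an overlap agree by the Jacobi identity and the cocycle condition. The
  symmetric algebra is the case \<open>L = 0\<close>, \<open>\<omega> = 0\<close>. All algebras are handled as quotients of the free
  algebra \<^typ>\<open>'v list \<Rightarrow>\<^sub>0 'k\<close>, so that computations take place in a type class.
\<close>

section \<open>The free algebra\<close>

text \<open>The comparison of algebras rests on one observation: which words are irreducible depends
  on \<epsilon> and the basis alone, so S(V) and all U_\<omega>(L) share their normal words. A
  reduction step swaps two letters or shortens the word. Hence a normal combination of words of
  length n that falls into filtration degree n - 1 is zero. This makes \<phi>_\<omega> injective,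
  and the same leading term argument makes the map from U_\<omega>(L) to a given object injective.

  T(V) is defined over a free algebra in which every vector is a letter, whereas reduction needs
  basis letters; \<open>expand\<close> mediates between the two.

  Elements of G(A) are families of cosets and awkward to compute with. They are reached only as
  \<open>symbol_map A h p\<close> with p in the free algebra, and \<phi> is known through its
  composite with the projection of the free algebra onto S(V).

  Confluence is proved by comparing defects: relations between overlapping or disjoint pairs show
  that two defects of a word vanish together, and the pair picked by the reduction has defect
  zero.\<close>

abbreviation lookup :: "('w \<Rightarrow>\<^sub>0 'k::zero) \<Rightarrow> 'w \<Rightarrow> 'k" where "lookup \<equiv> Poly_Mapping.lookup"
abbreviation keys :: "('w \<Rightarrow>\<^sub>0 'k::zero) \<Rightarrow> 'w set" where "keys \<equiv> Poly_Mapping.keys"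

definition sm :: "'k::field \<Rightarrow> ('w::monoid_add \<Rightarrow>\<^sub>0 'k) \<Rightarrow> ('w \<Rightarrow>\<^sub>0 'k)" where
  "sm c p = Poly_Mapping.single 0 c * p"

abbreviation mon :: "'w \<Rightarrow> ('w \<Rightarrow>\<^sub>0 'k::field)" where
  "mon w \<equiv> Poly_Mapping.single w 1"

lemma lookup_sm [simp]: "lookup (sm c p) w = c * lookup p w"
  unfolding sm_def mult_map_scale_conv_mult[symmetric]
  by (simp add: Poly_Mapping.map.rep_eq when_def)

lemma sm_single [simp]: "sm c (Poly_Mapping.single w d) = Poly_Mapping.single w (c * d)"
  by (rule poly_mapping_eqI) (simp add: lookup_single when_def)

interpretation smv: vector_space "sm :: 'k::field \<Rightarrow> ('w::monoid_add \<Rightarrow>\<^sub>0 'k) \<Rightarrow> _"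
  by standard (auto intro!: poly_mapping_eqI simp: lookup_add algebra_simps)

lemma free_expand: "p = (\<Sum>w\<in>keys p. sm (lookup p w) (mon w))"
proof (rule poly_mapping_eqI)
  fix v
  have "lookup (\<Sum>w\<in>keys p. sm (lookup p w) (mon w)) v = (\<Sum>w\<in>keys p. if w = v then lookup p w else 0)"
    unfolding lookup_sum by (intro sum.cong) (auto simp: lookup_single when_def)
  then show "lookup p v = lookup (\<Sum>w\<in>keys p. sm (lookup p w) (mon w)) v"
    by (simp add: in_keys_iff)
qed

text \<open>Linear induction on the span of the words in \<open>W\<close>, by which linear
  statements about the free algebra are reduced to words.\<close>

lemma free_induct [consumes 1, case_names zero mon sm add]:
  assumes "keys p \<subseteq> W" "P 0" "\<And>w. w \<in> W \<Longrightarrow> P (mon w)"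
    and "\<And>c p. P p \<Longrightarrow> P (sm c p)" "\<And>p q. P p \<Longrightarrow> P q \<Longrightarrow> P (p + q)"
  shows "P p"
proof -
  have "P (\<Sum>w\<in>S. sm (lookup p w) (mon w))" if "S \<subseteq> W" "finite S" for S
    using that(2,1) by (induction S) (auto simp del: sm_single intro: assms)
  then show ?thesis
    using assms(1) free_expand[of p] by (metis finite_keys)
qed

lemmas free_induct_UNIV = free_induct[OF subset_UNIV, case_names zero mon sm add]

lemma sm_mult_left: "sm c p * q = sm c (p * q)"
  by (simp add: sm_def mult.assoc)

lemma single_zero_commute: "Poly_Mapping.single 0 c * p = p * Poly_Mapping.single 0 c"
  for c :: "'k::field"
proof (induction p rule: free_induct_UNIV)
  case (sm d p)
  have "Poly_Mapping.single 0 c * sm d p = sm d (Poly_Mapping.single 0 c * p)"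
    by (simp add: sm_def mult.assoc[symmetric] mult_single mult.commute)
  then show ?case using sm by (simp add: sm_mult_left)
qed (auto simp: algebra_simps mult_single)

lemma sm_mult_right: "p * sm c q = sm c (p * q)"
  using single_zero_commute[of c p] by (simp add: sm_def mult.assoc[symmetric])

lemmas sm_mult = sm_mult_left sm_mult_right

lemma mon_mult: "mon u * mon v = mon (u + v)"
  by (simp add: mult_single)

lemma mon_append: "mon u * mon v = mon (u @ v)"
  by (simp add: mon_mult plus_list_def)

lemma keys_mult_listE:
  assumes "w \<in> keys (p * q)"
  obtains u v where "w = u @ v" "u \<in> keys p" "v \<in> keys q"
  using assms keys_mult[of p q] by (auto simp: plus_list_def)

lemma keys_subset_closed:
  shows "keys (0 :: 'w::monoid_add \<Rightarrow>\<^sub>0 'k::field) \<subseteq> W"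
    and "keys p \<subseteq> W \<Longrightarrow> keys q \<subseteq> W \<Longrightarrow> keys (p + q) \<subseteq> W"
    and "keys p \<subseteq> W \<Longrightarrow> keys (sm c p) \<subseteq> W"
    and "keys p \<subseteq> W \<Longrightarrow> keys q \<subseteq> W \<Longrightarrow> keys (p - q) \<subseteq> W"
  unfolding subset_iff in_keys_iff lookup_add lookup_minus lookup_sm lookup_zero
  by (metis, metis add_0, metis mult_zero_right, metis diff_0_right)

lemma keys_sum_subset:
  fixes f :: "'i \<Rightarrow> 'w::monoid_add \<Rightarrow>\<^sub>0 'k::field"
  shows "(\<And>i. i \<in> I \<Longrightarrow> keys (f i) \<subseteq> W) \<Longrightarrow> keys (sum f I) \<subseteq> W"
  by (induction I rule: infinite_finite_induct) (simp_all add: keys_subset_closed(2))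

text \<open>Words are a basis of the free algebra, so a function on words extends linearly;
  \<open>reduce\<close> and \<open>vector_part\<close> arise in this way.\<close>

definition lext :: "('k::field \<Rightarrow> 'w::ab_group_add \<Rightarrow> 'w) \<Rightarrow> ('a \<Rightarrow> 'w) \<Rightarrow> ('a::monoid_add \<Rightarrow>\<^sub>0 'k) \<Rightarrow> 'w" where
  "lext sc g p = (\<Sum>w\<in>keys p. sc (lookup p w) (g w))"

context vector_space begin

lemma lext_superset:
  assumes "finite S" "keys p \<subseteq> S"
  shows "lext scale g p = (\<Sum>w\<in>S. lookup p w *s g w)"
  unfolding lext_def using assms by (intro sum.mono_neutral_left) (auto simp: in_keys_iff)

lemma linear_lext: "Vector_Spaces.linear sm scale (lext scale g)"
proof -
  have add: "lext scale g (p + q) = lext scale g p + lext scale g q" for p q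
  proof -
    let ?S = "keys p \<union> keys q \<union> keys (p + q)"
    have "lext scale g r = (\<Sum>w\<in>?S. lookup r w *s g w)" if "r \<in> {p, q, p + q}" for r
      using that by (intro lext_superset) auto
    then show ?thesis
      by (simp add: lookup_add scale_left_distrib sum.distrib)
  qed
  have sm: "lext scale g (sm c p) = c *s lext scale g p" for c p
  proof -
    have "keys (sm c p) \<subseteq> keys p" by (rule keys_subset_closed) simp
    then show ?thesis by (simp add: lext_superset[of "keys p"] scale_sum_right)
  qed
  show ?thesis
    unfolding Vector_Spaces.linear_def module_hom_def module_hom_axioms_def
    using add sm module_axioms smv.module_axioms vector_space_axioms smv.vector_space_axioms by blast
qed

lemma lext_single [simp]: "lext scale g (Poly_Mapping.single w c) = c *s g w"
  by (cases "c = 0") (auto simp: lext_def)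

end

section \<open>Projections onto the words of a given length or degree\<close>

definition pcomp :: "('w \<Rightarrow> bool) \<Rightarrow> ('w::monoid_add \<Rightarrow>\<^sub>0 'k::field) \<Rightarrow> ('w \<Rightarrow>\<^sub>0 'k)" where
  "pcomp P p = (\<Sum>w\<in>{w\<in>keys p. P w}. Poly_Mapping.single w (lookup p w))"

lemma lookup_pcomp [simp]: "lookup (pcomp P p) v = (if P v then lookup p v else 0)"
proof -
  have "lookup (pcomp P p) v = (\<Sum>w\<in>{w\<in>keys p. P w}. if w = v then lookup p w else 0)"
    unfolding pcomp_def lookup_sum by (intro sum.cong) (auto simp: lookup_single when_def)
  then show ?thesis by (auto simp: in_keys_iff)
qed

lemma pcomp_add: "pcomp P (p + q) = pcomp P p + pcomp P q"
  and pcomp_sm: "pcomp P (sm c p) = sm c (pcomp P p)"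
  and pcomp_zero [simp]: "pcomp P 0 = 0"
  and pcomp_diff: "pcomp P (p - q) = pcomp P p - pcomp P q"
  by (auto intro!: poly_mapping_eqI simp: lookup_add lookup_minus)

lemma pcomp_single: "pcomp P (Poly_Mapping.single w c) = (if P w then Poly_Mapping.single w c else 0)"
  by (auto intro!: poly_mapping_eqI simp: lookup_single when_def)

lemma keys_pcomp: "keys (pcomp P p) = {w\<in>keys p. P w}"
  by (auto simp: in_keys_iff split: if_splits)

lemma pcomp_id: "(\<And>w. w \<in> keys p \<Longrightarrow> P w) \<Longrightarrow> pcomp P p = p"
  by (rule poly_mapping_eqI) (metis in_keys_iff lookup_pcomp)

lemma pcomp_none: "(\<And>w. w \<in> keys p \<Longrightarrow> \<not> P w) \<Longrightarrow> pcomp P p = 0"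
  by (rule poly_mapping_eqI) (metis in_keys_iff lookup_pcomp lookup_zero)

lemma pcomp_sum: "pcomp P (sum f I) = (\<Sum>i\<in>I. pcomp P (f i))"
  by (induction I rule: infinite_finite_induct) (auto simp: pcomp_add)

lemma pcomp_sum_fibres:
  assumes "finite S" "f ` keys p \<subseteq> S"
  shows "(\<Sum>s\<in>S. pcomp (\<lambda>w. f w = s) p) = p"
proof (rule poly_mapping_eqI)
  fix v
  have "lookup (\<Sum>s\<in>S. pcomp (\<lambda>w. f w = s) p) v = (\<Sum>s\<in>S. if f v = s then lookup p v else 0)"
    by (simp add: lookup_sum)
  also have "\<dots> = lookup p v"
    using assms by (cases "v \<in> keys p") (auto simp: in_keys_iff)
  finally show "lookup (\<Sum>s\<in>S. pcomp (\<lambda>w. f w = s) p) v = lookup p v" .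
qed

abbreviation lcomp :: "nat \<Rightarrow> ('v list \<Rightarrow>\<^sub>0 'k::field) \<Rightarrow> ('v list \<Rightarrow>\<^sub>0 'k)" where
  "lcomp n \<equiv> pcomp (\<lambda>w. length w = n)"

text \<open>A word of length n splits into a prefix of length i and a rest. The resulting Cauchy
  product has the shape of the product in \<open>assoc_graded\<close>.\<close>

lemma lcomp_mult: "lcomp n (p * q) = (\<Sum>i\<le>n. lcomp i p * lcomp (n - i) q)"
proof (induction p rule: free_induct_UNIV)
  case (mon u)
  show ?case
  proof (induction q rule: free_induct_UNIV)
    case (mon v)
    have "(\<Sum>i\<le>n. lcomp i (mon u) * lcomp (n - i) (mon v) :: 'a list \<Rightarrow>\<^sub>0 'b)
        = (\<Sum>i\<le>n. if i = length u then lcomp (length u) (mon u) * lcomp (n - length u) (mon v) else 0)"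
      by (intro sum.cong) (auto simp: pcomp_single)
    then show ?case
      by (auto simp: pcomp_single mult_single plus_list_def)
  next
    case (sm c q)
    then show ?case by (simp add: sm_mult pcomp_sm smv.scale_sum_right)
  qed (simp_all add: pcomp_add algebra_simps sum.distrib)
qed (simp_all add: pcomp_add pcomp_sm algebra_simps sum.distrib sm_mult smv.scale_sum_right)

section \<open>Algebra homomorphisms out of the free algebra\<close>

lemma free_algebra_simps [simp]:
  "carrier free_algebra = UNIV" "mult free_algebra = (*)" "one free_algebra = 1"
  "zero free_algebra = 0" "add free_algebra = (+)" "smult free_algebra = sm"
  by (auto simp: free_algebra_def sm_def fun_eq_iff)

lemma k_algebra_free: "k_algebra (free_algebra :: ('k::field, 'v list \<Rightarrow>\<^sub>0 'k) module)"
proof -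
  have "ring (free_algebra :: ('k, 'v list \<Rightarrow>\<^sub>0 'k) module)"
    by (rule ringI; (rule abelian_groupI monoid.intro)?)
      (auto simp: algebra_simps monoid_def intro: exI[of _ "- _"] left_minus)
  then show ?thesis
    by (auto simp: k_algebra_def k_algebra_axioms_def sm_mult smv.scale_left_distrib smv.scale_right_distrib)
qed

lemma alg_homD:
  assumes "h \<in> alg_hom A B"
  shows "x \<in> carrier A \<Longrightarrow> h x \<in> carrier B"
    and "x \<in> carrier A \<Longrightarrow> y \<in> carrier A \<Longrightarrow> h (x \<otimes>\<^bsub>A\<^esub> y) = h x \<otimes>\<^bsub>B\<^esub> h y"
    and "x \<in> carrier A \<Longrightarrow> y \<in> carrier A \<Longrightarrow> h (x \<oplus>\<^bsub>A\<^esub> y) = h x \<oplus>\<^bsub>B\<^esub> h y"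
    and "h \<one>\<^bsub>A\<^esub> = \<one>\<^bsub>B\<^esub>"
    and "x \<in> carrier A \<Longrightarrow> h (c \<odot>\<^bsub>A\<^esub> x) = c \<odot>\<^bsub>B\<^esub> h x"
  using assms unfolding alg_hom_def by (auto simp: ring_hom_def)

lemma alg_homI:
  assumes "\<And>x. x \<in> carrier A \<Longrightarrow> h x \<in> carrier B"
    and "\<And>x y. x \<in> carrier A \<Longrightarrow> y \<in> carrier A \<Longrightarrow> h (x \<otimes>\<^bsub>A\<^esub> y) = h x \<otimes>\<^bsub>B\<^esub> h y"
    and "\<And>x y. x \<in> carrier A \<Longrightarrow> y \<in> carrier A \<Longrightarrow> h (x \<oplus>\<^bsub>A\<^esub> y) = h x \<oplus>\<^bsub>B\<^esub> h y"
    and "h \<one>\<^bsub>A\<^esub> = \<one>\<^bsub>B\<^esub>"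
    and "\<And>c x. x \<in> carrier A \<Longrightarrow> h (c \<odot>\<^bsub>A\<^esub> x) = c \<odot>\<^bsub>B\<^esub> h x"
  shows "h \<in> alg_hom A B"
  using assms unfolding alg_hom_def by (auto intro: ring_hom_memI)

lemma alg_hom_comp: "f \<in> alg_hom A B \<Longrightarrow> g \<in> alg_hom B C \<Longrightarrow> (\<lambda>x. g (f x)) \<in> alg_hom A C"
  by (rule alg_homI) (simp_all add: alg_homD)

lemma (in k_algebra) smult_zero: "c \<odot> \<zero> = \<zero>"
  using smult_add_right[of \<zero> \<zero> c] smult_closed[of \<zero> c] by (simp add: add.r_cancel_one')

lemma (in k_algebra) smult_0: "x \<in> carrier A \<Longrightarrow> 0 \<odot> x = \<zero>"
  using smult_add_left[of x 0 0] smult_closed[of x 0] by (simp add: add.r_cancel_one')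

lemma (in k_algebra) smult_minus_one: "x \<in> carrier A \<Longrightarrow> (-1) \<odot> x = \<ominus> x"
  using smult_add_left[of x "-1" 1] smult_closed[of x "-1"] smult_0[of x] smult_one[of x]
  by (simp add: minus_equality)

text \<open>The laws of an algebra are equations and pass to homomorphic images. That zero goes to
  zero is a separate hypothesis: it is no part of \<open>alg_hom\<close>, and B is not yet known to
  be a group.\<close>

lemma k_algebra_surj_image:
  assumes A: "k_algebra A" and h: "h \<in> alg_hom A B" and z: "h \<zero>\<^bsub>A\<^esub> = \<zero>\<^bsub>B\<^esub>"
    and surj: "h ` carrier A = carrier B"
  shows "k_algebra B"
proof -
  interpret A: k_algebra A by fact
  have ex: "\<exists>x\<in>carrier A. y = h x" if "y \<in> carrier B" for y using that surj by auto
  note h = alg_homD[OF h]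
  have 1: "abelian_group B"
  proof (rule abelian_groupI)
    show "x \<oplus>\<^bsub>B\<^esub> y \<in> carrier B" if "x \<in> carrier B" "y \<in> carrier B" for x y
      using ex[OF that(1)] ex[OF that(2)] h(3)[symmetric] by (auto simp: h(1))
    show "\<zero>\<^bsub>B\<^esub> \<in> carrier B" using z h(1)[of "\<zero>\<^bsub>A\<^esub>"] by auto
    show "x \<oplus>\<^bsub>B\<^esub> y \<oplus>\<^bsub>B\<^esub> z = x \<oplus>\<^bsub>B\<^esub> (y \<oplus>\<^bsub>B\<^esub> z)"
      if "x \<in> carrier B" "y \<in> carrier B" "z \<in> carrier B" for x y z
      using ex[OF that(1)] ex[OF that(2)] ex[OF that(3)] h(3)[symmetric] by (auto simp: A.a_assoc)
    show "x \<oplus>\<^bsub>B\<^esub> y = y \<oplus>\<^bsub>B\<^esub> x" if "x \<in> carrier B" "y \<in> carrier B" for x y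
      using ex[OF that(1)] ex[OF that(2)] h(3)[symmetric] by (auto simp: A.a_comm)
    show "\<zero>\<^bsub>B\<^esub> \<oplus>\<^bsub>B\<^esub> x = x" if "x \<in> carrier B" for x
      using ex[OF that(1)] h(3)[symmetric] by (auto simp: z[symmetric])
    show "\<exists>y\<in>carrier B. y \<oplus>\<^bsub>B\<^esub> x = \<zero>\<^bsub>B\<^esub>" if x: "x \<in> carrier B" for x
    proof -
      obtain a where a: "a \<in> carrier A" "x = h a" using ex[OF x] by auto
      then have "h (\<ominus>\<^bsub>A\<^esub> a) \<oplus>\<^bsub>B\<^esub> x = \<zero>\<^bsub>B\<^esub>"
        using h(3)[of "\<ominus>\<^bsub>A\<^esub> a" a] z by (simp add: A.l_neg)
      then show ?thesis using a h(1)[of "\<ominus>\<^bsub>A\<^esub> a"] by blast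
    qed
  qed
  have 2: "Group.monoid B"
  proof (rule monoidI)
    show "x \<otimes>\<^bsub>B\<^esub> y \<in> carrier B" if "x \<in> carrier B" "y \<in> carrier B" for x y
      using ex[OF that(1)] ex[OF that(2)] h(2)[symmetric] by (auto simp: h(1))
    show "\<one>\<^bsub>B\<^esub> \<in> carrier B" using h(4) h(1)[of "\<one>\<^bsub>A\<^esub>"] by auto
    show "x \<otimes>\<^bsub>B\<^esub> y \<otimes>\<^bsub>B\<^esub> z = x \<otimes>\<^bsub>B\<^esub> (y \<otimes>\<^bsub>B\<^esub> z)"
      if "x \<in> carrier B" "y \<in> carrier B" "z \<in> carrier B" for x y z
      using ex[OF that(1)] ex[OF that(2)] ex[OF that(3)] h(2)[symmetric] by (auto simp: A.m_assoc)
    show "\<one>\<^bsub>B\<^esub> \<otimes>\<^bsub>B\<^esub> x = x" "x \<otimes>\<^bsub>B\<^esub> \<one>\<^bsub>B\<^esub> = x" if "x \<in> carrier B" for x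
      using ex[OF that(1)] h(2)[symmetric] by (auto simp: h(4)[symmetric])
  qed
  have 3: "(x \<oplus>\<^bsub>B\<^esub> y) \<otimes>\<^bsub>B\<^esub> z = x \<otimes>\<^bsub>B\<^esub> z \<oplus>\<^bsub>B\<^esub> y \<otimes>\<^bsub>B\<^esub> z"
    "z \<otimes>\<^bsub>B\<^esub> (x \<oplus>\<^bsub>B\<^esub> y) = z \<otimes>\<^bsub>B\<^esub> x \<oplus>\<^bsub>B\<^esub> z \<otimes>\<^bsub>B\<^esub> y"
    if xyz: "x \<in> carrier B" "y \<in> carrier B" "z \<in> carrier B" for x y z
    using ex[OF xyz(1)] ex[OF xyz(2)] ex[OF xyz(3)]
    by (auto simp: h(2,3)[symmetric] A.l_distr A.r_distr)
  have "ring B" using 1 2 3 by (intro ringI) auto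
  moreover have "k_algebra_axioms B"
  proof
    fix x c d assume x: "x \<in> carrier B"
    then obtain a where a: "a \<in> carrier A" "x = h a" using ex by auto
    show "c \<odot>\<^bsub>B\<^esub> x \<in> carrier B" "1 \<odot>\<^bsub>B\<^esub> x = x"
      "(c + d) \<odot>\<^bsub>B\<^esub> x = c \<odot>\<^bsub>B\<^esub> x \<oplus>\<^bsub>B\<^esub> d \<odot>\<^bsub>B\<^esub> x" "(c * d) \<odot>\<^bsub>B\<^esub> x = c \<odot>\<^bsub>B\<^esub> (d \<odot>\<^bsub>B\<^esub> x)"
      using a by (simp_all add: h(3,5)[symmetric] h(1) A.smult_closed A.smult_add_left A.smult_smult A.smult_one)
    fix y assume "y \<in> carrier B"
    then obtain b where b: "b \<in> carrier A" "y = h b" using ex by auto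
    show "c \<odot>\<^bsub>B\<^esub> (x \<oplus>\<^bsub>B\<^esub> y) = c \<odot>\<^bsub>B\<^esub> x \<oplus>\<^bsub>B\<^esub> c \<odot>\<^bsub>B\<^esub> y"
      "(c \<odot>\<^bsub>B\<^esub> x) \<otimes>\<^bsub>B\<^esub> y = c \<odot>\<^bsub>B\<^esub> (x \<otimes>\<^bsub>B\<^esub> y)" "x \<otimes>\<^bsub>B\<^esub> (c \<odot>\<^bsub>B\<^esub> y) = c \<odot>\<^bsub>B\<^esub> (x \<otimes>\<^bsub>B\<^esub> y)"
      using a b by (simp_all add: h(2,3,5)[symmetric] A.smult_closed A.smult_add_right
          A.smult_mult_left A.smult_mult_right)
  qed
  ultimately show ?thesis by (simp add: k_algebra_def)
qed

lemma a_minus_free [simp]: "p \<ominus>\<^bsub>free_algebra\<^esub> q = p - q"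
proof -
  interpret k_algebra free_algebra by (rule k_algebra_free)
  show ?thesis
    using r_neg[of q] minus_equality[of "- q" q] by (simp add: a_minus_def)
qed

locale free_hom = A: k_algebra A for A :: "('k::field, 'a, 'm) module_scheme" (structure) +
  fixes h :: "('v list \<Rightarrow>\<^sub>0 'k) \<Rightarrow> 'a"
  assumes hom: "h \<in> alg_hom free_algebra A"
begin

lemma closed [simp]: "h p \<in> carrier A"
  and mult: "h (p * q) = h p \<otimes> h q"
  and add: "h (p + q) = h p \<oplus> h q"
  and one: "h 1 = \<one>"
  and sm: "h (sm c p) = c \<odot> h p"
  using alg_homD[OF hom] by auto

lemma zero: "h 0 = \<zero>"
  using sm[of 0 0] by (simp add: A.smult_0)

lemma uminus: "h (- p) = \<ominus> h p"
  using add[of "- p" p] by (simp add: zero A.minus_equality)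

lemma diff: "h (p - q) = h p \<ominus> h q"
  using add[of p "- q"] by (simp add: uminus a_minus_def)

lemma eq_iff: "h p = h q \<longleftrightarrow> h (p - q) = \<zero>"
  by (metis A.add.inv_closed A.add.inv_inv A.add.r_inv A.minus_equality A.minus_eq closed diff)

lemma sum: "finite I \<Longrightarrow> h (sum f I) = (\<Oplus>i\<in>I. h (f i))"
  by (induction I rule: finite_induct) (auto simp: zero add A.finsum_insert)

lemma ideal_kernel: "h p = \<zero> \<Longrightarrow> h (u * p * v) = \<zero>"
  by (simp add: mult)

text \<open>Congruence rules for the kernel relation of h: computations modulo the relations of A
  are carried out on representatives in the free algebra.\<close>

lemma eq_mult: "h p = h q \<Longrightarrow> h r = h s \<Longrightarrow> h (p * r) = h (q * s)"
  and eq_add: "h p = h q \<Longrightarrow> h r = h s \<Longrightarrow> h (p + r) = h (q + s)"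
  and eq_diff: "h p = h q \<Longrightarrow> h r = h s \<Longrightarrow> h (p - r) = h (q - s)"
  and eq_sm: "h p = h q \<Longrightarrow> h (sm c p) = h (sm c q)"
  by (simp_all add: mult add diff sm)

lemma eq_sum: "(\<And>i. i \<in> I \<Longrightarrow> h (f i) = h (g i)) \<Longrightarrow> h (sum f I) = h (sum g I)"
  by (induction I rule: infinite_finite_induct) (auto simp: add)

end

lemma free_homI: "k_algebra A \<Longrightarrow> h \<in> alg_hom free_algebra A \<Longrightarrow> free_hom A h"
  by (simp add: free_hom_def free_hom_axioms_def)

text \<open>The target is an arbitrary record: this is also applied to associated graded algebras, which
  are never shown to be algebras.\<close>

lemma alg_hom_free_eqI:
  fixes f g :: "('v list \<Rightarrow>\<^sub>0 'k::field) \<Rightarrow> 'x"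
  assumes f: "f \<in> alg_hom free_algebra X" and g: "g \<in> alg_hom free_algebra X"
    and eq: "\<And>v. v \<in> W \<Longrightarrow> f (mon [v]) = g (mon [v])"
    and p: "keys p \<subseteq> lists W"
  shows "f p = g p"
proof -
  have zero: "f 0 = 0 \<odot>\<^bsub>X\<^esub> f 1" "g 0 = 0 \<odot>\<^bsub>X\<^esub> g 1"
    using alg_homD(5)[OF f, of 1 0] alg_homD(5)[OF g, of 1 0] by auto
  have one: "f 1 = g 1" using alg_homD(4)[OF f] alg_homD(4)[OF g] by simp
  show ?thesis using p
  proof (induction p rule: free_induct)
    case (mon w)
    then show ?case
    proof (induction w)
      case Nil
      then show ?case using one by (simp add: zero_list_def[symmetric])
    next
      case (Cons a w)
      have "mon (a # w) = mon [a] * (mon w :: _ \<Rightarrow>\<^sub>0 'k)" by (simp add: mon_mult plus_list_def)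
      then show ?case
        using Cons alg_homD(2)[OF f] alg_homD(2)[OF g] eq by auto
    qed
  qed (use zero one alg_homD[OF f] alg_homD[OF g] in auto)
qed

definition alift :: "('k::field, 'a, 'm) module_scheme \<Rightarrow> ('v \<Rightarrow> 'a) \<Rightarrow> ('v list \<Rightarrow>\<^sub>0 'k) \<Rightarrow> 'a" where
  "alift A f p = (\<Oplus>\<^bsub>A\<^esub>w\<in>keys p. lookup p w \<odot>\<^bsub>A\<^esub> foldr (\<lambda>v x. f v \<otimes>\<^bsub>A\<^esub> x) w \<one>\<^bsub>A\<^esub>)"

context k_algebra begin

context
  fixes f :: "'v \<Rightarrow> 'a"
  assumes f: "\<And>v. f v \<in> carrier A"
begin

abbreviation (input) "wprod w \<equiv> foldr (\<lambda>v x. f v \<otimes> x) w \<one>"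

lemma wprod_closed: "wprod w \<in> carrier A"
  by (induction w) (auto intro: f)

lemma wprod_append: "wprod (u @ v) = wprod u \<otimes> wprod v"
  by (induction u) (auto simp: wprod_closed f m_assoc)

lemma alift_superset:
  assumes "finite S" "keys p \<subseteq> S"
  shows "alift A f p = (\<Oplus>w\<in>S. lookup p w \<odot> wprod w)"
  unfolding alift_def using assms
  by (intro add.finprod_mono_neutral_cong_left)
    (auto simp: in_keys_iff wprod_closed smult_closed smult_0)

lemma alift_add: "alift A f (p + q) = alift A f p \<oplus> alift A f q"
proof -
  let ?S = "keys p \<union> keys q \<union> keys (p + q)"
  have "alift A f r = (\<Oplus>w\<in>?S. lookup r w \<odot> wprod w)" if "r \<in> {p, q, p + q}" for r
    using that by (intro alift_superset) auto
  then show ?thesis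
    by (simp add: lookup_add smult_add_left wprod_closed smult_closed finsum_addf Pi_def)
qed

lemma alift_single: "alift A f (Poly_Mapping.single w c) = c \<odot> wprod w"
proof (cases "c = 0")
  case False
  then show ?thesis
    by (simp add: alift_def finsum_insert[of "{}"] smult_closed wprod_closed)
qed (simp add: alift_def smult_0 wprod_closed)

lemma alift_closed: "alift A f p \<in> carrier A"
  unfolding alift_def by (intro finsum_closed) (auto intro: smult_closed wprod_closed)

lemma alift_zero: "alift A f 0 = \<zero>"
  by (simp add: alift_def)

lemma alift_sm: "alift A f (sm c p) = c \<odot> alift A f p"
proof (induction p arbitrary: c rule: free_induct_UNIV)
  case (sm d p)
  have "alift A f (sm c (sm d p)) = (c * d) \<odot> alift A f p"
    using sm.IH[of "c * d"] by simp
  then show ?case using sm.IH[of d] by (simp add: smult_smult alift_closed)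
qed (simp_all add: alift_zero smult_zero alift_single smult_one wprod_closed
    smv.scale_right_distrib alift_add smult_add_right alift_closed)

lemma alift_mult: "alift A f (p * q) = alift A f p \<otimes> alift A f q"
proof (induction p rule: free_induct_UNIV)
  case (mon u)
  show ?case
  proof (induction q rule: free_induct_UNIV)
    case (mon v)
    show ?case
      by (simp add: mon_mult alift_single plus_list_def wprod_append wprod_closed smult_one del: foldr_append)
  qed (simp_all add: alift_zero alift_closed alift_add alift_sm r_distr smult_mult_right sm_mult distrib_left)
qed (simp_all add: alift_zero alift_closed alift_add alift_sm l_distr smult_mult_left sm_mult distrib_right)

lemma alift_hom: "alift A f \<in> alg_hom free_algebra A"
proof (rule alg_homI)
  show "alift A f \<one>\<^bsub>free_algebra\<^esub> = \<one>"
    using alift_single[of 0 1] unfolding single_one by (simp add: zero_list_def smult_one)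
qed (auto simp: alift_closed alift_mult alift_add alift_sm)

lemma alift_mon: "alift A f (mon [v]) = f v"
  by (simp add: alift_single f smult_one)

end

end

section \<open>Color spaces and homogeneous bases\<close>

text \<open>The order on letters to which "nondecreasing" refers, obtained from the well-ordering
  theorem. Termination of the reduction is controlled by the number of inversions with respect to
  it.\<close>

definition wo_less :: "'v \<Rightarrow> 'v \<Rightarrow> bool" where
  "wo_less x y \<longleftrightarrow> (x, y) \<in> (SOME r. well_order_on UNIV r) \<and> x \<noteq> y"

lemma wo_less_linear: "\<not> wo_less x x" "wo_less x y \<Longrightarrow> wo_less y z \<Longrightarrow> wo_less x z" "wo_less x y \<or> x = y \<or> wo_less y x" 
  and wo_less_asym: "wo_less x y \<Longrightarrow> \<not> wo_less y x"
proof -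
  have "well_order_on (UNIV :: 'a set) (SOME r. well_order_on UNIV r)"
    by (rule someI_ex) (rule well_order_on)
  then have l: "linear_order_on (UNIV :: 'a set) (SOME r. well_order_on UNIV r)"
    by (simp add: well_order_on_def)
  show "\<not> wo_less x x" for x :: 'a by (simp add: wo_less_def)
  show "wo_less x y \<or> x = y \<or> wo_less y x" for x y :: 'a
    using l by (auto simp: wo_less_def linear_order_on_def total_on_def)
  show as: "\<not> wo_less y x" if "wo_less x y" for x y :: 'a
    using l that by (auto simp: wo_less_def linear_order_on_def partial_order_on_def antisym_def)
  show "wo_less x z" if "wo_less x y" "wo_less y z" for x y z :: 'a
    using l that as[of y z] unfolding wo_less_def linear_order_on_def partial_order_on_def preorder_on_def trans_def
    by blast
qed

fun inversions :: "'v list \<Rightarrow> nat" where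
  "inversions [] = 0"
| "inversions (x # xs) = length (filter (\<lambda>y. wo_less y x) xs) + inversions xs"

text \<open>A swap of neighbours changes the relative position of no other two letters, so exactly
  one inversion disappears.\<close>

lemma inversions_swap: "wo_less b a \<Longrightarrow> inversions (u @ b # a # v) < inversions (u @ a # b # v)"
  by (induction u) (auto dest: wo_less_asym)

locale color_space = vector_space scale
  for scale :: "'k::field_char_0 \<Rightarrow> 'v::ab_group_add \<Rightarrow> 'v" (infixr \<open>*s\<close> 75) +
  fixes \<epsilon> :: "'g::ab_group_add \<Rightarrow> 'g \<Rightarrow> 'k" and V :: "'g \<Rightarrow> 'v set"
  assumes bichar: "antisymmetric_bicharacter \<epsilon>" and gvs: "graded_vector_space scale V"
begin

lemma eps_nz [simp]: "\<epsilon> g h \<noteq> 0"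
  and eps_inv: "\<epsilon> g h * \<epsilon> h g = 1"
  and eps_add: "\<epsilon> g (h + k) = \<epsilon> g h * \<epsilon> g k" "\<epsilon> (g + h) k = \<epsilon> g k * \<epsilon> h k"
  using bichar by (auto simp: antisymmetric_bicharacter_def)

lemma eps_zero [simp]: "\<epsilon> g 0 = 1" "\<epsilon> 0 g = 1"
  using eps_add(1)[of g 0 0] eps_add(2)[of 0 0 g] by auto

lemma eps_self: "\<epsilon> g g = 1 \<or> \<epsilon> g g = - 1"
  using eps_inv[of g g] by (metis square_eq_1_iff)

lemma subspace_V: "subspace (V g)"
  using gvs by (simp add: graded_vector_space_def)

lemmas V_closed = subspace_0[OF subspace_V] subspace_add[OF subspace_V] subspace_scale[OF subspace_V]
  subspace_neg[OF subspace_V] subspace_diff[OF subspace_V] subspace_sum[OF subspace_V]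

lemma V_ex1: "\<exists>!f. (\<forall>g. f g \<in> V g) \<and> finite {g. f g \<noteq> 0} \<and> x = (\<Sum>g\<in>{g. f g \<noteq> 0}. f g)"
  using gvs by (simp add: graded_vector_space_def)

lemma V_decomp_single:
  assumes "x \<in> V g" "\<And>h. f h \<in> V h" "finite {h. f h \<noteq> 0}" "x = (\<Sum>h\<in>{h. f h \<noteq> 0}. f h)"
  shows "f = (\<lambda>h. if h = g then x else 0)"
proof -
  let ?f = "\<lambda>h. if h = g then x else 0"
  have "{h. ?f h \<noteq> 0} \<subseteq> {g}" by auto
  then have fin: "finite {h. ?f h \<noteq> 0}" using finite_subset by blast
  have "(\<Sum>h\<in>{h. ?f h \<noteq> 0}. ?f h) = x" by (cases "x = 0") auto
  then have "x = (\<Sum>h\<in>{h. ?f h \<noteq> 0}. ?f h)" by simp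
  moreover have "\<forall>h. ?f h \<in> V h" using assms(1) V_closed(1) by simp
  moreover have "\<forall>h. f h \<in> V h" using assms(2) by simp
  moreover obtain f0 where
    "\<And>f. (\<forall>g. f g \<in> V g) \<and> finite {g. f g \<noteq> 0} \<and> x = (\<Sum>g\<in>{g. f g \<noteq> 0}. f g) \<Longrightarrow> f = f0"
    using V_ex1[of x] by blast
  from this[of ?f] this[of f] show ?thesis
    using assms(3,4) fin calculation by blast
qed

lemma V_unique:
  assumes "x \<in> V g" "x \<in> V h" "x \<noteq> 0"
  shows "g = h"
proof -
  let ?f = "\<lambda>k. if k = h then x else 0"
  have "{k. ?f k \<noteq> 0} = {h}" using assms by auto
  then have "?f = (\<lambda>k. if k = g then x else 0)"
    using assms by (intro V_decomp_single) (simp_all add: V_closed)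
  from fun_cong[OF this, of g] show ?thesis using assms by (auto split: if_splits)
qed

definition hB :: "'v set" where
  "hB = (SOME B. B \<subseteq> (\<Union>g. V g) \<and> independent B \<and> (\<Union>g. V g) \<subseteq> span B)"

lemma hB: "hB \<subseteq> (\<Union>g. V g)" "independent hB" "(\<Union>g. V g) \<subseteq> span hB"
proof -
  have "\<exists>B. B \<subseteq> (\<Union>g. V g) \<and> independent B \<and> (\<Union>g. V g) \<subseteq> span B"
    by (metis maximal_independent_subset)
  from someI_ex[OF this] show "hB \<subseteq> (\<Union>g. V g)" "independent hB" "(\<Union>g. V g) \<subseteq> span hB"
    unfolding hB_def by blast+
qed

lemma span_V: "x \<in> span (\<Union>g. V g)"
proof -
  obtain f where f: "\<forall>g. f g \<in> V g" "x = (\<Sum>g\<in>{g. f g \<noteq> 0}. f g)" using V_ex1[of x] by blast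
  then show ?thesis by (auto intro!: span_sum intro: span_base)
qed

lemma span_hB: "x \<in> span hB"
  using span_V span_minimal[OF hB(3) subspace_span] by blast

definition deg :: "'v \<Rightarrow> 'g" where "deg b = (THE g. b \<in> V g)"

lemma hB_nz: "b \<in> hB \<Longrightarrow> b \<noteq> 0"
  using hB(2) dependent_zero by blast

lemma deg_eq: "b \<in> V g \<Longrightarrow> b \<noteq> 0 \<Longrightarrow> deg b = g"
  unfolding deg_def by (rule the_equality) (auto dest: V_unique)

lemma hB_V: "b \<in> hB \<Longrightarrow> b \<in> V (deg b)"
  using hB(1) deg_eq hB_nz by blast

abbreviation coord :: "'v \<Rightarrow> 'v \<Rightarrow> 'k" where "coord \<equiv> representation hB"

lemma coord_hB: "coord v b \<noteq> 0 \<Longrightarrow> b \<in> hB"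
  by (rule representation_ne_zero)

lemma sum_coord: "(\<Sum>b | coord v b \<noteq> 0. coord v b *s b) = v"
  by (rule sum_nonzero_representation_eq[OF hB(2) span_hB])

text \<open>Sorting the expansion of a vector over \<open>hB\<close> by degree yields a homogeneous
  decomposition; by uniqueness only the part of degree g survives if the vector lies in
  \<open>V g\<close>.\<close>

lemma V_span_hB: "V g \<subseteq> span (hB \<inter> V g)"
proof
  fix v assume v: "v \<in> V g"
  let ?S = "{b. coord v b \<noteq> 0}"
  define f where "f h = (\<Sum>b | coord v b \<noteq> 0 \<and> deg b = h. coord v b *s b)" for h
  have fin: "finite ?S" by (rule finite_representation)
  have fV: "f h \<in> V h" for h
    unfolding f_def by (intro V_closed) (auto dest: coord_hB hB_V)
  have sub: "{h. f h \<noteq> 0} \<subseteq> deg ` ?S"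
  proof -
    have "f h = 0" if "h \<notin> deg ` ?S" for h
      unfolding f_def using that by (intro sum.neutral) auto
    then show ?thesis by blast
  qed
  have "v = (\<Sum>h\<in>deg ` ?S. f h)"
    using sum.image_gen[OF fin, of "\<lambda>b. coord v b *s b" deg] sum_coord[of v]
    by (simp add: f_def)
  also have "\<dots> = (\<Sum>h\<in>{h. f h \<noteq> 0}. f h)"
    using sub fin by (intro sum.mono_neutral_right) auto
  finally have "f = (\<lambda>h. if h = g then v else 0)"
    using V_decomp_single[OF v] fV sub fin finite_subset by blast
  then have "v = f g" by simp
  also have "\<dots> \<in> span (hB \<inter> V g)"
    unfolding f_def by (intro span_sum span_scale span_base) (auto dest: coord_hB hB_V)
  finally show "v \<in> span (hB \<inter> V g)" .
qed

lemma coord_deg: 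
  assumes "v \<in> V g" "coord v b \<noteq> 0"
  shows "deg b = g"
proof -
  have "coord v = representation (hB \<inter> V g) v"
    using assms V_span_hB by (intro representation_extend hB) auto
  then have "b \<in> hB \<inter> V g" using assms representation_ne_zero by metis
  then show ?thesis by (simp add: deg_eq hB_nz)
qed

lemma V_induct [consumes 1, case_names basis zero add scale]:
  assumes "v \<in> V g" and "\<And>b. b \<in> hB \<Longrightarrow> b \<in> V g \<Longrightarrow> P b" and "P 0"
    and "\<And>x y. x \<in> V g \<Longrightarrow> y \<in> V g \<Longrightarrow> P x \<Longrightarrow> P y \<Longrightarrow> P (x + y)"
    and "\<And>c x. x \<in> V g \<Longrightarrow> P x \<Longrightarrow> P (c *s x)"
  shows "P v"
proof -
  have "span (hB \<inter> V g) \<subseteq> {x \<in> V g. P x}"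
    using assms by (intro span_minimal) (auto simp: subspace_def V_closed)
  then show ?thesis using assms(1) V_span_hB by blast
qed

lemma all_induct [case_names hom zero add scale]:
  assumes "\<And>x g. x \<in> V g \<Longrightarrow> P x" and "P 0" and "\<And>x y. P x \<Longrightarrow> P y \<Longrightarrow> P (x + y)"
    and "\<And>c x. P x \<Longrightarrow> P (c *s x)"
  shows "P v"
proof -
  have "span (\<Union>g. V g) \<subseteq> {x. P x}"
    using assms by (intro span_minimal) (auto simp: subspace_def)
  then show ?thesis using span_V by blast
qed

sublocale vsm: vector_space_pair scale "sm :: 'k \<Rightarrow> ('v list \<Rightarrow>\<^sub>0 'k) \<Rightarrow> _"
  by unfold_locales

text \<open>A vector written in basis letters. As the words over \<open>hB\<close> are a basis of
  T(V), this is the inclusion of V into T(V), seen inside the free algebra.\<close>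

definition e :: "'v \<Rightarrow> 'v list \<Rightarrow>\<^sub>0 'k" where "e = vsm.construct hB (\<lambda>b. mon [b])"

lemma linear_e: "Vector_Spaces.linear scale sm e"
  unfolding e_def by (rule vsm.linear_construct[OF hB(2)])

lemma e_add: "e (x + y) = e x + e y" and e_scale: "e (c *s x) = sm c (e x)" and e_0 [simp]: "e 0 = 0"
  by (rule vsm.linear_add[OF linear_e] vsm.linear_scale[OF linear_e] vsm.linear_0[OF linear_e])+

lemma e_basis: "b \<in> hB \<Longrightarrow> e b = mon [b]"
  unfolding e_def by (rule vsm.construct_basis[OF hB(2)])

lemma e_expand: "e v = (\<Sum>b | coord v b \<noteq> 0. sm (coord v b) (mon [b]))"
proof -
  have "e v = e (\<Sum>b | coord v b \<noteq> 0. coord v b *s b)" by (simp add: sum_coord)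
  also have "\<dots> = (\<Sum>b | coord v b \<noteq> 0. sm (coord v b) (mon [b]))"
    unfolding vsm.linear_sum[OF linear_e]
    by (intro sum.cong) (auto simp: e_scale e_basis dest!: coord_hB)
  finally show ?thesis .
qed

lemma keys_e: "keys (e v) \<subseteq> {[b] | b. b \<in> hB \<and> coord v b \<noteq> 0}"
  unfolding e_expand by (intro keys_sum_subset keys_subset_closed) (auto dest: coord_hB)

end

text \<open>The multiplicities 2 and 3 are those with which a defect can occur in the relations used
  for \<open>defect_red\<close> when odd letters are repeated.\<close>

lemma sum_eq_zero_char_0:
  fixes x :: "'w::monoid_add \<Rightarrow>\<^sub>0 'k::field_char_0"
  shows "x + x = 0 \<Longrightarrow> x = 0" and "x + x + x = 0 \<Longrightarrow> x = 0"
proof -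
  have "x + x = sm 2 x" by (auto intro!: poly_mapping_eqI simp: lookup_add)
  then show "x + x = 0 \<Longrightarrow> x = 0" by (simp add: smv.scale_eq_0_iff)
  have "x + x + x = sm 3 x" by (auto intro!: poly_mapping_eqI simp: lookup_add)
  then show "x + x + x = 0 \<Longrightarrow> x = 0" by (simp add: smv.scale_eq_0_iff)
qed

section \<open>The diamond lemma for color Lie algebras\<close>

text \<open>Two paths of three swaps each lead from \<open>C * A * B\<close> to
  \<open>B * A * C\<close> around the hexagon of the six orders. In the difference all cubic terms
  cancel and commutators of one factor with the bracket of the other two remain; X, Y, Z stand for
  [a,b], [c,a], [c,b]. The hypotheses on the scalars make the linear terms cancel.\<close>

lemma hexagon_identity:
  fixes A B C X Y Z :: "'w::monoid_add \<Rightarrow>\<^sub>0 'k::field"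
  assumes "s * t * wab = wab" "q * t * wca = wca" "q * wcb = s * wcb"
  shows "(C * A - sm s (A * C) - Y - sm wca 1) * B + sm s (A * (C * B - sm t (B * C) - Z - sm wcb 1))
    + sm (s * t) ((A * B - sm q (B * A) - X - sm wab 1) * C)
    - C * (A * B - sm q (B * A) - X - sm wab 1) - sm q ((C * B - sm t (B * C) - Z - sm wcb 1) * A)
    - sm (q * t) (B * (C * A - sm s (A * C) - Y - sm wca 1))
    = (C * X - sm (s * t) (X * C)) - (Y * B - sm (q * t) (B * Y)) - (sm s (A * Z) - sm q (Z * A))"
  unfolding right_diff_distrib left_diff_distrib sm_mult smv.scale_right_diff_distrib
      smv.scale_right_distrib smv.scale_scale mult.assoc mult_1_left mult_1_right assms[unfolded mult.assoc]
  by (simp add: algebra_simps)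

locale color_Lie = color_space scale \<epsilon> V
  for scale :: "'k::field_char_0 \<Rightarrow> 'v::ab_group_add \<Rightarrow> 'v" (infixr \<open>*s\<close> 75)
    and \<epsilon> :: "'g::ab_group_add \<Rightarrow> 'g \<Rightarrow> 'k" and V :: "'g \<Rightarrow> 'v set" +
  fixes L :: "'v \<Rightarrow> 'v \<Rightarrow> 'v" and \<omega> :: "'v \<Rightarrow> 'v \<Rightarrow> 'k"
  assumes L: "L \<in> color_Lie_structures \<epsilon> scale V" and \<omega>: "\<omega> \<in> Z2_gr \<epsilon> scale V L"
begin

lemma linL: "Vector_Spaces.linear scale scale (L x)" "Vector_Spaces.linear scale scale (\<lambda>x. L x y)"
  and lin\<omega>: "Vector_Spaces.linear scale (*) (\<omega> x)" "Vector_Spaces.linear scale (*) (\<lambda>x. \<omega> x y)"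
proof -
  have "bilinear_map scale scale L" using L unfolding color_Lie_structures_def by blast
  then show "Vector_Spaces.linear scale scale (L x)" "Vector_Spaces.linear scale scale (\<lambda>x. L x y)"
    unfolding bilinear_map_def by blast+
  have "bilinear_map scale (*) \<omega>" using \<omega> unfolding Z2_gr_def by blast
  then show "Vector_Spaces.linear scale (*) (\<omega> x)" "Vector_Spaces.linear scale (*) (\<lambda>x. \<omega> x y)"
    unfolding bilinear_map_def by blast+
qed

lemma L_add: "L x (y + z) = L x y + L x z" "L (x + y) z = L x z + L y z"
  and L_scale: "L x (c *s y) = c *s L x y" "L (c *s x) y = c *s L x y"
  and L_0: "L x 0 = 0" "L 0 x = 0"
  and L_neg: "L x (- y) = - L x y"
proof -
  interpret A: Vector_Spaces.linear scale scale "L x" by (rule linL)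
  show "L x (y + z) = L x y + L x z" "L x (c *s y) = c *s L x y" "L x 0 = 0"
    "L x (- y) = - L x y"
    by (auto simp: A.add A.scale A.zero A.neg)
next
  interpret A: Vector_Spaces.linear scale scale "\<lambda>x. L x z" for z by (rule linL)
  show "L (x + y) z = L x z + L y z" "L (c *s x) y = c *s L x y" "L 0 x = 0"
    using A.add A.scale A.zero by auto
qed

lemma \<omega>_add: "\<omega> x (y + z) = \<omega> x y + \<omega> x z" "\<omega> (x + y) z = \<omega> x z + \<omega> y z"
  and \<omega>_scale: "\<omega> x (c *s y) = c * \<omega> x y" "\<omega> (c *s x) y = c * \<omega> x y"
  and \<omega>_0: "\<omega> x 0 = 0" "\<omega> 0 x = 0"
  and \<omega>_neg: "\<omega> x (- y) = - \<omega> x y"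
proof -
  interpret A: Vector_Spaces.linear scale "(*)" "\<omega> x" by (rule lin\<omega>)
  show "\<omega> x (y + z) = \<omega> x y + \<omega> x z" "\<omega> x (c *s y) = c * \<omega> x y" "\<omega> x 0 = 0"
    "\<omega> x (- y) = - \<omega> x y"
    by (auto simp: A.add A.scale A.zero A.neg)
next
  interpret A: Vector_Spaces.linear scale "(*)" "\<lambda>x. \<omega> x z" for z by (rule lin\<omega>)
  show "\<omega> (x + y) z = \<omega> x z + \<omega> y z" "\<omega> (c *s x) y = c * \<omega> x y" "\<omega> 0 x = 0"
    using A.add A.scale A.zero by auto
qed

lemma L_V: "a \<in> V g \<Longrightarrow> b \<in> V h \<Longrightarrow> L a b \<in> V (g + h)"
  and L_anti: "a \<in> V g \<Longrightarrow> b \<in> V h \<Longrightarrow> L a b = - (\<epsilon> g h *s L b a)"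
  and L_cyc: "a \<in> V g \<Longrightarrow> b \<in> V h \<Longrightarrow> c \<in> V k \<Longrightarrow>
    \<epsilon> k g *s L a (L b c) + \<epsilon> g h *s L b (L c a) + \<epsilon> h k *s L c (L a b) = 0"
  using L unfolding color_Lie_structures_def by blast+

lemma \<omega>_V: "a \<in> V g \<Longrightarrow> b \<in> V h \<Longrightarrow> g + h \<noteq> 0 \<Longrightarrow> \<omega> a b = 0"
  and \<omega>_anti: "a \<in> V g \<Longrightarrow> b \<in> V h \<Longrightarrow> \<omega> a b = - \<epsilon> g h * \<omega> b a"
  and \<omega>_cyc: "a \<in> V g \<Longrightarrow> b \<in> V h \<Longrightarrow> c \<in> V k \<Longrightarrow>
    \<epsilon> k g * \<omega> a (L b c) + \<epsilon> g h * \<omega> b (L c a) + \<epsilon> h k * \<omega> c (L a b) = 0"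
  using \<omega> unfolding Z2_gr_def by blast+

text \<open>The Jacobi identity says that bracketing with c is a color derivation; this form, and
  its analogue for \<omega> below, matches the right side of the hexagon.\<close>

lemma L_leibniz:
  assumes "a \<in> V g" "b \<in> V h" "c \<in> V k"
  shows "L c (L a b) = L (L c a) b + \<epsilon> k g *s L a (L c b)"
proof -
  have 1: "L b (L c a) = - (\<epsilon> h (k + g) *s L (L c a) b)"
    using assms by (intro L_anti L_V)
  have 2: "L a (L b c) = - (\<epsilon> h k *s L a (L c b))"
    using L_anti[OF assms(2,3)] by (simp add: L_scale L_neg del: scale_minus_left scale_minus_right)
  have "\<epsilon> h k *s L c (L a b) = (\<epsilon> k g * \<epsilon> h k) *s L a (L c b) + (\<epsilon> g h * \<epsilon> h (k + g)) *s L (L c a) b"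
    using L_cyc[OF assms] unfolding 1 2 by (simp add: eq_neg_iff_add_eq_0 algebra_simps)
  also have "\<epsilon> g h * \<epsilon> h (k + g) = \<epsilon> h k"
    using eps_inv[of g h] by (simp add: eps_add algebra_simps)
  finally have "\<epsilon> k h *s (\<epsilon> h k *s L c (L a b)) = \<epsilon> k h *s (\<epsilon> h k *s (L (L c a) b + \<epsilon> k g *s L a (L c b)))"
    by (simp add: algebra_simps)
  then show ?thesis by (simp only: scale_scale eps_inv scale_one)
qed

lemma \<omega>_leibniz:
  assumes "a \<in> V g" "b \<in> V h" "c \<in> V k"
  shows "\<omega> c (L a b) = \<omega> (L c a) b + \<epsilon> k g * \<omega> a (L c b)"
proof -
  have 1: "\<omega> b (L c a) = - (\<epsilon> h (k + g) * \<omega> (L c a) b)"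
    using assms \<omega>_anti[OF assms(2) L_V[OF assms(3,1)]] by simp
  have 2: "\<omega> a (L b c) = - (\<epsilon> h k * \<omega> a (L c b))"
    using L_anti[OF assms(2,3)] by (simp add: \<omega>_scale \<omega>_neg)
  have "\<epsilon> h k * \<omega> c (L a b) = (\<epsilon> k g * \<epsilon> h k) * \<omega> a (L c b) + (\<epsilon> g h * \<epsilon> h (k + g)) * \<omega> (L c a) b"
    using \<omega>_cyc[OF assms] unfolding 1 2 by (simp add: eq_neg_iff_add_eq_0 algebra_simps)
  also have "\<epsilon> g h * \<epsilon> h (k + g) = \<epsilon> h k"
    using eps_inv[of g h] by (simp add: eps_add algebra_simps)
  finally have "\<epsilon> h k * \<omega> c (L a b) = \<epsilon> h k * (\<omega> (L c a) b + \<epsilon> k g * \<omega> a (L c b))"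
    by (simp add: algebra_simps)
  then show ?thesis by (simp only: mult_cancel_left eps_nz) simp
qed

text \<open>The image of \<open>env_rel\<close> under \<open>expand\<close>: the defining relation
  of the enveloping algebra in basis letters.\<close>

definition rel :: "'g \<Rightarrow> 'g \<Rightarrow> 'v \<Rightarrow> 'v \<Rightarrow> 'v list \<Rightarrow>\<^sub>0 'k" where
  "rel g h x y = e x * e y - sm (\<epsilon> g h) (e y * e x) - e (L x y) - sm (\<omega> x y) 1"

lemma rel_add: "rel g h (x + y) z = rel g h x z + rel g h y z" "rel g h x (y + z) = rel g h x y + rel g h x z"
  and rel_scale: "rel g h (c *s x) y = sm c (rel g h x y)" "rel g h x (c *s y) = sm c (rel g h x y)"
  and rel_0: "rel g h 0 x = 0" "rel g h x 0 = 0"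
  unfolding rel_def
  by (simp_all add: L_add L_scale L_0 \<omega>_add \<omega>_scale \<omega>_0 e_add e_scale algebra_simps sm_mult
      smv.scale_right_distrib smv.scale_right_diff_distrib smv.scale_left_distrib)

lemma rel_anti:
  assumes "a \<in> V g" "b \<in> V h"
  shows "rel g h a b = - sm (\<epsilon> g h) (rel h g b a)"
proof -
  have "e (L a b) = - sm (\<epsilon> g h) (e (L b a))" "\<omega> a b = - \<epsilon> g h * \<omega> b a"
    using L_anti[OF assms] \<omega>_anti[OF assms] by (simp_all add: e_scale flip: scale_minus_left)
  then show ?thesis
    unfolding rel_def by (simp add: smv.scale_right_diff_distrib eps_inv algebra_simps)
qed

text \<open>For an even vector, antisymmetry makes [a,a] and \<omega>(a,a) equal to their negatives,
  hence zero. Thus squares of even letters carry no relation, and only odd squares have to be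
  reduced.\<close>

lemma rel_even:
  assumes "a \<in> V g" "\<epsilon> g g = 1"
  shows "rel g g a a = 0"
proof -
  have "L a a = - L a a" using L_anti[OF assms(1,1)] assms by simp
  then have "L a a + L a a = 0" by (metis add.right_inverse)
  then have "2 *s L a a = 0" by (simp add: scale_left_distrib[of 1 1, simplified])
  then have "L a a = 0" by simp
  moreover have "\<omega> a a = 0" using \<omega>_anti[OF assms(1,1)] assms by (simp add: eq_neg_iff_add_eq_0)
  ultimately show ?thesis using assms by (simp add: rel_def)
qed

text \<open>The two ways of reversing a product of three factors differ by the Jacobi identity.\<close>

lemma rel_hexagon:
  assumes a: "a \<in> V g" and b: "b \<in> V h" and c: "c \<in> V k"
  shows "rel k g c a * e b + sm (\<epsilon> k g) (e a * rel k h c b) + sm (\<epsilon> k g * \<epsilon> k h) (rel g h a b * e c)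
      - e c * rel g h a b - sm (\<epsilon> g h) (rel k h c b * e a) - sm (\<epsilon> g h * \<epsilon> k h) (e b * rel k g c a)
    = rel k (g + h) c (L a b) - rel (k + g) h (L c a) b - sm (\<epsilon> k g) (rel g (k + h) a (L c b))"
proof -
  \<comment> \<open>In each of the next three facts a value of \<omega> can be nonzero only if its
    two degrees cancel, and \<epsilon> of their sum is then 1.\<close>
  have 1: "\<epsilon> k g * \<epsilon> k h * \<omega> a b = \<omega> a b"
    using \<omega>_V[OF a b] by (cases "g + h = 0") (auto simp: eps_add(1)[symmetric])
  have 2: "\<epsilon> g h * \<epsilon> k h * \<omega> c a = \<omega> c a"
    using \<omega>_V[OF c a] by (cases "k + g = 0") (auto simp: eps_add(2)[symmetric] add.commute)
  have "\<epsilon> g k * \<epsilon> g h * \<omega> c b = \<omega> c b"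
    using \<omega>_V[OF c b] by (cases "k + h = 0") (auto simp: eps_add(1)[symmetric])
  then have "\<epsilon> k g * \<omega> c b = (\<epsilon> g k * \<epsilon> k g) * \<epsilon> g h * \<omega> c b" by (metis mult.assoc mult.commute)
  then have 3: "\<epsilon> g h * \<omega> c b = \<epsilon> k g * \<omega> c b" by (auto simp: eps_inv)
  have 4: "\<epsilon> k g * \<epsilon> g (k + h) = \<epsilon> g h" by (simp add: eps_add mult.assoc[symmetric] eps_inv)
  have 5: "\<epsilon> k (g + h) = \<epsilon> k g * \<epsilon> k h" "\<epsilon> (k + g) h = \<epsilon> g h * \<epsilon> k h" by (simp_all add: eps_add)
  have 6: "e (L c (L a b)) = e (L (L c a) b) + sm (\<epsilon> k g) (e (L a (L c b)))"
    using L_leibniz[OF assms] by (simp add: e_add e_scale)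
  have 7: "sm (\<omega> c (L a b)) 1 = sm (\<omega> (L c a) b) (1 :: 'v list \<Rightarrow>\<^sub>0 'k) + sm (\<epsilon> k g * \<omega> a (L c b)) 1"
    using \<omega>_leibniz[OF assms] by (simp only: smv.scale_left_distrib)
  show ?thesis
    unfolding rel_def hexagon_identity[OF 1 2 3] 5 6 7 smv.scale_right_diff_distrib smv.scale_scale 4
    by (simp add: algebra_simps)
qed

text \<open>The relation is bilinear in its two vectors, so pairs from the homogeneous basis
  suffice.\<close>

lemma rel_in_subspace:
  assumes K: "0 \<in> K" "\<And>p q. p \<in> K \<Longrightarrow> q \<in> K \<Longrightarrow> p + q \<in> K" "\<And>c p. p \<in> K \<Longrightarrow> sm c p \<in> K"
    and basis: "\<And>a b. a \<in> hB \<Longrightarrow> b \<in> hB \<Longrightarrow> rel (deg a) (deg b) a b \<in> K"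
    and x: "x \<in> V g" and y: "y \<in> V h"
  shows "rel g h x y \<in> K"
  using x
proof (induction x rule: V_induct)
  case (basis a)
  show ?case using y
  proof (induction y rule: V_induct)
    case (basis b)
    then show ?case using assms(4)[of a b] \<open>a \<in> hB\<close> \<open>a \<in> V g\<close> by (simp add: deg_eq hB_nz)
  qed (auto simp: rel_0 rel_add rel_scale K)
qed (auto simp: rel_0 rel_add rel_scale K)

end

section \<open>Reduction of words and its confluence\<close>

context color_Lie begin

definition reducible :: "'v \<Rightarrow> 'v \<Rightarrow> bool" where
  "reducible a b \<longleftrightarrow> wo_less b a \<or> (a = b \<and> \<epsilon> (deg a) (deg a) = - 1)"

definition reducible_at :: "'v list \<Rightarrow> nat \<Rightarrow> bool" where
  "reducible_at w i \<longleftrightarrow> Suc i < length w \<and> reducible (w ! i) (w ! Suc i)"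

definition pos :: "'v list \<Rightarrow> nat" where "pos w = (SOME i. reducible_at w i)"

lemma reducible_at_split: "reducible_at w i \<Longrightarrow> w = take i w @ w ! i # w ! Suc i # drop (i + 2) w"
  by (simp add: reducible_at_def Cons_nth_drop_Suc)

text \<open>
  The pair to be reduced is an arbitrary one; lemma \<open>defect_zero\<close> implies that the choice does not
  matter. For an odd letter \<open>a\<close> the relation reads \<open>2 a a = [a, a] + \<omega>(a, a)\<close>, whence the factor \<open>1/2\<close>.
\<close>

function reduce_word :: "'v list \<Rightarrow> 'v list \<Rightarrow>\<^sub>0 'k" where
  "reduce_word w =
    (if \<exists>i. reducible_at w i then
       (let u = take (pos w) w; a = w ! pos w; b = w ! Suc (pos w); v = drop (pos w + 2) w;
            t = (\<Sum>c | coord (L a b) c \<noteq> 0. sm (coord (L a b) c) (reduce_word (u @ c # v))) + sm (\<omega> a b) (reduce_word (u @ v))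
        in if a = b then sm (1/2) t
           else sm (\<epsilon> (deg a) (deg b)) (reduce_word (u @ b # a # v)) + t)
     else mon w)"
  by pat_completeness auto
text \<open>The bracket replaces two letters by one and the form removes both, so the length drops;
  a swap keeps the length and removes an inversion.\<close>

termination
proof (relation "measures [length, inversions]")
  fix w u a b v c assume ex: "\<exists>i. reducible_at w i" and x: "u = take (pos w) w" "a = w ! pos w" "b = w ! Suc (pos w)"
    "v = drop (pos w + 2) w"
  have r: "reducible_at w (pos w)" unfolding pos_def using ex by (rule someI_ex)
  then have w: "w = u @ a # b # v" using reducible_at_split x by simp
  then show "(u @ c # v, w) \<in> measures [length, inversions]" "(u @ v, w) \<in> measures [length, inversions]" by simp_all
  show "(u @ b # a # v, w) \<in> measures [length, inversions]" if "a \<noteq> b"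
  proof -
    have "wo_less b a" using r x that by (auto simp: reducible_at_def reducible_def)
    then show ?thesis unfolding w by (simp add: inversions_swap)
  qed
qed simp_all

declare reduce_word.simps [simp del]

definition lower :: "'v list \<Rightarrow> 'v \<Rightarrow> 'v \<Rightarrow> 'v list \<Rightarrow> 'v list \<Rightarrow>\<^sub>0 'k" where
  "lower u a b v =
    (\<Sum>c | coord (L a b) c \<noteq> 0. sm (coord (L a b) c) (reduce_word (u @ c # v))) + sm (\<omega> a b) (reduce_word (u @ v))"

text \<open>Describes a reduction step without reference to \<open>pos\<close>, so that nothing
  below depends on which pair is chosen.\<close>

lemma reduce_word_cases:
  obtains (normal) "\<not> (\<exists>i. reducible_at w i)" "reduce_word w = mon w"
  | (swap) u a b v where "w = u @ a # b # v" "wo_less b a"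
      "reduce_word w = sm (\<epsilon> (deg a) (deg b)) (reduce_word (u @ b # a # v)) + lower u a b v"
  | (square) u a v where "w = u @ a # a # v" "\<epsilon> (deg a) (deg a) = - 1" "reduce_word w = sm (1/2) (lower u a a v)"
proof (cases "\<exists>i. reducible_at w i")
  case True
  then have r: "reducible_at w (pos w)" unfolding pos_def by (rule someI_ex)
  note w = reducible_at_split[OF r]
  show ?thesis
  proof (cases "w ! pos w = w ! Suc (pos w)")
    case eq: True
    then have "\<epsilon> (deg (w ! pos w)) (deg (w ! pos w)) = - 1" 
      using r wo_less_linear(1)[of "w ! Suc (pos w)"] by (auto simp: reducible_at_def reducible_def)
    then show ?thesis
      using square[of "take (pos w) w" "w ! pos w" "drop (pos w + 2) w"] w eq reduce_word.simps[of w] True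
      by (simp add: Let_def lower_def)
  next
    case False
    then have "wo_less (w ! Suc (pos w)) (w ! pos w)" using r by (auto simp: reducible_at_def reducible_def)
    then show ?thesis
      using swap[of "take (pos w) w" "w ! pos w" "w ! Suc (pos w)" "drop (pos w + 2) w"] w False reduce_word.simps[of w] True
      by (simp add: Let_def lower_def)
  qed
next
  case False
  then have "reduce_word w = mon w" by (subst reduce_word.simps) (simp only: if_False)
  with False show ?thesis by (rule normal)
qed

lemma reducible_at_append: "reducible_at (u @ a # b # v) (length u) \<longleftrightarrow> reducible a b"
  by (simp add: reducible_at_def nth_append)

definition reduce :: "('v list \<Rightarrow>\<^sub>0 'k) \<Rightarrow> 'v list \<Rightarrow>\<^sub>0 'k" where "reduce = lext sm reduce_word"

lemma reduce_add: "reduce (p + q) = reduce p + reduce q" and reduce_sm: "reduce (sm c p) = sm c (reduce p)"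
  and reduce_0 [simp]: "reduce 0 = 0" and reduce_neg: "reduce (- p) = - reduce p" and reduce_diff: "reduce (p - q) = reduce p - reduce q"
  and reduce_sum: "reduce (sum f I) = (\<Sum>i\<in>I. reduce (f i))"
proof -
  interpret A: Vector_Spaces.linear "sm :: 'k \<Rightarrow> ('v list \<Rightarrow>\<^sub>0 'k) \<Rightarrow> _" sm reduce
    unfolding reduce_def by (rule smv.linear_lext)
  show "reduce (p + q) = reduce p + reduce q" "reduce (sm c p) = sm c (reduce p)" "reduce 0 = 0" "reduce (- p) = - reduce p"
    "reduce (p - q) = reduce p - reduce q" "reduce (sum f I) = (\<Sum>i\<in>I. reduce (f i))"
    by (simp_all add: A.add A.scale A.zero A.neg A.diff A.sum)
qed

lemma reduce_mon: "reduce (mon w) = reduce_word w"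
  by (simp add: reduce_def)

text \<open>By \<open>defect_expand\<close> it vanishes exactly if replacing the displayed pair by
  means of its relation is consistent with \<open>reduce\<close>. Confluence is the vanishing of all
  defects over \<open>hB\<close>.\<close>

definition defect :: "'v list \<Rightarrow> 'v \<Rightarrow> 'v \<Rightarrow> 'v list \<Rightarrow> 'v list \<Rightarrow>\<^sub>0 'k" where
  "defect u a b v = reduce (mon u * rel (deg a) (deg b) a b * mon v)"

lemma lower_eq: "lower u a b v = reduce (mon u * (e (L a b) + sm (\<omega> a b) 1) * mon v)"
proof -
  have "reduce (mon u * e (L a b) * mon v)
      = (\<Sum>c | coord (L a b) c \<noteq> 0. sm (coord (L a b) c) (reduce_word (u @ c # v)))"
    unfolding e_expand sum_distrib_left sum_distrib_right reduce_sum
    by (intro sum.cong) (simp_all add: sm_mult reduce_sm mon_append reduce_mon del: sm_single)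
  then show ?thesis
    by (simp add: lower_def distrib_left distrib_right reduce_add sm_mult reduce_sm mon_append reduce_mon del: sm_single)
qed

lemma defect_expand:
  assumes "a \<in> hB" "b \<in> hB"
  shows "defect u a b v = reduce_word (u @ a # b # v) - sm (\<epsilon> (deg a) (deg b)) (reduce_word (u @ b # a # v)) - lower u a b v"
  using assms
  by (simp add: defect_def rel_def lower_eq e_basis algebra_simps reduce_add reduce_diff reduce_sm sm_mult mon_append reduce_mon
      del: sm_single)

lemma defect_anti:
  assumes "a \<in> hB" "b \<in> hB"
  shows "defect u a b v = - sm (\<epsilon> (deg a) (deg b)) (defect u b a v)"
  using rel_anti[OF hB_V[OF assms(1)] hB_V[OF assms(2)]]
  by (simp add: defect_def sm_mult reduce_sm reduce_neg)

lemma defect_not_red: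
  assumes "a \<in> hB" "b \<in> hB" "\<not> reducible a b" "\<not> reducible b a"
  shows "defect u a b v = 0"
proof -
  have "a = b" using assms wo_less_linear(3)[of a b] by (auto simp: reducible_def)
  moreover have "\<epsilon> (deg a) (deg a) = 1" using eps_self[of "deg a"] assms \<open>a = b\<close> by (auto simp: reducible_def)
  ultimately show ?thesis using rel_even[OF hB_V[OF assms(1)]] by (simp add: defect_def)
qed

text \<open>The pair that \<open>reduce_word\<close> works on has defect zero by construction. It is
  the reference with which the other pairs of the word are compared.\<close>

lemma defect_exists:
  assumes "w \<in> lists hB" "reducible_at w i"
  obtains u a b v where "w = u @ a # b # v" "reducible a b" "defect u a b v = 0"
proof (rule reduce_word_cases[of w])
  assume "\<not> (\<exists>i. reducible_at w i)" then show ?thesis using assms by blast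
next
  fix u a b v assume w: "w = u @ a # b # v" "wo_less b a"
    "reduce_word w = sm (\<epsilon> (deg a) (deg b)) (reduce_word (u @ b # a # v)) + lower u a b v"
  then have "defect u a b v = 0" using assms(1) by (subst defect_expand) auto
  then show ?thesis using w that by (auto simp: reducible_def)
next
  fix u a v assume w: "w = u @ a # a # v" "\<epsilon> (deg a) (deg a) = - 1" "reduce_word w = sm (1/2) (lower u a a v)"
  then have "lower u a a v = reduce_word w + reduce_word w" by (simp flip: smv.scale_left_distrib)
  then have "defect u a a v = 0" using assms(1) w by (subst defect_expand) auto
  then show ?thesis using w that by (auto simp: reducible_def)
qed

text \<open>A bracket of two letters is a combination of letters rather than a letter, so the
  vanishing of defects has to be carried over from basis letters to homogeneous vectors.\<close>

lemma short_hom: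
  assumes short: "\<And>u a b v. length u + length v < n \<Longrightarrow> u @ a # b # v \<in> lists hB \<Longrightarrow> defect u a b v = 0"
    and "u \<in> lists hB" "v \<in> lists hB" "length u + length v < n" "x \<in> V g" "y \<in> V h"
  shows "reduce (mon u * rel g h x y * mon v) = 0"
proof -
  have "rel g h x y \<in> {r. reduce (mon u * r * mon v) = 0}"
  proof (rule rel_in_subspace[OF _ _ _ _ assms(5,6)])
    fix a b assume "a \<in> hB" "b \<in> hB"
    then have "defect u a b v = 0" using assms(2-4) by (intro short) auto
    then show "rel (deg a) (deg b) a b \<in> {r. reduce (mon u * r * mon v) = 0}" by (simp add: defect_def)
  qed (simp_all add: distrib_left distrib_right reduce_add sm_mult reduce_sm)
  then show ?thesis by simp
qed

text \<open>This is \<open>rel_hexagon\<close> placed between u and v: its left side consists of the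
  six defects, and its right side lives on words with one letter fewer, where \<open>short\<close>
  applies. The number n counts the letters outside a displayed pair.\<close>

lemma defect_overlap:
  assumes short: "\<And>u a b v. length u + length v < n \<Longrightarrow> u @ a # b # v \<in> lists hB \<Longrightarrow> defect u a b v = 0"
    and w: "u @ c # a # b # v \<in> lists hB" "n = Suc (length u + length v)"
  shows "defect u c a (b # v) + sm (\<epsilon> (deg c) (deg a)) (defect (u @ [a]) c b v)
      + sm (\<epsilon> (deg c) (deg a) * \<epsilon> (deg c) (deg b)) (defect u a b (c # v))
      = defect (u @ [c]) a b v + sm (\<epsilon> (deg a) (deg b)) (defect u c b (a # v))
      + sm (\<epsilon> (deg a) (deg b) * \<epsilon> (deg c) (deg b)) (defect (u @ [b]) c a v)"
proof -
  have B: "a \<in> hB" "b \<in> hB" "c \<in> hB" "u \<in> lists hB" "v \<in> lists hB" using w by auto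
  note V = hB_V[OF B(1)] hB_V[OF B(2)] hB_V[OF B(3)]
  let ?S = "\<lambda>p. reduce (mon u * p * mon v)"
  have lin: "?S (p + q) = ?S p + ?S q" "?S (p - q) = ?S p - ?S q" "?S (sm s p) = sm s (?S p)" for p q s
    by (simp_all add: algebra_simps reduce_add reduce_diff sm_mult reduce_sm)
  have l: "?S (mon [x] * rel (deg y) (deg z) y z) = defect (u @ [x]) y z v"
    and r: "?S (rel (deg y) (deg z) y z * mon [x]) = defect u y z (x # v)" for x y z
    unfolding defect_def by (simp_all add: mult.assoc mon_append) (simp_all add: mult.assoc[symmetric] mon_append)
  have 0: "?S (rel (deg c) (deg a + deg b) c (L a b)) = 0" "?S (rel (deg c + deg a) (deg b) (L c a) b) = 0"
    "?S (rel (deg a) (deg c + deg b) a (L c b)) = 0"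
    using short_hom[OF short B(4,5)] w(2) V L_V by auto
  from arg_cong[where f = ?S, OF rel_hexagon[OF V]] show ?thesis
    unfolding lin 0 e_basis[OF B(1)] e_basis[OF B(2)] e_basis[OF B(3)] l r
    by (simp add: algebra_simps)
qed

text \<open>Two pairs without a common letter can be rewritten in either order. The terms in which
  one of them is already replaced by its bracket and form are shorter and vanish by
  \<open>short\<close>.\<close>

lemma defect_disjoint:
  assumes short: "\<And>u a b v. length u + length v < n \<Longrightarrow> u @ a # b # v \<in> lists hB \<Longrightarrow> defect u a b v = 0"
    and w: "u @ c # d # x @ a # b # v \<in> lists hB" "n = length u + length x + length v + 2"
  shows "defect u c d (x @ a # b # v) + sm (\<epsilon> (deg c) (deg d)) (defect (u @ d # c # x) a b v)
    = defect (u @ c # d # x) a b v + sm (\<epsilon> (deg a) (deg b)) (defect u c d (x @ b # a # v))"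
proof -
  have B: "a \<in> hB" "b \<in> hB" "c \<in> hB" "d \<in> hB" "u \<in> lists hB" "v \<in> lists hB" "x \<in> lists hB" using w by auto
  let ?r = "rel (deg a) (deg b) a b" and ?s = "rel (deg c) (deg d) c d"
  let ?m = "e (L a b) + sm (\<omega> a b) 1" and ?n = "e (L c d) + sm (\<omega> c d) 1"
  let ?S = "\<lambda>p. reduce (mon u * p * mon v)"
  have lin: "?S (p + q) = ?S p + ?S q" "?S (sm s p) = sm s (?S p)" for p q s
    by (simp_all add: algebra_simps reduce_add sm_mult reduce_sm)
  have 1: "mon [a] * mon [b] = ?r + sm (\<epsilon> (deg a) (deg b)) (mon [b] * mon [a]) + ?m"
    "mon [c] * mon [d] = ?s + sm (\<epsilon> (deg c) (deg d)) (mon [d] * mon [c]) + ?n"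
    using B by (simp_all add: rel_def e_basis)
  have 2: "?S (?s * mon x * ?m) = 0"
  proof -
    have z: "reduce (mon u * ?s * mon (x @ c' # v)) = 0" "reduce (mon u * ?s * mon (x @ v)) = 0" if "c' \<in> hB" for c'
      using short[of u "x @ c' # v" c d] short[of u "x @ v" c d] w B that by (simp_all add: defect_def)
    have "?S (?s * mon x * e (L a b)) = 0"
      unfolding e_expand sum_distrib_left sum_distrib_right reduce_sum
      using z by (intro sum.neutral) (auto simp: sm_mult reduce_sm mon_append mult.assoc dest!: coord_hB
          simp del: sm_single)
    moreover have "?S (?s * mon x * sm (\<omega> a b) 1) = 0"
    proof -
      have "[] @ v = v" by simp
      then show ?thesis using short[of u "x @ v" c d] w B
        by (simp add: sm_mult reduce_sm mon_append mult.assoc defect_def del: sm_single)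
    qed
    ultimately show ?thesis unfolding distrib_left[of "?s * mon x"] lin by simp
  qed
  have 3: "?S (?n * mon x * ?r) = 0"
  proof -
    have "?S (e (L c d) * mon x * ?r) = 0"
      unfolding e_expand[of "L c d"] sum_distrib_left sum_distrib_right reduce_sum
    proof (intro sum.neutral ballI)
      fix c' assume "c' \<in> {b. coord (L c d) b \<noteq> 0}"
      then have "c' \<in> hB" using coord_hB by blast
      then have "defect (u @ c' # x) a b v = 0" using short[of "u @ c' # x" v a b] w B by simp
      then show "reduce (mon u * (sm (coord (L c d) c') (mon [c']) * mon x * ?r) * mon v) = 0"
        by (simp add: sm_mult reduce_sm mon_append mult.assoc[symmetric] defect_def del: sm_single)
    qed
    moreover have "?S (sm (\<omega> c d) 1 * mon x * ?r) = 0"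
      using short[of "u @ x" v a b] w B
      by (simp add: sm_mult reduce_sm mon_append mult.assoc[symmetric] defect_def del: sm_single)
    ultimately show ?thesis unfolding distrib_right lin by simp
  qed
  \<comment> \<open>With the two equations of \<open>1\<close> inserted, both sides become
    \<open>?s * mon x * ?r\<close> plus the same four terms.\<close>
  have "?s * mon x * (mon [a] * mon [b]) + sm (\<epsilon> (deg c) (deg d)) (mon [d] * mon [c]) * mon x * ?r + ?n * mon x * ?r
    = mon [c] * mon [d] * mon x * ?r + ?s * mon x * sm (\<epsilon> (deg a) (deg b)) (mon [b] * mon [a]) + ?s * mon x * ?m"
    unfolding 1 by (simp add: algebra_simps)
  from arg_cong[where f = ?S, OF this]
  have "?S (?s * mon x * (mon [a] * mon [b])) + ?S (sm (\<epsilon> (deg c) (deg d)) (mon [d] * mon [c]) * mon x * ?r)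
    = ?S (mon [c] * mon [d] * mon x * ?r) + ?S (?s * mon x * sm (\<epsilon> (deg a) (deg b)) (mon [b] * mon [a]))"
    unfolding lin 2 3 by simp
  moreover have "?S (?s * mon x * (mon [y] * mon [z])) = defect u c d (x @ y # z # v)" for y z
    by (simp add: defect_def mult.assoc mon_append)
  moreover have "?S (mon [y] * mon [z] * mon x * ?r) = defect (u @ y # z # x) a b v" for y z
    by (simp add: defect_def mult.assoc[symmetric] mon_append)
  ultimately show ?thesis unfolding sm_mult lin reduce_sm by simp
qed

text \<open>Induction along length and inversions. Modulo smaller words, the overlap and
  disjointness relations tie the defects of any two reducible pairs of w so that one vanishes if and
  only if the other does; and one of them vanishes by \<open>defect_exists\<close>.\<close>

lemma defect_red:
  assumes "w \<in> lists hB" "w = u @ a # b # v" "reducible a b"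
  shows "defect u a b v = 0"
  using assms
proof (induction w arbitrary: u a b v rule: wf_induct_rule[OF wf_measures[of "[length, inversions]"]])
  case (1 w)
  have IHs: "defect u a b v = 0" if "length u + length v + 2 < length w" "u @ a # b # v \<in> lists hB" "reducible a b" for u a b v
    using that by (intro "1.IH"[of "u @ a # b # v"]) auto
  have IHi: "defect u a b v = 0" if "length u + length v + 2 = length w" "inversions (u @ a # b # v) < inversions w"
      "u @ a # b # v \<in> lists hB" "reducible a b" for u a b v
    using that by (intro "1.IH"[of "u @ a # b # v"]) auto
  \<comment> \<open>On shorter words every pair has defect zero: it or its swap is reducible, or it
    is a repeated even letter, whose relation is zero.\<close>
  have short: "defect u a b v = 0" if "length u + length v < length w - 2" "u @ a # b # v \<in> lists hB" for u a b v
  proof -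
    have B: "a \<in> hB" "b \<in> hB" and l: "length u + length v + 2 < length w" using that by auto
    consider "reducible a b" | "reducible b a" | "\<not> reducible a b" "\<not> reducible b a" by blast
    then show ?thesis
    proof cases
      case 2
      have "defect u b a v = 0" using l that by (intro IHs 2) auto
      then show ?thesis using defect_anti[OF B] by simp
    qed (use l that IHs defect_not_red[OF B] in auto)
  qed
  (* If some of the letters coincide, the same defect occurs several times in the overlap relation:
     it then bounds the other one up to a factor 2 or 3, invertible in characteristic 0. *)
  have overlap: "defect u c a (b # v) = 0 \<longleftrightarrow> defect (u @ [c]) a b v = 0"
    if w: "w = u @ c # a # b # v" and r: "reducible c a" "reducible a b" for u c a b v
  proof -
    have B: "u @ c # a # b # v \<in> lists hB" using "1.prems"(1) w by simp
    have n: "length w - 2 = Suc (length u + length v)" using w by simp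
    note eq = defect_overlap[OF short B n, simplified]
    have s: "inversions (u @ a # c # b # v) < inversions w" if "wo_less a c"
      using inversions_swap[OF that, of u "b # v"] w by simp
    have t: "inversions (u @ c # b # a # v) < inversions w" if "wo_less b a"
      using inversions_swap[OF that, of "u @ [c]" v] w by simp
    have s': "inversions (u @ a # b # c # v) < inversions (u @ a # c # b # v)" if "wo_less b c"
      using inversions_swap[OF that, of "u @ [a]" v] by simp
    have t': "inversions (u @ b # c # a # v) < inversions (u @ c # b # a # v)" if "wo_less b c"
      using inversions_swap[OF that, of u "a # v"] by simp
    have L: "length w = length u + length v + 3" using w by simp
    \<comment> \<open>The four remaining defects of the overlap relation belong to words that arise
      from w by swaps of descents, hence have fewer inversions, as long as the letters concerned are
      distinct.\<close>
    have D1: "defect (u @ [a]) c b v = 0" if "wo_less a c" "reducible c b"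
      using s that B L by (intro IHi) auto
    have D2: "defect u a b (c # v) = 0" if "wo_less b c" "inversions (u @ a # c # b # v) \<le> inversions w"
      using s' that B L r by (intro IHi) fastforce+
    have D3: "defect u c b (a # v) = 0" if "wo_less b a" "reducible c b"
      using t that B L by (intro IHi) auto
    have D4: "defect (u @ [b]) c a v = 0" if "wo_less b c" "inversions (u @ c # b # a # v) \<le> inversions w"
      using t' that B L r by (intro IHi) fastforce+
    consider "wo_less a c" "wo_less b a" | "c = a" "wo_less b a" "\<epsilon> (deg c) (deg a) = - 1"
      | "wo_less a c" "a = b" "\<epsilon> (deg a) (deg b) = - 1" | "c = a" "a = b" "\<epsilon> (deg a) (deg a) = - 1"
      using r by (auto simp: reducible_def)
    then show ?thesis
    proof cases
      case 1
      then have "wo_less b c" using wo_less_linear(2)[of b a c] by simp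
      then show ?thesis using eq D1 D2 D3 D4 1 s t by (simp add: reducible_def)
    next
      case 2
      then have "defect u c a (b # v) - (defect (u @ [c]) a b v + defect (u @ [c]) a b v) = 0"
        using eq D2 D3 D4 w t by (simp add: reducible_def algebra_simps)
      then show ?thesis using sum_eq_zero_char_0(1)[of "defect (u @ [c]) a b v"] by auto
    next
      case 3
      then have "defect u c a (b # v) + defect u c a (b # v) = defect (u @ [c]) a b v"
        using eq D1 D2 D4 w s by (simp add: reducible_def algebra_simps)
      then show ?thesis using sum_eq_zero_char_0(1)[of "defect u c a (b # v)"] by auto
    next
      case 4
      let ?x = "defect u c a (b # v) - defect (u @ [c]) a b v"
      have "?x + ?x + ?x = 0" using eq 4 by (simp add: algebra_simps)
      from sum_eq_zero_char_0(2)[OF this] show ?thesis by simp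
    qed
  qed
  have disjoint: "defect u c d (x @ a # b # v) = 0 \<longleftrightarrow> defect (u @ c # d # x) a b v = 0"
    if w: "w = u @ c # d # x @ a # b # v" and r: "reducible c d" "reducible a b" for u c d x a b v
  proof -
    have B: "u @ c # d # x @ a # b # v \<in> lists hB" using "1.prems"(1) w by simp
    have n: "length w - 2 = length u + length x + length v + 2" using w by simp
    note eq = defect_disjoint[OF short B n, simplified]
    have D1: "defect (u @ d # c # x) a b v = 0" if "wo_less d c"
      using that B w r inversions_swap[OF that, of u "x @ a # b # v"] by (intro IHi) auto
    have D2: "defect u c d (x @ b # a # v) = 0" if "wo_less b a"
      using that B w r inversions_swap[OF that, of "u @ c # d # x" v] by (intro IHi) auto
    have k: "z = 0" if "z + z = 0" for z :: "'v list \<Rightarrow>\<^sub>0 'k" using that by (rule sum_eq_zero_char_0)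
    consider "wo_less d c" "wo_less b a" | "c = d" "\<epsilon> (deg c) (deg d) = - 1" "wo_less b a"
      | "wo_less d c" "a = b" "\<epsilon> (deg a) (deg b) = - 1"
      | "c = d" "\<epsilon> (deg c) (deg d) = - 1" "a = b" "\<epsilon> (deg a) (deg b) = - 1"
      using r by (auto simp: reducible_def)
    then show ?thesis
    proof cases
      case 1
      then show ?thesis using eq D1 D2 by simp
    next
      case 2
      then have "defect u c d (x @ a # b # v) = defect (u @ c # d # x) a b v + defect (u @ c # d # x) a b v"
        using eq D2 by (simp add: algebra_simps)
      then show ?thesis using k[of "defect (u @ c # d # x) a b v"] by auto
    next
      case 3
      then have "defect u c d (x @ a # b # v) + defect u c d (x @ a # b # v) = defect (u @ c # d # x) a b v"
        using eq D1 by (simp add: algebra_simps)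
      then show ?thesis using k[of "defect u c d (x @ a # b # v)"] by auto
    next
      case 4
      let ?x = "defect u c d (x @ a # b # v) - defect (u @ c # d # x) a b v"
      have "?x + ?x = 0" using eq 4 by (simp add: algebra_simps)
      from k[OF this] show ?thesis by simp
    qed
  qed
  \<comment> \<open>Two reducible pairs at different positions share exactly one letter or
    none.\<close>
  have pair: "defect u c d y = 0 \<longleftrightarrow> defect u' a b v = 0"
    if t: "w = u @ c # d # y" "w = u' @ a # b # v" "reducible c d" "reducible a b" "length u < length u'" for u c d y u' a b v
  proof -
    obtain z where z: "u' = u @ z" "c # d # y = z @ a # b # v"
      using t(1,2,5) by (auto simp: append_eq_append_conv2)
    with t(5) obtain z' where z': "z = c # z'" by (cases z) auto
    show ?thesis
    proof (cases z')
      case Nil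
      then show ?thesis using overlap[of u c a b v] z z' t by auto
    next
      case (Cons d' x)
      then show ?thesis using disjoint[of u c d x a b v] z z' t by auto
    qed
  qed
  obtain u0 a0 b0 v0 where *: "w = u0 @ a0 # b0 # v0" "reducible a0 b0" "defect u0 a0 b0 v0 = 0"
    using defect_exists[OF "1.prems"(1), of "length u"] "1.prems" reducible_at_append by metis
  show ?case
  proof (cases "length u" "length u0" rule: linorder_cases)
    case less
    then show ?thesis using pair[of u a b v u0 a0 b0 v0] * "1.prems" by simp
  next
    case equal
    then show ?thesis using * "1.prems" by simp
  next
    case greater
    then show ?thesis using pair[of u0 a0 b0 v0 u a b v] * "1.prems" by simp
  qed
qed

lemma defect_zero:
  assumes "u @ a # b # v \<in> lists hB"
  shows "defect u a b v = 0"
proof -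
  have B: "a \<in> hB" "b \<in> hB" using assms by auto
  consider "reducible a b" | "reducible b a" | "\<not> reducible a b" "\<not> reducible b a" by blast
  then show ?thesis
  proof cases
    case 1
    then show ?thesis using defect_red assms by blast
  next
    case 2
    have "defect u b a v = 0" using assms by (intro defect_red[OF _ refl 2]) auto
    then show ?thesis using defect_anti[OF B] by simp
  qed (use defect_not_red[OF B] in auto)
qed

end

section \<open>Normal forms\<close>

lemma keys_linear_image:
  fixes f :: "('w::monoid_add \<Rightarrow>\<^sub>0 'k::field) \<Rightarrow> ('x::monoid_add \<Rightarrow>\<^sub>0 'k)"
  assumes "\<And>p q. f (p + q) = f p + f q" "\<And>c p. f (sm c p) = sm c (f p)"
    and "\<And>w. w \<in> W \<Longrightarrow> keys (f (mon w)) \<subseteq> X" and p: "keys p \<subseteq> W"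
  shows "keys (f p) \<subseteq> X"
proof -
  have 0: "f 0 = 0" using assms(2)[of 0 0] by simp
  show ?thesis
    using p by (induction p rule: free_induct) (simp_all add: 0 assms(1-3) keys_subset_closed)
qed

section \<open>Rewriting arbitrary letters in the homogeneous basis\<close>

context color_space begin

text \<open>A projection of the free algebra onto the words over \<open>hB\<close>, which represent
  T(V). It absorbs the linearity relations, so that reduction only meets basis letters.\<close>

definition expand :: "('v list \<Rightarrow>\<^sub>0 'k) \<Rightarrow> 'v list \<Rightarrow>\<^sub>0 'k" where "expand = alift free_algebra e"

lemma expand_hom: "expand \<in> alg_hom free_algebra free_algebra"
  unfolding expand_def by (rule k_algebra.alift_hom[OF k_algebra_free]) simp

lemma expand_mon: "expand (mon [v]) = e v"
  unfolding expand_def by (rule k_algebra.alift_mon[OF k_algebra_free]) simp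

lemma expand_add: "expand (p + q) = expand p + expand q" and expand_sm: "expand (sm c p) = sm c (expand p)"
  and expand_mult: "expand (p * q) = expand p * expand q" and expand_one: "expand 1 = 1"
  using alg_homD[OF expand_hom] by simp_all

lemma expand_zero [simp]: "expand 0 = 0" and expand_neg: "expand (- p) = - expand p" and expand_diff: "expand (p - q) = expand p - expand q"
proof -
  show 0: "expand 0 = 0" using expand_sm[of 0 0] by simp
  show 1: "expand (- p) = - expand p" for p using expand_add[of p "- p"] 0 by (simp add: eq_neg_iff_add_eq_0 add.commute)
  show "expand (p - q) = expand p - expand q" using expand_add[of p "- q"] 1 by simp
qed

lemma expand_id: "keys p \<subseteq> lists hB \<Longrightarrow> expand p = p"
  by (rule alg_hom_free_eqI[OF expand_hom, of "\<lambda>p. p"]) (auto intro: alg_homI simp: expand_mon e_basis)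

definition wdeg :: "'v list \<Rightarrow> 'g" where "wdeg w = sum_list (map deg w)"

lemma wdeg_append [simp]: "wdeg (u @ v) = wdeg u + wdeg v" and wdeg_Cons [simp]: "wdeg (a # v) = deg a + wdeg v"
  and wdeg_Nil [simp]: "wdeg [] = 0"
  by (simp_all add: wdeg_def)

text \<open>A relation between words and degrees: a homogeneous word containing the letter 0 has
  every degree, as 0 lies in all components. The function \<open>wdeg\<close> is its counterpart on
  words over \<open>hB\<close>.\<close>

definition hwords :: "'g \<Rightarrow> 'v list set" where
  "hwords g = {vs. \<exists>gs. list_all2 (\<lambda>v h. v \<in> V h) vs gs \<and> sum_list gs = g}"

lemma hwords_Nil: "[] \<in> hwords g \<longleftrightarrow> g = 0"
  by (auto simp: hwords_def)

lemma hwords_Cons: "a # w \<in> hwords g \<longleftrightarrow> (\<exists>h. a \<in> V h \<and> w \<in> hwords (g - h))"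
proof
  assume "a # w \<in> hwords g"
  then obtain h gs where "a \<in> V h" "list_all2 (\<lambda>v h. v \<in> V h) w gs" "h + sum_list gs = g"
    by (auto simp: hwords_def list_all2_Cons1)
  then show "\<exists>h. a \<in> V h \<and> w \<in> hwords (g - h)" by (auto simp: hwords_def intro!: exI[of _ h])
next
  assume "\<exists>h. a \<in> V h \<and> w \<in> hwords (g - h)"
  then obtain h gs where "a \<in> V h" "list_all2 (\<lambda>v h. v \<in> V h) w gs" "sum_list gs = g - h"
    by (auto simp: hwords_def)
  then show "a # w \<in> hwords g" by (auto simp: hwords_def intro!: exI[of _ "h # gs"])
qed

lemma hB_hwords: "w \<in> lists hB \<Longrightarrow> w \<in> hwords (wdeg w)"
proof (induction w)
  case (Cons a w)
  then show ?case using hB_V[of a] by (auto simp: hwords_Cons intro!: exI[of _ "deg a"])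
qed (simp add: hwords_Nil)

lemma hwords_append: "u \<in> hwords g \<Longrightarrow> v \<in> hwords h \<Longrightarrow> u @ v \<in> hwords (g + h)"
  unfolding hwords_def by (auto intro: list_all2_appendI)

lemma expand_Cons: "expand (mon (a # w)) = e a * expand (mon w)"
proof -
  have "mon (a # w) = mon [a] * (mon w :: 'v list \<Rightarrow>\<^sub>0 'k)" by (simp add: mon_mult plus_list_def)
  then show ?thesis by (simp only: expand_mult expand_mon)
qed

lemma keys_expand_mon: "keys (expand (mon w)) \<subseteq> {x \<in> lists hB. length x = length w}"
proof (induction w)
  case Nil
  have "expand (mon []) = 1" using expand_one by (simp add: zero_list_def[symmetric])
  then show ?case by (simp add: zero_list_def)
next
  case (Cons a w)
  show ?case unfolding expand_Cons
    using keys_mult[of "e a" "expand (mon w)"] keys_e[of a] Cons by (fastforce simp: plus_list_def)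
qed

lemma keys_expand_hwords: "w \<in> hwords g \<Longrightarrow> keys (expand (mon w)) \<subseteq> {x. wdeg x = g}"
proof (induction w arbitrary: g)
  case Nil
  have "expand (mon []) = 1" using expand_one by (simp add: zero_list_def[symmetric])
  then show ?case using Nil by (simp add: zero_list_def hwords_Nil)
next
  case (Cons a w)
  then obtain h where h: "a \<in> V h" "w \<in> hwords (g - h)" by (auto simp: hwords_Cons)
  show ?case unfolding expand_Cons
  proof
    fix x assume "x \<in> keys (e a * expand (mon w))"
    then obtain y z where yz: "x = y @ z" "y \<in> keys (e a)" "z \<in> keys (expand (mon w))"
      using keys_mult[of "e a" "expand (mon w)"] by (auto simp: plus_list_def)
    then obtain b where "y = [b]" "coord a b \<noteq> 0" using keys_e by blast
    then show "x \<in> {x. wdeg x = g}" using yz Cons.IH[OF h(2)] coord_deg[OF h(1)] by auto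
  qed
qed

definition env_rel :: "('v \<Rightarrow> 'v \<Rightarrow> 'v) \<Rightarrow> ('v \<Rightarrow> 'v \<Rightarrow> 'k) \<Rightarrow> 'g \<Rightarrow> 'g \<Rightarrow> 'v \<Rightarrow> 'v \<Rightarrow> 'v list \<Rightarrow>\<^sub>0 'k" where
  "env_rel L \<omega> g h x y = mon [x] * mon [y] - sm (\<epsilon> g h) (mon [y] * mon [x]) - mon [L x y] - sm (\<omega> x y) 1"

lemmas keys_expand = keys_linear_image[of expand, OF expand_add expand_sm]

lemma keys_expand_all: "keys (expand p) \<subseteq> lists hB"
  by (rule keys_expand[where W = UNIV]) (use keys_expand_mon in blast)+

end

section \<open>The normal form and its behaviour under length and degree\<close>

context color_Lie begin

definition nf :: "('v list \<Rightarrow>\<^sub>0 'k) \<Rightarrow> 'v list \<Rightarrow>\<^sub>0 'k" where "nf p = reduce (expand p)"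

lemma nf_add: "nf (p + q) = nf p + nf q" and nf_sm: "nf (sm c p) = sm c (nf p)" and nf_0 [simp]: "nf 0 = 0"
  and nf_diff: "nf (p - q) = nf p - nf q"
  by (simp_all add: nf_def expand_add reduce_add expand_sm reduce_sm expand_diff reduce_diff)

lemma nf_sum: "nf (sum f I) = (\<Sum>i\<in>I. nf (f i))"
  by (induction I rule: infinite_finite_induct) (auto simp: nf_add)

lemma reduce_rel:
  assumes "keys p \<subseteq> lists hB" "keys q \<subseteq> lists hB" "x \<in> V g" "y \<in> V h"
  shows "reduce (p * rel g h x y * q) = 0"
  using assms(1)
proof (induction p rule: free_induct)
  case (mon u)
  show ?case using assms(2)
  proof (induction q rule: free_induct)
    case (mon v)
    show ?case
      by (rule short_hom[where n = "Suc (length u + length v)"])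
        (use defect_zero mon \<open>u \<in> lists hB\<close> assms in auto)
  qed (simp_all add: distrib_left reduce_add sm_mult reduce_sm)
qed (simp_all add: distrib_right reduce_add sm_mult reduce_sm)

lemma expand_env_rel: "expand (env_rel L \<omega> g h x y) = rel g h x y"
  by (simp add: env_rel_def rel_def expand_diff expand_mult expand_sm expand_mon expand_one del: sm_single)

text \<open>The factors on both sides are essential: \<open>nf\<close> is linear but not
  multiplicative, and its kernel has to contain the whole two-sided ideal of the relations.\<close>

lemma nf_env_rel:
  assumes "x \<in> V g" "y \<in> V h"
  shows "nf (p * env_rel L \<omega> g h x y * q) = 0"
  unfolding nf_def expand_mult expand_env_rel by (intro reduce_rel keys_expand_all assms)

lemma nf_linear:
  "nf (p * (mon [x + y] - mon [x] - mon [y]) * q) = 0" "nf (p * (mon [c *s x] - sm c (mon [x])) * q) = 0"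
  by (simp_all add: nf_def expand_mult expand_diff expand_mon expand_sm e_add e_scale del: sm_single)

text \<open>Neither L nor \<omega> enters here. The set is therefore the same for every enveloping
  algebra over V and for S(V), on which the comparison of the two rests.\<close>

definition normal :: "'v list set" where "normal = {w \<in> lists hB. \<not> (\<exists>i. reducible_at w i)}"

lemma reduce_normal: "keys p \<subseteq> normal \<Longrightarrow> reduce p = p"
proof (induction p rule: free_induct)
  case (mon w)
  then have "\<not> reducible_at w i" for i by (simp add: normal_def)
  then show ?case
    using reduce_word_cases[of w "reduce_word w = mon w"] by (metis reduce_mon reducible_at_append reducible_def)
qed (simp_all add: reduce_add reduce_sm)

lemma nf_normal: "keys p \<subseteq> normal \<Longrightarrow> nf p = p"
  unfolding nf_def by (subst expand_id) (auto simp: normal_def reduce_normal)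

lemma keys_lower:
  assumes "\<And>c. coord (L a b) c \<noteq> 0 \<Longrightarrow> keys (reduce_word (u @ c # v)) \<subseteq> X" "\<omega> a b \<noteq> 0 \<Longrightarrow> keys (reduce_word (u @ v)) \<subseteq> X"
  shows "keys (lower u a b v) \<subseteq> X"
proof -
  have "keys (sm (\<omega> a b) (reduce_word (u @ v))) \<subseteq> X"
    using assms(2) by (cases "\<omega> a b = 0") (simp_all add: keys_subset_closed(3))
  moreover have "keys (\<Sum>c | coord (L a b) c \<noteq> 0. sm (coord (L a b) c) (reduce_word (u @ c # v))) \<subseteq> X"
    using assms(1) by (intro keys_sum_subset keys_subset_closed(3)) simp
  ultimately show ?thesis unfolding lower_def by (rule keys_subset_closed(2)[rotated])
qed

text \<open>The degree is kept because the bracket is graded and \<omega> vanishes unless the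
  degrees cancel; swaps keep the length and all other terms lower it. For zero bracket and form only
  swaps contribute, which is why S(V) is graded by length.\<close>

lemma keys_reduce_word:
  assumes "w \<in> lists hB"
  shows "keys (reduce_word w) \<subseteq> {x \<in> normal. length x \<le> length w \<and> wdeg x = wdeg w \<and>
    ((\<forall>a b. L a b = 0) \<longrightarrow> (\<forall>a b. \<omega> a b = 0) \<longrightarrow> length x = length w)}" (is "_ \<subseteq> ?X w")
  using assms
proof (induction w rule: wf_induct_rule[OF wf_measures[of "[length, inversions]"]])
  case (1 w)
  have lower: "keys (lower u a b v) \<subseteq> ?X w" if w: "w = u @ a # b # v" for u a b v
  proof (rule keys_lower)
    have B: "a \<in> hB" "b \<in> hB" using 1 w by auto
    fix c assume c: "coord (L a b) c \<noteq> 0"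
    then have "deg c = deg a + deg b" using coord_deg[OF L_V] hB_V B by blast
    moreover have "keys (reduce_word (u @ c # v)) \<subseteq> ?X (u @ c # v)"
      using 1 w coord_hB[OF c] by (intro "1.IH") auto
    moreover have "\<not> (\<forall>a b. L a b = 0)" using c by (metis representation_zero)
    ultimately show "keys (reduce_word (u @ c # v)) \<subseteq> ?X w" using w by (auto simp: add_ac)
  next
    have B: "a \<in> hB" "b \<in> hB" using 1 w by auto
    assume "\<omega> a b \<noteq> 0"
    then have "deg a + deg b = 0" "\<not> (\<forall>a b. \<omega> a b = 0)" using \<omega>_V hB_V B by blast+
    moreover have "keys (reduce_word (u @ v)) \<subseteq> ?X (u @ v)"
      using 1 w by (intro "1.IH") auto
    ultimately show "keys (reduce_word (u @ v)) \<subseteq> ?X w"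
      using w by (auto simp: add.assoc[symmetric])
  qed
  show ?case
  proof (rule reduce_word_cases[of w])
    assume "\<not> (\<exists>i. reducible_at w i)" "reduce_word w = mon w"
    then show ?thesis using 1 by (simp add: normal_def)
  next
    fix u a b v assume w: "w = u @ a # b # v" "wo_less b a"
      "reduce_word w = sm (\<epsilon> (deg a) (deg b)) (reduce_word (u @ b # a # v)) + lower u a b v"
    have "keys (reduce_word (u @ b # a # v)) \<subseteq> ?X (u @ b # a # v)"
      using 1 w inversions_swap by (intro "1.IH") auto
    also have "?X (u @ b # a # v) = ?X w" using w by (simp add: add_ac)
    finally show ?thesis unfolding w(3) by (intro keys_subset_closed lower w)
  next
    fix u a v assume w: "w = u @ a # a # v" "reduce_word w = sm (1/2) (lower u a a v)"
    show ?thesis unfolding w(2) by (intro keys_subset_closed lower w)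
  qed
qed

lemmas keys_reduce = keys_linear_image[of reduce, OF reduce_add reduce_sm]

lemma keys_nf: "keys (nf p) \<subseteq> normal"
  unfolding nf_def by (rule keys_reduce[OF _ keys_expand_all]) (use keys_reduce_word reduce_mon in auto)

lemma keys_nf_length: 
  assumes "keys p \<subseteq> {w. length w \<le> n}"
  shows "keys (nf p) \<subseteq> {w. length w \<le> n}"
proof -
  have "keys (expand p) \<subseteq> {x \<in> lists hB. length x \<le> n}"
    using assms keys_expand_mon by (intro keys_expand[OF _ assms]) fastforce
  then show ?thesis
    unfolding nf_def using keys_reduce_word reduce_mon by (elim keys_reduce[rotated]) fastforce
qed

lemma keys_nf_hwords: 
  assumes "keys p \<subseteq> hwords g"
  shows "keys (nf p) \<subseteq> {w. wdeg w = g}"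
proof -
  have "keys (expand p) \<subseteq> {x \<in> lists hB. wdeg x = g}"
    using assms keys_expand_mon keys_expand_hwords by (intro keys_expand[OF _ assms]) fastforce
  then show ?thesis
    unfolding nf_def using keys_reduce_word reduce_mon by (elim keys_reduce[rotated]) fastforce
qed

lemma keys_nf_length_eq: 
  assumes "\<And>a b. L a b = 0" "\<And>a b. \<omega> a b = 0" "keys p \<subseteq> {w. length w = n}"
  shows "keys (nf p) \<subseteq> {w. length w = n}"
proof -
  have "keys (expand p) \<subseteq> {x \<in> lists hB. length x = n}"
    using assms keys_expand_mon by (intro keys_expand[OF _ assms(3)]) fastforce
  then show ?thesis
    unfolding nf_def using keys_reduce_word reduce_mon assms(1,2) by (elim keys_reduce[rotated]) fastforce
qed

text \<open>A reduction step subtracts a multiple of a relation placed between two words, and a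
  homomorphism killing the relations does not see it. The induction follows the recursion of
  \<open>reduce_word\<close>.\<close>

lemma hom_reduce_word:
  assumes h: "free_hom A h" and rel: "\<And>a b. a \<in> hB \<Longrightarrow> b \<in> hB \<Longrightarrow> h (rel (deg a) (deg b) a b) = \<zero>\<^bsub>A\<^esub>"
    and w: "w \<in> lists hB"
  shows "h (reduce_word w) = h (mon w)"
  using w
proof (induction w rule: wf_induct_rule[OF wf_measures[of "[length, inversions]"]])
  case (1 w)
  interpret free_hom A h by fact
  have lower: "h (lower u a b v) = h (mon u * (e (L a b) + sm (\<omega> a b) 1) * mon v)" if w: "w = u @ a # b # v" for u a b v
  proof -
    have "mon u * (e (L a b) + sm (\<omega> a b) 1) * mon v
       = (\<Sum>c | coord (L a b) c \<noteq> 0. sm (coord (L a b) c) (mon (u @ c # v))) + sm (\<omega> a b) (mon (u @ v))"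
      unfolding e_expand distrib_left distrib_right sum_distrib_left sum_distrib_right sm_mult mon_append mult_1_right
      by simp
    moreover have "h (reduce_word (u @ v)) = h (mon (u @ v))" using 1 w by (intro "1.IH") auto
    moreover have "h (reduce_word (u @ c # v)) = h (mon (u @ c # v))" if "coord (L a b) c \<noteq> 0" for c
      using 1 w coord_hB[OF that] by (intro "1.IH") auto
    ultimately show ?thesis unfolding lower_def by (simp only:) (intro eq_add eq_sum eq_sm; simp)
  qed
  have k: "h (mon u * rel (deg a) (deg b) a b * mon v) = \<zero>\<^bsub>A\<^esub>" if w: "w = u @ a # b # v" for u a b v
    using 1 w by (intro ideal_kernel rel) auto
  show ?case
  proof (rule reduce_word_cases[of w])
    fix u a b v assume w: "w = u @ a # b # v" "wo_less b a"
      "reduce_word w = sm (\<epsilon> (deg a) (deg b)) (reduce_word (u @ b # a # v)) + lower u a b v"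
    have B: "a \<in> hB" "b \<in> hB" using 1 w by auto
    have "h (reduce_word (u @ b # a # v)) = h (mon (u @ b # a # v))"
      using 1 w inversions_swap by (intro "1.IH") auto
    then have "h (reduce_word w) = h (sm (\<epsilon> (deg a) (deg b)) (mon (u @ b # a # v)) + mon u * (e (L a b) + sm (\<omega> a b) 1) * mon v)"
      unfolding w(3) by (intro eq_add eq_sm lower w(1))
    also have "sm (\<epsilon> (deg a) (deg b)) (mon (u @ b # a # v)) + mon u * (e (L a b) + sm (\<omega> a b) 1) * mon v
      = mon w - mon u * rel (deg a) (deg b) a b * mon v"
      unfolding rel_def w(1) e_basis[OF B(1)] e_basis[OF B(2)]
      by (simp add: algebra_simps sm_mult mon_append del: sm_single)
    also have "h \<dots> = h (mon w)" unfolding eq_iff using k[OF w(1)] by (simp add: uminus)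
    finally show ?thesis .
  next
    fix u a v assume w: "w = u @ a # a # v" "\<epsilon> (deg a) (deg a) = - 1" "reduce_word w = sm (1/2) (lower u a a v)"
    have B: "a \<in> hB" using 1 w by auto
    have "h (reduce_word w) = h (sm (1/2) (mon u * (e (L a a) + sm (\<omega> a a) 1) * mon v))"
      unfolding w(3) by (intro eq_sm lower w(1))
    also have "sm (1/2) (mon u * (e (L a a) + sm (\<omega> a a) 1) * mon v)
      = sm (1/2) (mon w + mon w) - sm (1/2) (mon u * rel (deg a) (deg a) a a * mon v)"
      unfolding rel_def w(1,2) e_basis[OF B]
      by (simp add: algebra_simps sm_mult mon_append smv.scale_right_distrib smv.scale_right_diff_distrib del: sm_single)
    also have "sm (1/2) (mon w + mon w) = (mon w :: 'v list \<Rightarrow>\<^sub>0 'k)"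
      by (simp flip: single_add)
    also have "h (mon w - sm (1/2) (mon u * rel (deg a) (deg a) a a * mon v)) = h (mon w)"
      unfolding eq_iff using k[OF w(1)] by (simp add: uminus sm A.smult_zero)
    finally show ?thesis .
  qed simp
qed

lemma hom_nf:
  assumes h: "free_hom A h" and rel: "\<And>a b. a \<in> hB \<Longrightarrow> b \<in> hB \<Longrightarrow> h (rel (deg a) (deg b) a b) = \<zero>\<^bsub>A\<^esub>"
    and expand: "\<And>p. h (expand p) = h p"
  shows "h (nf p) = h p"
proof -
  interpret free_hom A h by fact
  have "h (reduce q) = h q" if "keys q \<subseteq> lists hB" for q
    using that
    by (induction q rule: free_induct) (auto simp: reduce_mon hom_reduce_word[OF h rel] reduce_add reduce_sm add sm simp del: sm_single)
  then show ?thesis unfolding nf_def using keys_expand_all expand by metis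
qed

end

section \<open>Presentations of quotient algebras\<close>

lemma (in k_algebra) minus_zero_iff:
  assumes "x \<in> carrier A" "y \<in> carrier A"
  shows "x \<ominus> y = \<zero> \<longleftrightarrow> x = y"
proof
  assume "x \<ominus> y = \<zero>"
  then have "x \<oplus> \<ominus> y \<oplus> y = \<zero> \<oplus> y" by (simp add: a_minus_def)
  then show "x = y" using assms by (simp add: a_assoc l_neg)
qed (use assms in \<open>simp add: a_minus_def r_neg\<close>)

lemma quotient_algebra_hom:
  assumes "k_algebra A" "ideal I A"
  shows "(\<lambda>x. I +>\<^bsub>A\<^esub> x) \<in> alg_hom A (quotient_algebra A I)"
    and "(\<lambda>x. I +>\<^bsub>A\<^esub> x) ` carrier A = carrier (quotient_algebra A I)"
    and "I +>\<^bsub>A\<^esub> \<zero>\<^bsub>A\<^esub> = \<zero>\<^bsub>quotient_algebra A I\<^esub>"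
proof -
  interpret A: k_algebra A by fact
  interpret I: ideal I A by fact
  show surj: "(\<lambda>x. I +>\<^bsub>A\<^esub> x) ` carrier A = carrier (quotient_algebra A I)"
    by (auto simp: quotient_algebra_def FactRing_def A_RCOSETS_def')
  show "I +>\<^bsub>A\<^esub> \<zero>\<^bsub>A\<^esub> = \<zero>\<^bsub>quotient_algebra A I\<^esub>"
    by (simp add: quotient_algebra_def FactRing_def A.a_coset_add_zero[OF I.a_subset])
  have sm: "I +>\<^bsub>A\<^esub> (c \<odot>\<^bsub>A\<^esub> y) = I +>\<^bsub>A\<^esub> (c \<odot>\<^bsub>A\<^esub> x)" if x: "x \<in> carrier A" and y: "y \<in> I +>\<^bsub>A\<^esub> x" for c x y
  proof -
    obtain i where i: "i \<in> I" "y = i \<oplus>\<^bsub>A\<^esub> x" using y by (auto simp: a_r_coset_def')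
    have ic: "i \<in> carrier A" using i I.a_subset by auto
    have "c \<odot>\<^bsub>A\<^esub> i = (c \<odot>\<^bsub>A\<^esub> \<one>\<^bsub>A\<^esub>) \<otimes>\<^bsub>A\<^esub> i" using ic by (simp add: A.smult_mult_left)
    then have "c \<odot>\<^bsub>A\<^esub> i \<in> I" using i I.I_l_closed A.smult_closed by simp
    moreover have "c \<odot>\<^bsub>A\<^esub> y = c \<odot>\<^bsub>A\<^esub> i \<oplus>\<^bsub>A\<^esub> c \<odot>\<^bsub>A\<^esub> x" using i ic x by (simp add: A.smult_add_right)
    ultimately show ?thesis
      using x A.smult_closed[of x c] A.smult_closed[of i c] ic A.a_coset_add_assoc[OF I.a_subset, of "c \<odot>\<^bsub>A\<^esub> i" "c \<odot>\<^bsub>A\<^esub> x"]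
        I.a_rcos_const[of "c \<odot>\<^bsub>A\<^esub> i"] by simp
  qed
  show "(\<lambda>x. I +>\<^bsub>A\<^esub> x) \<in> alg_hom A (quotient_algebra A I)"
  proof (rule alg_homI)
    fix x c assume x: "x \<in> carrier A"
    then have "x \<in> I +>\<^bsub>A\<^esub> x" by (simp add: I.a_rcos_self)
    then have "(\<Union>y\<in>I +>\<^bsub>A\<^esub> x. I +>\<^bsub>A\<^esub> (c \<odot>\<^bsub>A\<^esub> y)) = I +>\<^bsub>A\<^esub> (c \<odot>\<^bsub>A\<^esub> x)"
      by (rule UN_constant_eq) (rule ballI, rule sm[OF x])
    then show "I +>\<^bsub>A\<^esub> (c \<odot>\<^bsub>A\<^esub> x) = c \<odot>\<^bsub>quotient_algebra A I\<^esub> (I +>\<^bsub>A\<^esub> x)"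
      by (simp add: quotient_algebra_def)
  qed (use surj in \<open>auto simp: quotient_algebra_def FactRing_def I.rcoset_mult_add I.a_rcos_sum\<close>)
qed

lemma k_algebra_quotient: "k_algebra A \<Longrightarrow> ideal I A \<Longrightarrow> k_algebra (quotient_algebra A I)"
  by (rule k_algebra_surj_image[OF _ quotient_algebra_hom(1,3,2)])

text \<open>Two-sided ideals of the free algebra; closure under negation comes from multiplication
  by -1.\<close>

definition fideal :: "('v list \<Rightarrow>\<^sub>0 'k::field) set \<Rightarrow> bool" where
  "fideal K \<longleftrightarrow> 0 \<in> K \<and> (\<forall>p\<in>K. \<forall>q\<in>K. p + q \<in> K) \<and> (\<forall>p\<in>K. \<forall>u v. u * p * v \<in> K)"

text \<open>Passes from a presentation of A to one of a quotient of A. The last fact replaces a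
  description of the generated ideal: elements that agree in the quotient differ by a member of
  every ideal K that contains the new generators and the old kernel. It holds because the image of K
  is an ideal of A containing I.\<close>

lemma quotient_presentation:
  fixes h :: "('v list \<Rightarrow>\<^sub>0 'k::field) \<Rightarrow> 'a"
  assumes h: "free_hom A h" and surj: "range h = carrier A" and I: "I = genideal A (h ` Gs)"
  shows "ideal I A"
    and "(\<lambda>p. I +>\<^bsub>A\<^esub> h p) \<in> alg_hom free_algebra (quotient_algebra A I)"
    and "range (\<lambda>p. I +>\<^bsub>A\<^esub> h p) = carrier (quotient_algebra A I)"
    and "p \<in> Gs \<Longrightarrow> I +>\<^bsub>A\<^esub> h p = I +>\<^bsub>A\<^esub> h 0"
    and "fideal K \<Longrightarrow> Gs \<subseteq> K \<Longrightarrow> (\<And>p. h p = h 0 \<Longrightarrow> p \<in> K) \<Longrightarrow> I +>\<^bsub>A\<^esub> h p = I +>\<^bsub>A\<^esub> h q \<Longrightarrow> p - q \<in> K"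
proof -
  interpret free_hom A h by fact
  have sub: "h ` Gs \<subseteq> carrier A" by auto
  show ideal: "ideal I A" unfolding I by (rule A.genideal_ideal[OF sub])
  interpret I: ideal I A by (rule ideal)
  note Q = quotient_algebra_hom[OF A.k_algebra_axioms ideal]
  show "(\<lambda>p. I +>\<^bsub>A\<^esub> h p) \<in> alg_hom free_algebra (quotient_algebra A I)"
    by (rule alg_hom_comp[OF hom Q(1)])
  show "range (\<lambda>p. I +>\<^bsub>A\<^esub> h p) = carrier (quotient_algebra A I)"
    using Q(2) unfolding surj[symmetric] image_image .
  have eq: "I +>\<^bsub>A\<^esub> h p = I +>\<^bsub>A\<^esub> h q \<longleftrightarrow> h (p - q) \<in> I" for p q
    using A.quotient_eq_iff_same_a_r_cos[OF ideal, of "h p" "h q"] by (auto simp: diff)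
  show "p \<in> Gs \<Longrightarrow> I +>\<^bsub>A\<^esub> h p = I +>\<^bsub>A\<^esub> h 0"
    unfolding eq using A.genideal_self[OF sub] I by auto
  assume K: "fideal K" "Gs \<subseteq> K" "\<And>p. h p = h 0 \<Longrightarrow> p \<in> K" and pq: "I +>\<^bsub>A\<^esub> h p = I +>\<^bsub>A\<^esub> h q"
  have neg: "- k \<in> K" if "k \<in> K" for k
    using K(1) that unfolding fideal_def by (metis mult_1_right mult_minus1)
  have "ideal (h ` K) A"
  proof (rule idealI)
    show "ring A" by unfold_locales
    show "subgroup (h ` K) (add_monoid A)"
    proof (rule A.add.subgroupI)
      show "h ` K \<noteq> {}" using K(1) by (auto simp: fideal_def)
      show "\<ominus>\<^bsub>A\<^esub> a \<in> h ` K" if "a \<in> h ` K" for a using that neg by (auto simp: uminus[symmetric])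
      show "a \<oplus>\<^bsub>A\<^esub> b \<in> h ` K" if "a \<in> h ` K" "b \<in> h ` K" for a b
        using that K(1) by (auto simp: add[symmetric] fideal_def)
    qed auto
    fix a x assume "a \<in> h ` K" "x \<in> carrier A"
    then obtain k where k: "k \<in> K" "a = h k" by auto
    moreover obtain p where "x = h p" using surj \<open>x \<in> carrier A\<close> by (metis rangeE)
    moreover have "p * k * 1 \<in> K" "1 * k * p \<in> K" using K(1) k(1) unfolding fideal_def by blast+
    ultimately show "x \<otimes>\<^bsub>A\<^esub> a \<in> h ` K" "a \<otimes>\<^bsub>A\<^esub> x \<in> h ` K"
      by (auto simp: mult[symmetric])
  qed
  then have "I \<subseteq> h ` K" unfolding I using K(2) by (intro A.genideal_minimal) auto
  then obtain k where k: "k \<in> K" "h (p - q) = h k" using pq eq by auto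
  then have "p - q - k \<in> K" by (intro K(3)) (simp add: diff zero A.minus_zero_iff)
  then have "p - q - k + k \<in> K" using k(1) K(1) unfolding fideal_def by blast
  then show "p - q \<in> K" by simp
qed

lemma (in free_hom) image_subspace: "linear_subspace A (h ` {p. keys p \<subseteq> W})"
  unfolding linear_subspace_def
proof (intro conjI ballI allI)
  show "\<zero> \<in> h ` {p. keys p \<subseteq> W}" using zero by (metis (mono_tags) keys_subset_closed(1) image_eqI mem_Collect_eq)
  fix x y c assume x: "x \<in> h ` {p. keys p \<subseteq> W}" 
  show "c \<odot> x \<in> h ` {p. keys p \<subseteq> W}" using x keys_subset_closed(3)[of _ W c] by (auto simp: sm[symmetric])
  assume "y \<in> h ` {p. keys p \<subseteq> W}"
  then obtain p q where "keys p \<subseteq> W" "keys q \<subseteq> W" "x = h p" "y = h q" using x by auto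
  then show "x \<oplus> y \<in> h ` {p. keys p \<subseteq> W}"
    using keys_subset_closed(2)[of p W q] by (simp add: add[symmetric])
qed auto

text \<open>Turns the spans that define gradings and filtrations into images of sets given by a
  condition on \<open>keys\<close>.\<close>

lemma (in free_hom) linear_span_image:
  "linear_span A (h ` mon ` W) = h ` {p. keys p \<subseteq> W}"
proof
  have "h ` mon ` W \<subseteq> h ` {p. keys p \<subseteq> W}" by auto
  then show "linear_span A (h ` mon ` W) \<subseteq> h ` {p. keys p \<subseteq> W}"
    using image_subspace unfolding linear_span_def by blast
  show "h ` {p. keys p \<subseteq> W} \<subseteq> linear_span A (h ` mon ` W)"
    unfolding linear_span_def
  proof safe
    fix p :: "'v list \<Rightarrow>\<^sub>0 'k" and X assume p: "keys p \<subseteq> W" and X: "linear_subspace A X" "h ` mon ` W \<subseteq> X"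
    show "h p \<in> X" using p
      by (induction p rule: free_induct) (use X in \<open>auto simp: zero add sm linear_subspace_def simp del: sm_single\<close>)
  qed
qed

section \<open>Tensor, enveloping and symmetric algebra as quotients of the free algebra\<close>

context color_space begin

abbreviation T where "T \<equiv> tensor_algebra scale"

definition piT :: "('v list \<Rightarrow>\<^sub>0 'k) \<Rightarrow> ('v list \<Rightarrow>\<^sub>0 'k) set" where
  "piT p = linearity_ideal scale +>\<^bsub>free_algebra\<^esub> p"

definition lin_gens :: "('v list \<Rightarrow>\<^sub>0 'k) set" where
  "lin_gens = {mon [v + w] - mon [v] - mon [w] |v w. True} \<union> {mon [c *s v] - sm c (mon [v]) |c v. True}"

lemma pure_tensor: "pure_tensor scale vs = piT (mon vs)"
  by (simp add: pure_tensor_def piT_def)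

lemma piT_presentation:
  shows "free_hom T piT" "range piT = carrier T"
    and "p \<in> lin_gens \<Longrightarrow> piT p = piT 0"
    and "fideal K \<Longrightarrow> lin_gens \<subseteq> K \<Longrightarrow> piT p = piT q \<Longrightarrow> p - q \<in> K"
proof -
  have id: "free_hom free_algebra (\<lambda>p. p)"
    by (intro free_homI k_algebra_free alg_homI) auto
  have I: "linearity_ideal scale = genideal free_algebra ((\<lambda>p. p) ` lin_gens)"
    by (simp add: linearity_ideal_def lin_gens_def)
  note P = quotient_presentation[OF id _ I, folded tensor_algebra_def piT_def, simplified]
  show "free_hom T piT"
    using P(1,2) by (intro free_homI) (simp_all add: tensor_algebra_def k_algebra_quotient k_algebra_free)
  show "range piT = carrier T" by (rule P(3))
  show "p \<in> lin_gens \<Longrightarrow> piT p = piT 0" by (rule P(4))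
  show "fideal K \<Longrightarrow> lin_gens \<subseteq> K \<Longrightarrow> piT p = piT q \<Longrightarrow> p - q \<in> K"
    using P(5)[of K p q] by (simp add: fideal_def)
qed

sublocale T: free_hom T piT by (rule piT_presentation)

lemma tensors_upto: "tensors_upto scale n = piT ` {p. keys p \<subseteq> {w. length w \<le> n}}"
  unfolding tensors_upto_def T.linear_span_image[symmetric] by (rule arg_cong) (auto simp: pure_tensor)

lemma tensors_homog: "tensors_homog scale V g = piT ` {p. keys p \<subseteq> hwords g}"
  unfolding tensors_homog_def T.linear_span_image[symmetric] hwords_def
  by (rule arg_cong) (auto simp: pure_tensor)

lemma tensors_bihomog: "tensors_bihomog scale V n g = piT ` {p. keys p \<subseteq> {w. length w = n} \<inter> hwords g}"
  unfolding tensors_bihomog_def T.linear_span_image[symmetric] hwords_def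
  by (rule arg_cong) (auto simp: pure_tensor)

abbreviation U where "U \<equiv> env_algebra \<epsilon> scale V"

abbreviation (input) Sym where "Sym \<equiv> sym_algebra \<epsilon> scale V"

definition piU :: "('v \<Rightarrow> 'v \<Rightarrow> 'v) \<Rightarrow> ('v \<Rightarrow> 'v \<Rightarrow> 'k) \<Rightarrow> ('v list \<Rightarrow>\<^sub>0 'k) \<Rightarrow> ('v list \<Rightarrow>\<^sub>0 'k) set set" where
  "piU L \<omega> p = env_proj \<epsilon> scale V L \<omega> (piT p)"

definition env_gens :: "('v \<Rightarrow> 'v \<Rightarrow> 'v) \<Rightarrow> ('v \<Rightarrow> 'v \<Rightarrow> 'k) \<Rightarrow> ('v list \<Rightarrow>\<^sub>0 'k) set" where
  "env_gens L \<omega> = {env_rel L \<omega> g h a b |g h a b. a \<in> V g \<and> b \<in> V h}"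

lemma color_commutator:
  "color_commutator \<epsilon> scale g h a b = piT (mon [a] * mon [b] - sm (\<epsilon> g h) (mon [b] * mon [a]))"
  by (simp add: color_commutator_def Let_def pure_tensor T.mult T.diff T.sm)

lemma env_ideal: "env_ideal \<epsilon> scale V L \<omega> = genideal T (piT ` env_gens L \<omega>)"
proof -
  have "(color_commutator \<epsilon> scale g h a b \<ominus>\<^bsub>T\<^esub> pure_tensor scale [L a b]) \<ominus>\<^bsub>T\<^esub> \<omega> a b \<odot>\<^bsub>T\<^esub> \<one>\<^bsub>T\<^esub>
    = piT (env_rel L \<omega> g h a b)" for g h a b
    by (simp add: env_rel_def color_commutator pure_tensor T.diff T.sm T.one del: sm_single)
  then show ?thesis
    unfolding env_ideal_def Let_def env_gens_def by (intro arg_cong2[where f = genideal]) (simp_all only:, blast)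
qed

lemma sym_ideal: "sym_ideal \<epsilon> scale V = env_ideal \<epsilon> scale V (\<lambda>_ _. 0) (\<lambda>_ _. 0)"
proof -
  \<comment> \<open>The zero bracket contributes the letter 0 to the relation. This letter is a
    nonzero element of the free algebra and vanishes only modulo linearity.\<close>
  have "mon [0 + 0] - mon [0] - mon [0] \<in> lin_gens" unfolding lin_gens_def by blast
  then have "piT (- mon [0]) = piT 0" using piT_presentation(3) by fastforce
  then have "piT (sm (- 1) (- mon [0])) = piT (sm (- 1) 0)" by (rule T.eq_sm)
  then have 0: "piT (mon [0]) = piT 0" by (simp del: sm_single)
  have "color_commutator \<epsilon> scale g h a b = piT (env_rel (\<lambda>_ _. 0) (\<lambda>_ _. 0) g h a b)" for g h a b
    unfolding color_commutator env_rel_def using T.eq_diff[OF refl 0] by simp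
  then show ?thesis
    unfolding env_ideal sym_ideal_def env_gens_def by (intro arg_cong2[where f = genideal]) (simp_all only:, blast)
qed

lemma sym_proj: "sym_proj \<epsilon> scale V t = env_proj \<epsilon> scale V (\<lambda>_ _. 0) (\<lambda>_ _. 0) t"
  by (simp add: sym_proj_def env_proj_def sym_ideal)

definition piS :: "('v list \<Rightarrow>\<^sub>0 'k) \<Rightarrow> ('v list \<Rightarrow>\<^sub>0 'k) set set" where
  "piS p = sym_proj \<epsilon> scale V (piT p)"

lemma piS_piU: "piS = piU (\<lambda>_ _. 0) (\<lambda>_ _. 0)"
  by (simp add: piS_def piU_def sym_proj fun_eq_iff)

lemma sym_homog: "sym_homog \<epsilon> scale V n g = piS ` {p. keys p \<subseteq> {w. length w = n} \<inter> hwords g}"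
  by (simp add: sym_homog_def tensors_bihomog piS_def image_image)

lemma env_algebra_fields:
  fixes L \<omega>
  defines "Q \<equiv> quotient_algebra T (env_ideal \<epsilon> scale V L \<omega>)"
  shows "carrier (U L \<omega>) = carrier Q" "mult (U L \<omega>) = mult Q" "one (U L \<omega>) = one Q" "zero (U L \<omega>) = zero Q"
    "add (U L \<omega>) = add Q" "smult (U L \<omega>) = smult Q"
    and homog_U: "homog (U L \<omega>) g = piU L \<omega> ` {p. keys p \<subseteq> hwords g}"
    and filt_U: "filt (U L \<omega>) n = piU L \<omega> ` {p. keys p \<subseteq> {w. length w \<le> n}}"
  by (simp_all add: env_algebra_def Let_def Q_def tensors_upto tensors_homog piU_def image_image)

text \<open>The fifth fact stands for the universal property: consequences of equality in U are
  obtained by exhibiting a suitable ideal K. The last fact repeats the first for the algebra without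
  grading and filtration, the form in which S(V) occurs.\<close>

lemma piU_presentation:
  shows "free_hom (U L \<omega>) (piU L \<omega>)" "range (piU L \<omega>) = carrier (U L \<omega>)"
    and "p \<in> lin_gens \<Longrightarrow> piU L \<omega> p = piU L \<omega> 0" and "p \<in> env_gens L \<omega> \<Longrightarrow> piU L \<omega> p = piU L \<omega> 0"
    and "fideal K \<Longrightarrow> lin_gens \<subseteq> K \<Longrightarrow> env_gens L \<omega> \<subseteq> K \<Longrightarrow> piU L \<omega> p = piU L \<omega> q \<Longrightarrow> p - q \<in> K"
    and "free_hom (quotient_algebra T (env_ideal \<epsilon> scale V L \<omega>)) (piU L \<omega>)"
proof -
  note P = quotient_presentation[OF piT_presentation(1,2) env_ideal, folded env_proj_def piU_def]
  let ?Q = "quotient_algebra T (env_ideal \<epsilon> scale V L \<omega>)"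
  have Q: "k_algebra ?Q" by (rule k_algebra_quotient[OF T.A.k_algebra_axioms P(1)])
  show "free_hom ?Q (piU L \<omega>)" by (intro free_homI Q P(2))
  then interpret Q: free_hom ?Q "piU L \<omega>" .
  have hom: "piU L \<omega> \<in> alg_hom free_algebra (U L \<omega>)"
    by (rule alg_homI) (simp_all add: env_algebra_fields Q.mult Q.add Q.one Q.sm)
  show surj: "range (piU L \<omega>) = carrier (U L \<omega>)" using P(3) by (simp add: env_algebra_fields)
  have "k_algebra (U L \<omega>)"
    by (rule k_algebra_surj_image[OF k_algebra_free hom]) (simp_all add: surj env_algebra_fields Q.zero)
  then show "free_hom (U L \<omega>) (piU L \<omega>)" using hom by (rule free_homI)
  show "p \<in> lin_gens \<Longrightarrow> piU L \<omega> p = piU L \<omega> 0" using piT_presentation(3) by (simp add: piU_def)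
  show "p \<in> env_gens L \<omega> \<Longrightarrow> piU L \<omega> p = piU L \<omega> 0" by (rule P(4))
  show "p - q \<in> K" if K: "fideal K" "lin_gens \<subseteq> K" "env_gens L \<omega> \<subseteq> K" "piU L \<omega> p = piU L \<omega> q"
  proof (rule P(5)[OF K(1,3) _ K(4)])
    fix r assume "piT r = piT 0"
    from piT_presentation(4)[OF K(1,2) this] show "r \<in> K" by simp
  qed
qed

lemma sym_algebra: "sym_algebra \<epsilon> scale V = quotient_algebra T (env_ideal \<epsilon> scale V (\<lambda>_ _. 0) (\<lambda>_ _. 0))"
  by (simp add: sym_algebra_def sym_ideal)

sublocale S: free_hom Sym piS
  unfolding piS_piU sym_algebra by (rule piU_presentation(6))

lemma range_piS: "range piS = carrier Sym"
  using piU_presentation(2)[of "\<lambda>_ _. 0" "\<lambda>_ _. 0"] by (simp add: env_algebra_fields sym_algebra piS_piU)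

end

section \<open>Associated graded algebras\<close>

context k_algebra begin

lemma subspaceD:
  assumes "linear_subspace A W"
  shows "x \<in> W \<Longrightarrow> x \<in> carrier A" "\<zero> \<in> W" "x \<in> W \<Longrightarrow> y \<in> W \<Longrightarrow> x \<oplus> y \<in> W" "x \<in> W \<Longrightarrow> c \<odot> x \<in> W"
    "x \<in> W \<Longrightarrow> \<ominus> x \<in> W" "x \<in> W \<Longrightarrow> y \<in> W \<Longrightarrow> x \<ominus> y \<in> W"
proof -
  show *: "x \<in> W \<Longrightarrow> x \<in> carrier A" "\<zero> \<in> W" "x \<in> W \<Longrightarrow> y \<in> W \<Longrightarrow> x \<oplus> y \<in> W" "x \<in> W \<Longrightarrow> c \<odot> x \<in> W" for x y c
    using assms by (auto simp: linear_subspace_def)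
  show neg: "x \<in> W \<Longrightarrow> \<ominus> x \<in> W" for x using *(1)[of x] *(4)[of x "- 1"] by (simp add: smult_minus_one)
  show "x \<in> W \<Longrightarrow> y \<in> W \<Longrightarrow> x \<ominus> y \<in> W" using *(3) neg by (simp add: a_minus_def)
qed

lemma subspace_finsum: "linear_subspace A W \<Longrightarrow> (\<And>i. i \<in> I \<Longrightarrow> f i \<in> W) \<Longrightarrow> finsum A f I \<in> W"
  by (induction I rule: infinite_finite_induct)
    (auto simp: subspaceD finsum_infinite Pi_def intro: subspaceD(1))

lemma coset_eq_iff:
  assumes W: "linear_subspace A W" and x: "x \<in> carrier A" and y: "y \<in> carrier A"
  shows "W +> x = W +> y \<longleftrightarrow> x \<ominus> y \<in> W"
proof
  assume "W +> x = W +> y"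
  then have "\<zero> \<oplus> x \<in> W +> y" using subspaceD(2)[OF W] by (force simp: a_r_coset_def')
  then obtain w where w: "w \<in> W" "x = w \<oplus> y" using x by (auto simp: a_r_coset_def')
  then have "x \<ominus> y = w" using y subspaceD(1)[OF W w(1)] by (simp add: a_minus_def a_assoc r_neg)
  then show "x \<ominus> y \<in> W" using w by simp
next
  assume d: "x \<ominus> y \<in> W"
  have sub: "W +> u \<subseteq> W +> v" if d: "u \<ominus> v \<in> W" and u: "u \<in> carrier A" and v: "v \<in> carrier A" for u v
  proof
    fix z assume "z \<in> W +> u"
    then obtain w where w: "w \<in> W" "z = w \<oplus> u" by (auto simp: a_r_coset_def')
    have "z = (w \<oplus> (u \<ominus> v)) \<oplus> v"
      using w subspaceD(1)[OF W w(1)] u v by (simp add: a_minus_def a_assoc l_neg)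
    then show "z \<in> W +> v" using subspaceD(3)[OF W w(1) d] by (auto simp: a_r_coset_def')
  qed
  have "y \<ominus> x = \<ominus> (x \<ominus> y)" using x y by (simp add: a_minus_def minus_add a_comm)
  then have "y \<ominus> x \<in> W" using subspaceD(5)[OF W d] by simp
  then show "W +> x = W +> y" using sub d x y by blast
qed

lemma coset_zero: "linear_subspace A W \<Longrightarrow> W +> \<zero> = W"
  by (rule a_coset_add_zero) (auto simp: linear_subspace_def)

lemma coset_self: "linear_subspace A W \<Longrightarrow> x \<in> carrier A \<Longrightarrow> x \<in> W +> x"
  using subspaceD(2) by (force simp: a_r_coset_def')

lemma coset_add:
  assumes W: "linear_subspace A W" and x: "x \<in> carrier A" and y: "y \<in> carrier A"
  shows "set_add A (W +> x) (W +> y) = W +> (x \<oplus> y)"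
proof
  show "set_add A (W +> x) (W +> y) \<subseteq> W +> (x \<oplus> y)"
  proof
    fix z assume "z \<in> set_add A (W +> x) (W +> y)"
    then obtain v w where vw: "v \<in> W" "w \<in> W" "z = (v \<oplus> x) \<oplus> (w \<oplus> y)"
      by (auto simp: set_add_def' a_r_coset_def')
    then have "z = (v \<oplus> w) \<oplus> (x \<oplus> y)" using subspaceD(1)[OF W] x y by (simp add: a_ac)
    then show "z \<in> W +> (x \<oplus> y)" using subspaceD(3)[OF W] vw by (auto simp: a_r_coset_def')
  qed
  show "W +> (x \<oplus> y) \<subseteq> set_add A (W +> x) (W +> y)"
  proof
    fix z assume "z \<in> W +> (x \<oplus> y)"
    then obtain v where v: "v \<in> W" "z = v \<oplus> (x \<oplus> y)" by (auto simp: a_r_coset_def')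
    then have "z = (v \<oplus> x) \<oplus> (\<zero> \<oplus> y)" using subspaceD(1)[OF W] x y by (simp add: a_ac)
    then show "z \<in> set_add A (W +> x) (W +> y)"
      using v(1) subspaceD(2)[OF W] by (force simp: set_add_def' a_r_coset_def')
  qed
qed

lemma coset_smult:
  assumes W: "linear_subspace A W" and x: "x \<in> carrier A"
  shows "(\<Union>y\<in>W +> x. W +> (c \<odot> y)) = W +> (c \<odot> x)"
proof (rule UN_constant_eq[OF coset_self[OF W x]], rule ballI)
  fix y assume "y \<in> W +> x"
  then obtain w where w: "w \<in> W" "y = w \<oplus> x" by (auto simp: a_r_coset_def')
  have wc: "w \<in> carrier A" by (rule subspaceD(1)[OF W w(1)])
  have "c \<odot> y \<ominus> c \<odot> x = c \<odot> w" 
    using w wc x by (simp add: smult_add_right a_minus_def a_assoc r_neg smult_closed)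
  then show "W +> (c \<odot> y) = W +> (c \<odot> x)"
    using w wc x W by (subst coset_eq_iff) (auto simp: smult_closed subspaceD)
qed

end

locale gfa = k_algebra A for A :: "('k::field, 'a, 'g::ab_group_add, 'm) graded_filtered_scheme" (structure) +
  assumes gf: "graded_filtered_algebra A"
begin

lemma filt_subspace: "linear_subspace A (filt A n)"
  and filt_Suc: "filt A n \<subseteq> filt A (Suc n)"
  and filt_mult: "x \<in> filt A m \<Longrightarrow> y \<in> filt A n \<Longrightarrow> x \<otimes> y \<in> filt A (m + n)"
  and filt_Union: "carrier A = (\<Union>n. filt A n)"
  using gf by (auto simp: graded_filtered_algebra_def graded_subspace_def)

lemma homog_subspace: "linear_subspace A (homog A g)"
  and homog_mult: "x \<in> homog A g \<Longrightarrow> y \<in> homog A h \<Longrightarrow> x \<otimes> y \<in> homog A (g + h)"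
  and homog_decomp: "x \<in> carrier A \<Longrightarrow> \<exists>!f. homogeneous_decomposition A (homog A) x f"
  using gf by (auto simp: graded_filtered_algebra_def graded_algebra_def)

lemma filt_mono: "m \<le> n \<Longrightarrow> filt A m \<subseteq> filt A n"
  by (rule lift_Suc_mono_le[of "filt A"]) (rule filt_Suc)

lemma pred_0: "filt_pred A 0 = {\<zero>}" and pred_Suc: "filt_pred A (Suc n) = filt A n"
  by (simp_all add: filt_pred_def)

lemma pred_subspace: "linear_subspace A (filt_pred A n)"
proof (cases n)
  case 0
  then show ?thesis by (simp add: pred_0 linear_subspace_def smult_zero)
qed (simp add: pred_Suc filt_subspace)

lemma pred_filt: "filt_pred A n \<subseteq> filt A n"
  using filt_Suc by (cases n) (auto simp: pred_0 pred_Suc subspaceD[OF filt_subspace])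

lemma pred_mult_right:
  assumes "x \<in> filt_pred A i" "y \<in> filt A j" "i + j = n"
  shows "x \<otimes> y \<in> filt_pred A n"
  using assms filt_mult[of x "i - 1" y j] subspaceD[OF filt_subspace]
  by (cases i) (auto simp: pred_0 pred_Suc subspaceD[OF pred_subspace])

lemma pred_mult_left:
  assumes "x \<in> filt A i" "y \<in> filt_pred A j" "i + j = n"
  shows "x \<otimes> y \<in> filt_pred A n"
  using assms filt_mult[of x i y "j - 1"] subspaceD[OF filt_subspace]
  by (cases j) (auto simp: pred_0 pred_Suc subspaceD[OF pred_subspace])

text \<open>The product is defined as a union over all choices of representatives. Another choice
  changes each summand by an element of F_{n-1}, so all cosets in the union coincide.\<close>

lemma assoc_graded_mult:
  assumes x: "\<And>i. x i \<in> filt A i" and y: "\<And>i. y i \<in> filt A i"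
    and f: "\<And>i. f i = filt_pred A i +> x i" and h: "\<And>i. h i = filt_pred A i +> y i"
  shows "(f \<otimes>\<^bsub>assoc_graded A\<^esub> h) n = filt_pred A n +> (\<Oplus>i\<in>{..n}. x i \<otimes> y (n - i))"
proof -
  have xc: "x i \<in> carrier A" and yc: "y i \<in> carrier A" for i
    using x y subspaceD(1)[OF filt_subspace] by auto
  have main: "filt_pred A n +> (\<Oplus>i\<in>{..n}. x' i \<otimes> y' (n - i)) = filt_pred A n +> (\<Oplus>i\<in>{..n}. x i \<otimes> y (n - i))"
    if x': "x' \<in> Pi {..n} f" and y': "y' \<in> Pi {..n} h" for x' y'
  proof -
    have ex: "\<exists>d\<in>filt_pred A n. x' i \<otimes> y' (n - i) = d \<oplus> x i \<otimes> y (n - i)" if i: "i \<in> {..n}" for i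
    proof -
      obtain p where p: "p \<in> filt_pred A i" "x' i = p \<oplus> x i"
        using x' i f by (auto simp: Pi_def a_r_coset_def')
      have "y' (n - i) \<in> h (n - i)" using y' by (auto simp: Pi_def)
      then obtain q where q: "q \<in> filt_pred A (n - i)" "y' (n - i) = q \<oplus> y (n - i)"
        unfolding h by (auto simp: a_r_coset_def')
      have pc: "p \<in> carrier A" "q \<in> carrier A" using p q subspaceD(1)[OF pred_subspace] by auto
      have y'F: "y' (n - i) \<in> filt A (n - i)"
        unfolding q(2) using q(1) y pred_filt by (intro subspaceD(3)[OF filt_subspace]) auto
      have "p \<otimes> y' (n - i) \<oplus> x i \<otimes> q \<in> filt_pred A n"
        using i p q x y'F by (intro subspaceD(3)[OF pred_subspace] pred_mult_right pred_mult_left) auto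
      moreover have "x' i \<otimes> y' (n - i) = (p \<otimes> y' (n - i) \<oplus> x i \<otimes> q) \<oplus> x i \<otimes> y (n - i)"
        unfolding p(2) q(2) using pc xc yc by (simp add: l_distr r_distr a_ac)
      ultimately show ?thesis by blast
    qed
    obtain d where d: "\<And>i. i \<in> {..n} \<Longrightarrow> d i \<in> filt_pred A n"
      "\<And>i. i \<in> {..n} \<Longrightarrow> x' i \<otimes> y' (n - i) = d i \<oplus> x i \<otimes> y (n - i)"
      using ex by metis
    have dc: "d i \<in> carrier A" if "i \<in> {..n}" for i using d(1)[OF that] subspaceD(1)[OF pred_subspace] by auto
    have "(\<Oplus>i\<in>{..n}. x' i \<otimes> y' (n - i)) = (\<Oplus>i\<in>{..n}. d i \<oplus> x i \<otimes> y (n - i))"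
      using d dc xc yc by (intro finsum_cong') auto
    also have "\<dots> = (\<Oplus>i\<in>{..n}. d i) \<oplus> (\<Oplus>i\<in>{..n}. x i \<otimes> y (n - i))"
      using dc xc yc by (intro finsum_addf) auto
    finally have "(\<Oplus>i\<in>{..n}. x' i \<otimes> y' (n - i)) = (\<Oplus>i\<in>{..n}. d i) \<oplus> (\<Oplus>i\<in>{..n}. x i \<otimes> y (n - i))" .
    moreover have "(\<Oplus>i\<in>{..n}. d i) \<in> filt_pred A n" using d by (intro subspace_finsum pred_subspace) auto
    moreover have "(\<Oplus>i\<in>{..n}. d i) \<in> carrier A" "(\<Oplus>i\<in>{..n}. x i \<otimes> y (n - i)) \<in> carrier A"
      using dc xc yc by (auto intro!: finsum_closed)
    ultimately show ?thesis
      by (simp add: coset_eq_iff[OF pred_subspace] a_minus_def a_assoc r_neg)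
  qed
  have X: "x \<in> Pi {..n} f" "y \<in> Pi {..n} h"
    using f h coset_self[OF pred_subspace] xc yc by auto
  have "(\<Union>y'\<in>Pi {..n} h. filt_pred A n +> (\<Oplus>i\<in>{..n}. x' i \<otimes> y' (n - i)))
    = filt_pred A n +> (\<Oplus>i\<in>{..n}. x i \<otimes> y (n - i))" if "x' \<in> Pi {..n} f" for x'
    using main[OF that] by (intro UN_constant_eq[OF X(2)]) blast
  then have "(\<Union>x'\<in>Pi {..n} f. \<Union>y'\<in>Pi {..n} h. filt_pred A n +> (\<Oplus>i\<in>{..n}. x' i \<otimes> y' (n - i)))
    = filt_pred A n +> (\<Oplus>i\<in>{..n}. x i \<otimes> y (n - i))"
    by (intro UN_constant_eq[OF X(1)]) blast
  then show ?thesis by (simp add: assoc_graded_def)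
qed

end

text \<open>The map T(V) \<rightarrow> G(A) induced by h, seen on the free algebra: the length n
  part is sent to its class in degree n. For the presentations of objects used below it is \<phi>
  composed with the projection onto S(V).\<close>

definition symbol_map :: "('k::field, 'a, 'g, 'm) graded_filtered_scheme \<Rightarrow> (('v list \<Rightarrow>\<^sub>0 'k) \<Rightarrow> 'a) \<Rightarrow>
    ('v list \<Rightarrow>\<^sub>0 'k) \<Rightarrow> nat \<Rightarrow> 'a set" where
  "symbol_map A h p = (\<lambda>n. filt_pred A n +>\<^bsub>A\<^esub> h (lcomp n p))"

locale filtered_hom = gfa A + free_hom A h
  for A :: "('k::field, 'a, 'g::ab_group_add, 'm) graded_filtered_scheme" (structure)
    and h :: "('v list \<Rightarrow>\<^sub>0 'k) \<Rightarrow> 'a" +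
  assumes filt_word: "h (mon w) \<in> filt A (length w)"
begin

lemma filt_keys: "keys p \<subseteq> {w. length w \<le> n} \<Longrightarrow> h p \<in> filt A n"
proof (induction p rule: free_induct)
  case (mon w)
  then show ?case using filt_word filt_mono by auto
qed (auto simp: zero add sm subspaceD[OF filt_subspace] simp del: sm_single)

lemma pred_keys: "keys p \<subseteq> {w. length w < n} \<Longrightarrow> h p \<in> filt_pred A n"
  using filt_keys[of p "n - 1"] by (cases n) (auto simp: pred_0 pred_Suc zero less_Suc_eq_le)

lemma filt_lcomp: "h (lcomp n p) \<in> filt A n"
  by (rule filt_keys) (auto simp: keys_pcomp)

lemma symbol_map_keys:
  assumes "keys p \<subseteq> {w. length w = n}"
  shows "symbol_map A h p = gr_class A n (h p)"
proof (rule ext)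
  fix m
  have "lcomp m p = (if m = n then p else 0)"
    using assms by (auto intro!: pcomp_id pcomp_none)
  then show "symbol_map A h p m = gr_class A n (h p) m"
    by (simp add: symbol_map_def gr_class_def zero coset_zero[OF pred_subspace])
qed

lemma gr_class_lcomp:
  assumes "keys p \<subseteq> {w. length w \<le> n}"
  shows "gr_class A n (h (lcomp n p)) = gr_class A n (h p)"
proof -
  have "keys (lcomp n p - p) \<subseteq> {w. length w < n}"
    using assms by (fastforce simp: in_keys_iff lookup_minus split: if_splits)
  then have "h (lcomp n p) \<ominus> h p \<in> filt_pred A n" using pred_keys by (simp add: diff[symmetric])
  then show ?thesis
    by (simp add: gr_class_def coset_eq_iff[OF pred_subspace] fun_eq_iff)
qed

lemma symbol_map_hom: "symbol_map A h \<in> alg_hom free_algebra (assoc_graded A)"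
proof (rule alg_homI)
  fix p q c
  have "{n. symbol_map A h p n \<noteq> filt_pred A n} \<subseteq> length ` keys p"
  proof
    fix n assume n: "n \<in> {n. symbol_map A h p n \<noteq> filt_pred A n}"
    show "n \<in> length ` keys p"
    proof (rule ccontr)
      assume "n \<notin> length ` keys p"
      then have "lcomp n p = 0" by (intro pcomp_none) auto
      then show False using n by (simp add: symbol_map_def zero coset_zero[OF pred_subspace])
    qed
  qed
  then have "finite {n. symbol_map A h p n \<noteq> filt_pred A n}" by (rule finite_subset) simp
  then show "symbol_map A h p \<in> carrier (assoc_graded A)"
    using filt_lcomp by (auto simp: assoc_graded_def symbol_map_def)
  show "symbol_map A h (p \<otimes>\<^bsub>free_algebra\<^esub> q) = symbol_map A h p \<otimes>\<^bsub>assoc_graded A\<^esub> symbol_map A h q"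
  proof
    fix n
    have "symbol_map A h (p * q) n = filt_pred A n +> (\<Oplus>i\<in>{..n}. h (lcomp i p) \<otimes> h (lcomp (n - i) q))"
      by (simp add: symbol_map_def lcomp_mult sum mult)
    also have "\<dots> = (symbol_map A h p \<otimes>\<^bsub>assoc_graded A\<^esub> symbol_map A h q) n"
      by (rule assoc_graded_mult[symmetric]) (simp_all add: symbol_map_def filt_lcomp)
    finally show "symbol_map A h (p \<otimes>\<^bsub>free_algebra\<^esub> q) n = (symbol_map A h p \<otimes>\<^bsub>assoc_graded A\<^esub> symbol_map A h q) n" by simp
  qed
  show "symbol_map A h (p \<oplus>\<^bsub>free_algebra\<^esub> q) = symbol_map A h p \<oplus>\<^bsub>assoc_graded A\<^esub> symbol_map A h q"
    by (simp add: symbol_map_def assoc_graded_def pcomp_add add coset_add[OF pred_subspace])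
  show "symbol_map A h (c \<odot>\<^bsub>free_algebra\<^esub> p) = c \<odot>\<^bsub>assoc_graded A\<^esub> symbol_map A h p"
    by (simp add: symbol_map_def assoc_graded_def pcomp_sm sm coset_smult[OF pred_subspace])
next
  have "lcomp n (1 :: 'v list \<Rightarrow>\<^sub>0 'k) = (if n = 0 then 1 else 0)" for n
    by (auto intro!: poly_mapping_eqI simp: lookup_one when_def zero_list_def)
  then have "symbol_map A h 1 = (\<lambda>n. filt_pred A n +> h (if n = 0 then 1 else 0))"
    unfolding symbol_map_def by (simp only:)
  then show "symbol_map A h \<one>\<^bsub>free_algebra\<^esub> = \<one>\<^bsub>assoc_graded A\<^esub>"
    by (auto simp: assoc_graded_def one zero coset_zero[OF pred_subspace] fun_eq_iff)
qed

lemma symbol_map_eq_iff: "symbol_map A h p = symbol_map A h q \<longleftrightarrow> (\<forall>n. h (lcomp n (p - q)) \<in> filt_pred A n)"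
  by (simp add: symbol_map_def fun_eq_iff coset_eq_iff[OF pred_subspace] pcomp_diff diff)

text \<open>The kernel of \<open>symbol_map\<close>. That it is an ideal is computed in the
  filtration of A, where a factor from F_{i-1} lowers the whole product by one degree.\<close>

lemma fideal_symbol_map: "fideal {p. \<forall>n. h (lcomp n p) \<in> filt_pred A n}"
proof -
  have l: "h (lcomp n (u * p)) \<in> filt_pred A n" if "\<forall>n. h (lcomp n p) \<in> filt_pred A n" for n u p
    unfolding lcomp_mult using that
    by (auto simp: sum mult intro!: subspace_finsum[OF pred_subspace] pred_mult_left filt_lcomp)
  have r: "h (lcomp n (p * u)) \<in> filt_pred A n" if "\<forall>n. h (lcomp n p) \<in> filt_pred A n" for n u p
    unfolding lcomp_mult using that
    by (auto simp: sum mult intro!: subspace_finsum[OF pred_subspace] pred_mult_right filt_lcomp)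
  show ?thesis
    using l r by (auto simp: fideal_def zero pcomp_add add subspaceD[OF pred_subspace])
qed

text \<open>As M respects the filtrations, it sends a coset of F_{n-1} A into a single coset of
  F_{n-1} B, so the union in \<open>assoc_graded_map\<close> is that coset.\<close>

lemma assoc_graded_map_symbol_map:
  assumes B: "gfa B" and M: "M \<in> alg_hom A B" "\<And>n. M ` filt A n \<subseteq> filt B n"
  shows "assoc_graded_map B M (symbol_map A h p) = symbol_map B (\<lambda>p. M (h p)) p"
proof
  fix n
  interpret B: gfa B by fact
  interpret Mh: free_hom B "\<lambda>p. M (h p)"
    using B.k_algebra_axioms alg_hom_comp[OF hom M(1)] by (intro free_homI)
  note MD = alg_homD[OF M(1)]
  have M0: "M \<zero> = \<zero>\<^bsub>B\<^esub>" using Mh.zero by (simp add: zero)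
  have pred: "M x \<in> filt_pred B n" if "x \<in> filt_pred A n" for x
    using that M(2)[of "n - 1"] by (cases n) (auto simp: pred_0 pred_Suc B.pred_0 B.pred_Suc M0)
  show "assoc_graded_map B M (symbol_map A h p) n = symbol_map B (\<lambda>p. M (h p)) p n"
    unfolding assoc_graded_map_def symbol_map_def
  proof (rule UN_constant_eq[OF coset_self[OF pred_subspace closed]], rule ballI)
    fix x assume "x \<in> filt_pred A n +> h (lcomp n p)"
    then obtain w where w: "w \<in> filt_pred A n" "x = w \<oplus> h (lcomp n p)" by (auto simp: a_r_coset_def')
    have wc: "w \<in> carrier A" by (rule subspaceD(1)[OF pred_subspace w(1)])
    then have "M x = M w \<oplus>\<^bsub>B\<^esub> M (h (lcomp n p))" unfolding w(2) by (simp add: MD)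
    then show "filt_pred B n +>\<^bsub>B\<^esub> M x = filt_pred B n +>\<^bsub>B\<^esub> M (h (lcomp n p))"
      using pred[OF w(1)] MD(1) wc
      by (simp add: B.coset_eq_iff[OF B.pred_subspace] a_minus_def B.a_assoc B.r_neg)
  qed
qed

text \<open>Each coset has a representative made of words of length exactly n, and by finite support
  these representatives can be summed.\<close>

lemma symbol_map_surj:
  assumes filt: "\<And>n. filt A n \<subseteq> h ` {p. keys p \<subseteq> {w. length w \<le> n}}" and f: "f \<in> carrier (assoc_graded A)"
  shows "\<exists>p. f = symbol_map A h p"
proof -
  have "\<exists>p. keys p \<subseteq> {w. length w = n} \<and> f n = filt_pred A n +> h p" for n
  proof -
    obtain x where x: "x \<in> filt A n" "f n = filt_pred A n +> x" using f by (auto simp: assoc_graded_def)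
    then obtain p where p: "keys p \<subseteq> {w. length w \<le> n}" "x = h p" using filt by blast
    have "f n = filt_pred A n +> h (lcomp n p)"
      using gr_class_lcomp[OF p(1)] x p by (auto simp: gr_class_def fun_eq_iff split: if_splits)
    then show ?thesis by (intro exI[of _ "lcomp n p"]) (auto simp: keys_pcomp)
  qed
  then obtain q where q: "\<And>n. keys (q n) \<subseteq> {w. length w = n}" "\<And>n. f n = filt_pred A n +> h (q n)"
    by metis
  define N where "N = {n. f n \<noteq> filt_pred A n}"
  have fin: "finite N" using f by (simp add: assoc_graded_def N_def)
  have "f n = symbol_map A h (\<Sum>n\<in>N. q n) n" for n
  proof -
    have "lcomp n (\<Sum>n\<in>N. q n) = (\<Sum>m\<in>N. if m = n then q n else 0)"
      unfolding pcomp_sum using q(1) by (intro sum.cong) (auto intro!: pcomp_id pcomp_none)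
    also have "\<dots> = (if n \<in> N then q n else 0)" using fin by simp
    finally show ?thesis using q(2)[of n] coset_zero[OF pred_subspace, of n]
      by (auto simp: symbol_map_def zero N_def)
  qed
  then show ?thesis by blast
qed

end

section \<open>Generalized enveloping algebras are objects of the category\<close>

context color_space begin

context
  fixes A :: "('k, 'a, 'm) module_scheme" and h :: "('v list \<Rightarrow>\<^sub>0 'k) \<Rightarrow> 'a"
  assumes h: "free_hom A h" and lin: "\<And>p. p \<in> lin_gens \<Longrightarrow> h p = h 0"
begin

interpretation free_hom A h by (rule h)

lemma hom_linear: "h (mon [x + y]) = h (mon [x] + mon [y])" "h (mon [c *s x]) = h (sm c (mon [x]))"
  "h (mon [0]) = h 0"
proof -
  have "mon [x + y] - mon [x] - mon [y] \<in> lin_gens" "mon [c *s x] - sm c (mon [x]) \<in> lin_gens" for c x y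
    unfolding lin_gens_def by blast+
  then have 1: "h (mon [x + y] - (mon [x] + mon [y])) = \<zero>\<^bsub>A\<^esub>" and 2: "h (mon [c *s x] - sm c (mon [x])) = \<zero>\<^bsub>A\<^esub>" for x y c
    using lin by (simp_all add: zero diff_diff_eq del: sm_single)
  show "h (mon [x + y]) = h (mon [x] + mon [y])" "h (mon [c *s x]) = h (sm c (mon [x]))"
    unfolding eq_iff by (rule 1, rule 2)
  show "h (mon [0]) = h 0" unfolding eq_iff using 2[of 0 0] by simp
qed

lemma hom_expand: "h (expand p) = h p"
proof (rule alg_hom_free_eqI[OF alg_hom_comp[OF expand_hom hom] hom, of UNIV])
  fix v :: 'v
  have "h (e v) = h (mon [v])"
  proof (induction v rule: all_induct)
    case (hom x g)
    then show ?case
      by (induction x rule: V_induct)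
        (auto simp: e_basis hom_linear(1,3) e_add e_scale add sm simp del: sm_single
          intro: trans[OF _ hom_linear(2)[symmetric]])
  qed (auto simp: hom_linear(1,3) e_add e_scale add sm simp del: sm_single
          intro: trans[OF _ hom_linear(2)[symmetric]])
  then show "h (expand (mon [v])) = h (mon [v])" by (simp add: expand_mon)
qed auto

end

text \<open>The linear part of an element, evaluated in V. Together with the constant coefficient it
  detects S(V) in degrees 0 and 1.\<close>

definition vector_part :: "('v list \<Rightarrow>\<^sub>0 'k) \<Rightarrow> 'v" where
  "vector_part = lext scale (\<lambda>w. if length w = 1 then hd w else 0)"

lemma vector_part_add: "vector_part (p + q) = vector_part p + vector_part q" and vector_part_sm: "vector_part (sm c p) = c *s vector_part p"
  and vector_part_0 [simp]: "vector_part 0 = 0" and vector_part_diff: "vector_part (p - q) = vector_part p - vector_part q"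
proof -
  interpret A: Vector_Spaces.linear "sm :: 'k \<Rightarrow> ('v list \<Rightarrow>\<^sub>0 'k) \<Rightarrow> _" scale vector_part
    unfolding vector_part_def by (rule linear_lext)
  show "vector_part (p + q) = vector_part p + vector_part q" "vector_part (sm c p) = c *s vector_part p" "vector_part 0 = 0"
    "vector_part (p - q) = vector_part p - vector_part q"
    by (simp_all add: A.add A.scale A.zero A.diff)
qed

lemma vector_part_mon: "vector_part (mon w) = (if length w = 1 then hd w else 0)"
  by (simp add: vector_part_def)

lemma vector_part_V: "keys p \<subseteq> {w. length w = 1} \<inter> hwords g \<Longrightarrow> vector_part p \<in> V g"
proof (induction p rule: free_induct)
  case (mon w)
  then obtain a where "w = [a]" "w \<in> hwords g" by (auto simp: length_Suc_conv)
  then show ?case by (auto simp: vector_part_mon hwords_Cons hwords_Nil)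
qed (simp_all add: V_closed vector_part_add vector_part_sm)

lemma hom_vector_part:
  assumes h: "free_hom A h" and lin: "\<And>p. p \<in> lin_gens \<Longrightarrow> h p = h 0"
  shows "keys p \<subseteq> {w. length w = 1} \<Longrightarrow> h p = h (mon [vector_part p])"
proof (induction p rule: free_induct)
  interpret free_hom A h by (rule h)
  note l = hom_linear[OF h lin]
  { case (mon w)
    then show ?case by (auto simp: vector_part_mon length_Suc_conv)
  next
    case (sm c p)
    then show ?case unfolding vector_part_sm by (simp add: l(2) free_hom.sm[OF h] del: sm_single)
  next
    case (add p q)
    then show ?case unfolding vector_part_add by (simp add: l(1) free_hom.add[OF h])
  next
    case zero
    then show ?case by (simp add: l(3))
  }
qed

text \<open>The constant coefficient and the vector part together form a homomorphism to the
  square-zero extension of \<bbbK> by V, a commutative algebra in which products of vectors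
  vanish.\<close>

lemma low_mult: "lookup (p * q) [] = lookup p [] * lookup q []"
  "vector_part (p * q) = lookup p [] *s vector_part q + lookup q [] *s vector_part p"
proof -
  show "lookup (p * q) [] = lookup p [] * lookup q []"
  proof (induction p rule: free_induct_UNIV)
    case (mon u)
    show ?case
      by (induction q rule: free_induct_UNIV)
        (auto simp: mult_single lookup_single when_def plus_list_def distrib_left lookup_add sm_mult)
  qed (simp_all add: distrib_right lookup_add sm_mult)
  show "vector_part (p * q) = lookup p [] *s vector_part q + lookup q [] *s vector_part p"
  proof (induction p rule: free_induct_UNIV)
    case (mon u)
    show ?case
    proof (induction q rule: free_induct_UNIV)
      case (mon v)
      show ?case by (auto simp: mon_append vector_part_mon lookup_single when_def Suc_length_conv)
    qed (simp_all add: distrib_left lookup_add sm_mult vector_part_add vector_part_sm algebra_simps del: sm_single)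
  qed (simp_all add: distrib_right lookup_add sm_mult vector_part_add vector_part_sm algebra_simps del: sm_single)
qed

text \<open>
  The Poincare-Birkhoff-Witt theorem is not needed in degrees \<open>0\<close> and \<open>1\<close>, because the relations of
  the symmetric algebra have length two.
\<close>

lemma piS_low:
  assumes "piS p = piS q"
  shows "lookup p [] = lookup q []" "vector_part p = vector_part q"
proof -
  let ?K = "{p. lookup p [] = 0 \<and> vector_part p = 0}"
  have "fideal ?K" by (auto simp: fideal_def lookup_add vector_part_add low_mult)
  moreover have "lin_gens \<subseteq> ?K"
    by (auto simp: lin_gens_def lookup_minus lookup_single when_def vector_part_diff vector_part_mon vector_part_sm simp del: sm_single)
  moreover have "env_gens (\<lambda>_ _. 0) (\<lambda>_ _. 0) \<subseteq> ?K"
    by (auto simp: env_gens_def env_rel_def lookup_minus lookup_single when_def vector_part_diff vector_part_mon vector_part_sm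
        low_mult simp del: sm_single)
  ultimately have "p - q \<in> ?K" using assms unfolding piS_piU by (rule piU_presentation(5))
  then show "lookup p [] = lookup q []" "vector_part p = vector_part q" by (auto simp: lookup_minus vector_part_diff)
qed

text \<open>If color commutators of vectors drop from F_2 to F_1, the kernel of
  \<open>symbol_map\<close> contains the generators of the ideal of S(V), and being an ideal it
  contains that whole ideal.\<close>

lemma symbol_map_piS:
  assumes "filtered_hom A h" and lin: "\<And>p. p \<in> lin_gens \<Longrightarrow> h p = h 0"
    and comm: "\<And>a b g k. a \<in> V g \<Longrightarrow> b \<in> V k \<Longrightarrow> h (mon [a] * mon [b] - sm (\<epsilon> g k) (mon [b] * mon [a])) \<in> filt A 1"
    and eq: "piS p = piS q"
  shows "symbol_map A h p = symbol_map A h q"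
proof -
  interpret filtered_hom A h by fact
  let ?K = "{p. \<forall>n. h (lcomp n p) \<in> filt_pred A n}"
  have hom: "p \<in> ?K" if p: "keys p \<subseteq> {w. length w = m}" "h p \<in> filt_pred A m" for p m
  proof -
    have "lcomp n p = (if n = m then p else 0)" for n using p(1) by (auto intro!: pcomp_id pcomp_none)
    then show ?thesis using p(2) subspaceD(2)[OF pred_subspace] by (simp add: zero)
  qed
  have zero_in: "h x \<in> filt_pred A n" if "h x = h 0" for x n
    using that subspaceD(2)[OF pred_subspace] by (simp add: zero)
  have k1: "keys (mon [x] :: 'v list \<Rightarrow>\<^sub>0 'k) \<subseteq> {w. length w = 1}" for x by simp
  have "lin_gens \<subseteq> ?K"
  proof
    fix p assume p: "p \<in> lin_gens"
    then have "keys p \<subseteq> {w. length w = 1}"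
      unfolding lin_gens_def
      by (elim UnE CollectE exE conjE) (simp_all only: k1 keys_subset_closed(3,4))
    then show "p \<in> ?K" using hom zero_in lin[OF p] by blast
  qed
  moreover have "env_gens (\<lambda>_ _. 0) (\<lambda>_ _. 0) \<subseteq> ?K"
  proof
    fix p assume "p \<in> env_gens (\<lambda>_ _. 0) (\<lambda>_ _. 0)"
    then obtain g k a b where ab: "a \<in> V g" "b \<in> V k" and p: "p = env_rel (\<lambda>_ _. 0) (\<lambda>_ _. 0) g k a b"
      by (auto simp: env_gens_def)
    let ?c = "mon [a] * mon [b] - sm (\<epsilon> g k) (mon [b] * mon [a])"
    have "keys ?c \<subseteq> {w. length w = 2}"
      unfolding mon_append by (intro keys_subset_closed(3,4)) simp_all
    moreover have "h ?c \<in> filt_pred A 2" using comm[OF ab] pred_Suc[of 1] by (simp add: numeral_2_eq_2)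
    ultimately have 1: "?c \<in> ?K" by (rule hom)
    have "h (sm (- 1) (mon [0])) = h (sm (- 1) 0)"
      using hom_linear(3)[OF free_hom_axioms lin] by (rule eq_sm)
    moreover have "keys (sm (- 1) (mon [0]) :: 'v list \<Rightarrow>\<^sub>0 'k) \<subseteq> {w. length w = 1}"
      by (intro keys_subset_closed(3) k1)
    ultimately have 2: "sm (- 1) (mon [0]) \<in> ?K" by (intro hom zero_in) simp_all
    have "?c + sm (- 1) (mon [0]) \<in> ?K" using 1 2 fideal_symbol_map unfolding fideal_def by blast
    then show "p \<in> ?K" by (simp add: p env_rel_def smv.scale_minus_left del: sm_single)
  qed
  ultimately have "p - q \<in> ?K" using fideal_symbol_map eq unfolding piS_piU by (intro piU_presentation(5))
  then show ?thesis by (simp add: symbol_map_eq_iff)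
qed

lemma triv: "color_Lie scale \<epsilon> V (\<lambda>_ _. 0) (\<lambda>_ _. 0)"
proof unfold_locales
  interpret vv: vector_space_pair scale scale by unfold_locales
  interpret vk: vector_space_pair scale "(*)" by unfold_locales (simp_all add: algebra_simps)
  show "(\<lambda>_ _. 0) \<in> color_Lie_structures \<epsilon> scale V" "(\<lambda>_ _. 0) \<in> Z2_gr \<epsilon> scale V (\<lambda>_ _. 0)"
    by (auto simp: color_Lie_structures_def Z2_gr_def bilinear_map_def V_closed vv.linear_zero vk.linear_zero)
qed

abbreviation gcomp :: "'g \<Rightarrow> ('v list \<Rightarrow>\<^sub>0 'k) \<Rightarrow> 'v list \<Rightarrow>\<^sub>0 'k" where
  "gcomp g \<equiv> pcomp (\<lambda>w. wdeg w = g)"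

end

lemma (in free_hom) decomposition_pcomp:
  assumes "\<And>g. h (pcomp (\<lambda>w. d w = g) p) \<in> H g"
  shows "homogeneous_decomposition A H (h p) (\<lambda>g. h (pcomp (\<lambda>w. d w = g) p))"
  unfolding homogeneous_decomposition_def
proof (intro conjI allI)
  let ?f = "\<lambda>g. pcomp (\<lambda>w. d w = g) p"
  let ?S = "{g. h (?f g) \<noteq> \<zero>}" and ?R = "d ` keys p"
  have sub: "?S \<subseteq> ?R"
  proof -
    have "?f g = 0" if "g \<notin> ?R" for g using that by (intro pcomp_none) auto
    then show ?thesis using zero by fastforce
  qed
  then show "finite ?S" by (rule finite_subset) simp
  have "h p = h (\<Sum>g\<in>?R. ?f g)" by (subst pcomp_sum_fibres) auto
  also have "\<dots> = (\<Oplus>g\<in>?R. h (?f g))" by (simp add: sum)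
  also have "\<dots> = (\<Oplus>g\<in>?S. h (?f g))"
    using sub by (intro A.add.finprod_mono_neutral_cong_right) auto
  finally show "h p = (\<Oplus>g\<in>?S. h (?f g))" .
qed (rule assms)

section \<open>The Poincare-Birkhoff-Witt theorem and its consequences for the grading and
  filtration\<close>

context color_Lie begin

abbreviation "UL \<equiv> U L \<omega>"

abbreviation "pU \<equiv> piU L \<omega>"

sublocale U: free_hom UL pU by (rule piU_presentation(1))

lemma pU_nf: "pU (nf p) = pU p"
proof (rule hom_nf[OF U.free_hom_axioms])
  show expand: "pU (expand p) = pU p" for p by (rule hom_expand[OF U.free_hom_axioms]) (rule piU_presentation(3))
  fix a b assume "a \<in> hB" "b \<in> hB"
  then have "env_rel L \<omega> (deg a) (deg b) a b \<in> env_gens L \<omega>" using hB_V unfolding env_gens_def by blast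
  then show "pU (rel (deg a) (deg b) a b) = \<zero>\<^bsub>UL\<^esub>"
    using expand[of "env_rel L \<omega> (deg a) (deg b) a b"] piU_presentation(4) by (simp add: expand_env_rel U.zero)
qed

text \<open>Linear independence of the normal words in the enveloping algebra. The ideal
  \<open>?K\<close> is the largest one inside the kernel of \<open>nf\<close>; it contains all
  defining relations.\<close>

lemma pU_eq_iff: "pU p = pU q \<longleftrightarrow> nf p = nf q"
proof
  assume eq: "pU p = pU q"
  let ?K = "{p. \<forall>u v. nf (u * p * v) = 0}"
  have "fideal ?K"
    unfolding fideal_def
  proof (intro conjI ballI allI CollectI)
    fix p q u v u' v' assume p: "p \<in> ?K"
    show "nf (u' * (u * p * v) * v') = 0" using p[simplified, rule_format, of "u' * u" "v * v'"] by (simp add: mult.assoc)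
    assume "q \<in> ?K"
    then show "nf (u * (p + q) * v) = 0" using p by (simp add: distrib_left distrib_right nf_add)
  qed simp
  moreover have "lin_gens \<subseteq> ?K" by (auto simp: lin_gens_def nf_linear simp del: sm_single)
  moreover have "env_gens L \<omega> \<subseteq> ?K" by (auto simp: env_gens_def nf_env_rel)
  ultimately have "p - q \<in> ?K" using eq by (rule piU_presentation(5))
  then have "nf (1 * (p - q) * 1) = 0" by blast
  then show "nf p = nf q" by (simp add: nf_diff)
next
  assume "nf p = nf q"
  then show "pU p = pU q" using pU_nf[of p] pU_nf[of q] by simp
qed

lemma keys_normal_gcomp: "keys (gcomp g (nf p)) \<subseteq> hwords g"
  using keys_nf[of p] by (auto simp: keys_pcomp normal_def subset_iff intro: hB_hwords)

text \<open>The normal form is sorted by the degree of its words. X is the set of all words for the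
  grading, and the words of length at most n for the filtration.\<close>

lemma U_decomp:
  assumes "keys (nf p) \<subseteq> X"
  shows "homogeneous_decomposition UL (\<lambda>g. pU ` {q. keys q \<subseteq> hwords g} \<inter> pU ` {q. keys q \<subseteq> X}) (pU p)
    (\<lambda>g. pU (gcomp g (nf p)))"
proof -
  have "pU (gcomp g (nf p)) \<in> pU ` {q. keys q \<subseteq> hwords g} \<inter> pU ` {q. keys q \<subseteq> X}" for g
  proof -
    have "keys (gcomp g (nf p)) \<subseteq> X" using assms by (auto simp: keys_pcomp)
    then show ?thesis using keys_normal_gcomp by blast
  qed
  then show ?thesis using U.decomposition_pcomp[of wdeg "nf p"] by (simp add: pU_nf)
qed

text \<open>Normal forms carry the question into the free algebra, where the components by word
  degree are unique; homogeneous elements have homogeneous normal forms.\<close>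

lemma U_decomp_unique:
  assumes "homogeneous_decomposition UL (homog UL) (pU p) f"
  shows "f = (\<lambda>g. pU (gcomp g (nf p)))"
proof
  fix k
  let ?S = "{g. f g \<noteq> \<zero>\<^bsub>UL\<^esub>}"
  have f: "\<And>g. f g \<in> homog UL g" "finite ?S" "pU p = (\<Oplus>\<^bsub>UL\<^esub>g\<in>?S. f g)"
    using assms by (auto simp: homogeneous_decomposition_def)
  have "\<exists>q. keys q \<subseteq> hwords g \<and> f g = pU q" for g using f(1)[of g] unfolding homog_U by blast
  then obtain q where q: "\<And>g. keys (q g) \<subseteq> hwords g" "\<And>g. f g = pU (q g)" by metis
  have "f = (\<lambda>g. pU (q g))" using q(2) by blast
  then have "pU p = pU (\<Sum>g\<in>?S. q g)" unfolding f(3) U.sum[OF f(2)] by simp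
  then have "nf p = (\<Sum>g\<in>?S. nf (q g))" by (simp add: pU_eq_iff nf_sum)
  then have "gcomp k (nf p) = (\<Sum>g\<in>?S. gcomp k (nf (q g)))" by (simp add: pcomp_sum)
  also have "\<dots> = (\<Sum>g\<in>?S. if g = k then nf (q k) else 0)"
  proof (intro sum.cong refl)
    fix g
    show "gcomp k (nf (q g)) = (if g = k then nf (q k) else 0)"
      using keys_nf_hwords[OF q(1)[of g]] by (auto intro!: pcomp_id pcomp_none)
  qed
  also have "\<dots> = (if k \<in> ?S then nf (q k) else 0)" using f(2) by simp
  finally have "pU (gcomp k (nf p)) = (if k \<in> ?S then pU (q k) else \<zero>\<^bsub>UL\<^esub>)"
    by (simp add: pU_nf U.zero)
  then show "f k = pU (gcomp k (nf p))" using q(2)[of k] by auto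
qed

lemma carrier_U: "x \<in> carrier UL \<longleftrightarrow> (\<exists>p. x = pU p)"
  using piU_presentation(2)[of L \<omega>] by blast

lemma graded_U: "graded_algebra UL"
  unfolding graded_algebra_def
proof (intro conjI allI ballI)
  show "k_algebra UL" by unfold_locales
  show "linear_subspace UL (homog UL g)" for g unfolding homog_U by (rule U.image_subspace)
  fix x assume "x \<in> carrier UL"
  then obtain p where x: "x = pU p" using carrier_U by blast
  show "\<exists>!f. homogeneous_decomposition UL (homog UL) x f"
  proof (rule ex1I)
    show "homogeneous_decomposition UL (homog UL) x (\<lambda>g. pU (gcomp g (nf p)))"
      using U_decomp[of p UNIV] unfolding x homogeneous_decomposition_def homog_U by blast
  qed (use U_decomp_unique x in blast)
next
  fix g h x y assume "x \<in> homog UL g" "y \<in> homog UL h"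
  then obtain p q where "x = pU p" "y = pU q" "keys p \<subseteq> hwords g" "keys q \<subseteq> hwords h" unfolding homog_U by blast
  moreover from this have "keys (p * q) \<subseteq> hwords (g + h)"
    by (blast elim: keys_mult_listE intro: hwords_append)
  ultimately show "x \<otimes>\<^bsub>UL\<^esub> y \<in> homog UL (g + h)" unfolding homog_U by (auto simp: U.mult[symmetric])
qed

lemma graded_filtered_U: "graded_filtered_algebra UL"
  unfolding graded_filtered_algebra_def
proof (intro conjI allI ballI)
  show "graded_algebra UL" by (rule graded_U)
  show "graded_subspace UL (filt UL n)" for n
    unfolding graded_subspace_def
  proof (intro conjI ballI)
    show "linear_subspace UL (filt UL n)" unfolding filt_U by (rule U.image_subspace)
    fix x assume "x \<in> filt UL n"
    then obtain p where "x = pU p" "keys p \<subseteq> {w. length w \<le> n}" unfolding filt_U by blast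
    then show "\<exists>f. homogeneous_decomposition UL (\<lambda>g. homog UL g \<inter> filt UL n) x f"
      using U_decomp[OF keys_nf_length] unfolding homog_U filt_U by blast
  qed
  show "filt UL n \<subseteq> filt UL (Suc n)" for n
    unfolding filt_U by (intro image_mono) fastforce
  fix m n x y assume "x \<in> filt UL m" "y \<in> filt UL n"
  then obtain p q where "x = pU p" "y = pU q" "keys p \<subseteq> {w. length w \<le> m}" "keys q \<subseteq> {w. length w \<le> n}"
    unfolding filt_U by blast
  moreover from this have "keys (p * q) \<subseteq> {w. length w \<le> m + n}"
    by (auto elim!: keys_mult_listE simp: subset_iff intro!: add_mono)
  ultimately show "x \<otimes>\<^bsub>UL\<^esub> y \<in> filt UL (m + n)" unfolding filt_U by (auto simp: U.mult[symmetric])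
next
  have "pU p \<in> (\<Union>n. filt UL n)" for p
  proof -
    have "keys p \<subseteq> {w. length w \<le> Max (insert 0 (length ` keys p))}" by auto
    then show ?thesis unfolding filt_U by blast
  qed
  moreover have "filt UL n \<subseteq> carrier UL" for n unfolding filt_U by auto
  ultimately show "carrier UL = (\<Union>n. filt UL n)"
    by (intro equalityI subsetI) (auto simp: carrier_U subset_iff)
qed

sublocale UF: filtered_hom UL pU
proof unfold_locales
  show "graded_filtered_algebra UL" by (rule graded_filtered_U)
  show "pU (mon w) \<in> filt UL (length w)" for w unfolding filt_U by (intro imageI) simp
qed

end

lemma alg_hom_factor:
  assumes "\<pi> \<in> alg_hom free_algebra X" "range \<pi> = carrier X" "h \<in> alg_hom free_algebra Y" "\<And>p. M (\<pi> p) = h p"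
  shows "M \<in> alg_hom X Y"
proof -
  note P = alg_homD[OF assms(1), simplified] and H = alg_homD[OF assms(3), simplified]
  have ex: "\<exists>p. x = \<pi> p" if "x \<in> carrier X" for x using that assms(2) by blast
  show ?thesis
  proof (rule alg_homI)
    fix x c assume "x \<in> carrier X"
    then obtain p where x: "x = \<pi> p" using ex by blast
    show "M x \<in> carrier Y" using x H(1) assms(4) by simp
    show "M (c \<odot>\<^bsub>X\<^esub> x) = c \<odot>\<^bsub>Y\<^esub> M x" unfolding x P(5)[symmetric] assms(4) by (rule H(5))
    fix y assume "y \<in> carrier X"
    then obtain q where y: "y = \<pi> q" using ex by blast
    show "M (x \<otimes>\<^bsub>X\<^esub> y) = M x \<otimes>\<^bsub>Y\<^esub> M y" unfolding x y P(2)[symmetric] assms(4) by (rule H(2))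
    show "M (x \<oplus>\<^bsub>X\<^esub> y) = M x \<oplus>\<^bsub>Y\<^esub> M y" unfolding x y P(3)[symmetric] assms(4) by (rule H(3))
  next
    show "M \<one>\<^bsub>X\<^esub> = \<one>\<^bsub>Y\<^esub>" unfolding P(4)[symmetric] assms(4) by (rule H(4))
  qed
qed

context color_space begin

abbreviation "Obj \<equiv> R_objects \<epsilon> scale V"
abbreviation "Mor \<equiv> R_morphisms \<epsilon> scale V"
abbreviation "Iso \<equiv> R_isomorphic \<epsilon> scale V"
abbreviation "Coh \<equiv> cohomologous \<epsilon> scale V"

end

context color_Lie begin

abbreviation "\<phi>U \<equiv> env_phi \<epsilon> scale V L \<omega>"

lemma pU_comm:
  assumes "a \<in> V g" "b \<in> V k"
  shows "pU (mon [a] * mon [b] - sm (\<epsilon> g k) (mon [b] * mon [a])) = pU (mon [L a b] + sm (\<omega> a b) 1)"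
proof -
  have "env_rel L \<omega> g k a b \<in> env_gens L \<omega>" using assms by (auto simp: env_gens_def)
  then have "pU (env_rel L \<omega> g k a b) = pU 0" by (rule piU_presentation(4))
  then show ?thesis unfolding U.eq_iff env_rel_def by (simp add: U.zero diff_diff_eq add.assoc del: sm_single)
qed

text \<open>Identifies the definite description: \<open>symbol_map\<close> descends to S(V) because
  commutators drop in the filtration, and it is the only candidate because S(V) is generated by
  V.\<close>

lemma env_phi_piS: "\<phi>U (piS p) = symbol_map UL pU p"
  and env_phi_hom: "\<phi>U \<in> alg_hom Sym (assoc_graded UL)"
proof -
  have g: "symbol_map UL pU p = symbol_map UL pU q" if "piS p = piS q" for p q
  proof (rule symbol_map_piS[OF UF.filtered_hom_axioms piU_presentation(3) _ that])
    fix a b g k assume ab: "a \<in> V g" "b \<in> V k"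
    show "pU (mon [a] * mon [b] - sm (\<epsilon> g k) (mon [b] * mon [a])) \<in> filt UL 1"
      unfolding pU_comm[OF ab] by (intro UF.filt_keys keys_subset_closed) (simp_all add: zero_list_def)
  qed
  \<comment> \<open>A value is read off from an arbitrary representative, which is harmless by
    \<open>g\<close>; the restriction meets the demand of extensionality.\<close>
  define \<psi> where "\<psi> = restrict (\<lambda>s. symbol_map UL pU (SOME p. piS p = s)) (carrier Sym)"
  have \<psi>: "\<psi> (piS p) = symbol_map UL pU p" for p
  proof -
    have "piS (SOME q. piS q = piS p) = piS p" by (rule someI[of "\<lambda>q. piS q = piS p"]) simp
    from g[OF this] show ?thesis by (simp add: \<psi>_def)
  qed
  have hom: "\<psi> \<in> alg_hom Sym (assoc_graded UL)"
    using alg_hom_factor[OF S.hom range_piS UF.symbol_map_hom] \<psi> by blast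
  have gen: "symbol_map UL pU (mon [x]) = gr_class UL 1 (env_proj \<epsilon> scale V L \<omega> (pure_tensor scale [x]))" for x
    by (subst UF.symbol_map_keys[where n = 1]) (simp_all add: piU_def pure_tensor)
  have "\<phi>U = \<psi>"
    unfolding env_phi_def
  proof (rule the_equality)
    show "\<psi> \<in> alg_hom Sym (assoc_graded UL) \<and> \<psi> \<in> extensional (carrier Sym) \<and>
      (\<forall>x. \<psi> (sym_proj \<epsilon> scale V (pure_tensor scale [x])) = gr_class UL 1 (env_proj \<epsilon> scale V L \<omega> (pure_tensor scale [x])))"
      using hom \<psi> gen by (simp add: pure_tensor piS_def[symmetric]) (simp add: \<psi>_def)
  next
    fix \<phi> assume \<phi>: "\<phi> \<in> alg_hom Sym (assoc_graded UL) \<and> \<phi> \<in> extensional (carrier Sym) \<and>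
      (\<forall>x. \<phi> (sym_proj \<epsilon> scale V (pure_tensor scale [x])) = gr_class UL 1 (env_proj \<epsilon> scale V L \<omega> (pure_tensor scale [x])))"
    have "\<phi> (piS p) = symbol_map UL pU p" for p
    proof (rule alg_hom_free_eqI[of "\<lambda>p. \<phi> (piS p)" "assoc_graded UL" _ UNIV])
      show "(\<lambda>p. \<phi> (piS p)) \<in> alg_hom free_algebra (assoc_graded UL)"
        using \<phi> alg_hom_comp[OF S.hom] by blast
      show "\<phi> (piS (mon [v])) = symbol_map UL pU (mon [v])" for v
        using \<phi> gen by (simp add: piS_def pure_tensor)
    qed (auto intro: UF.symbol_map_hom)
    then have "\<phi> s = \<psi> s" if "s \<in> carrier Sym" for s using that \<psi> range_piS by (metis rangeE)
    then show "\<phi> = \<psi>" using \<phi> by (intro extensionalityI[of _ "carrier Sym"]) (auto simp: \<psi>_def)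
  qed
  then show "\<phi>U (piS p) = symbol_map UL pU p" "\<phi>U \<in> alg_hom Sym (assoc_graded UL)" using \<psi> hom by auto
qed

text \<open>Injectivity of \<phi>_\<omega>. The length n part is replaced by its normal form in
  S(V), still of length n. If its image lies in F_{n-1}, its normal form in U has length below n;
  but it is already normal in U, so it is zero.\<close>

lemma piS_eq_zeroI:
  assumes "\<And>n. pU (lcomp n p) \<in> filt_pred UL n"
  shows "piS p = piS 0"
proof -
  interpret triv: color_Lie scale \<epsilon> V "\<lambda>_ _. 0" "\<lambda>_ _. 0" by (rule triv)
  have 0: "piS (lcomp n p) = piS 0" for n
  proof -
    let ?r = "lcomp n p" and ?s = "triv.nf (lcomp n p)"
    have kr: "keys ?r \<subseteq> {w. length w = n}" by (auto simp: keys_pcomp)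
    have ks: "keys ?s \<subseteq> {w. length w = n}" by (intro triv.keys_nf_length_eq kr) auto
    \<comment> \<open>The normal form is taken for the zero structure, yet it is normal for L and
      \<omega> as well.\<close>
    have nfs: "nf ?s = ?s" by (rule nf_normal) (rule triv.keys_nf)
    have eq: "piS ?r = piS ?s" unfolding piS_piU by (rule triv.pU_nf[symmetric])
    then have "symbol_map UL pU ?r = symbol_map UL pU ?s" using env_phi_piS by metis
    then have "pU (lcomp n (?r - ?s)) \<in> filt_pred UL n" by (simp add: UF.symbol_map_eq_iff)
    moreover have "lcomp n (?r - ?s) = ?r - ?s"
      by (intro pcomp_id) (use keys_subset_closed(4)[OF kr ks] in blast)
    ultimately have "pU ?r \<ominus>\<^bsub>UL\<^esub> (pU ?r \<ominus>\<^bsub>UL\<^esub> pU ?s) \<in> filt_pred UL n"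
      using assms U.A.subspaceD(6)[OF UF.pred_subspace] by (simp add: U.diff)
    then have s: "pU ?s \<in> filt_pred UL n" by (simp add: U.diff[symmetric])
    have "?s = 0"
    proof (cases n)
      case 0
      then have "pU ?s = pU 0" using s by (simp add: UF.pred_0 U.zero)
      then show ?thesis using nfs by (simp add: pU_eq_iff)
    next
      case (Suc m)
      then have "filt_pred UL n = filt UL m" by (simp add: UF.pred_Suc)
      then obtain q where q: "keys q \<subseteq> {w. length w \<le> m}" "pU ?s = pU q"
        using s unfolding filt_U by blast
      then have "?s = nf q" using nfs by (simp add: pU_eq_iff)
      then have "keys ?s \<subseteq> {w. length w \<le> m} \<inter> {w. length w = n}" using keys_nf_length[OF q(1)] ks by auto
      then have "keys ?s = {}" using Suc by (intro equals0I) (auto dest!: subsetD)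
      then show ?thesis by simp
    qed
    then show ?thesis using eq by simp
  qed
  have "p = (\<Sum>n\<in>length ` keys p. lcomp n p)" by (rule pcomp_sum_fibres[symmetric]) auto
  then have "piS p = piS (\<Sum>n\<in>length ` keys p. lcomp n p)" by simp
  also have "\<dots> = piS (\<Sum>n\<in>length ` keys p. 0)" using 0 by (rule S.eq_sum)
  finally show ?thesis by simp
qed

theorem env_algebra_object: "(UL, \<phi>U) \<in> Obj"
  unfolding R_objects_def
proof (intro CollectI case_prodI conjI allI)
  show "graded_filtered_algebra UL" by (rule graded_filtered_U)
  show "\<phi>U \<in> alg_hom Sym (assoc_graded UL)" by (rule env_phi_hom)
  show "bij_betw \<phi>U (carrier Sym) (carrier (assoc_graded UL))"
    unfolding bij_betw_def range_piS[symmetric]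
  proof
    show "inj_on \<phi>U (range piS)"
    proof (rule inj_onI)
      fix x y assume "x \<in> range piS" "y \<in> range piS" "\<phi>U x = \<phi>U y"
      then obtain p q where "x = piS p" "y = piS q" "symbol_map UL pU p = symbol_map UL pU q" by (auto simp: env_phi_piS)
      moreover from this have "piS (p - q) = piS 0" by (intro piS_eq_zeroI) (simp add: UF.symbol_map_eq_iff)
      ultimately show "x = y" using S.eq_iff[of p q] by (simp add: S.zero)
    qed
    show "\<phi>U ` range piS = carrier (assoc_graded UL)"
    proof
      show "\<phi>U ` range piS \<subseteq> carrier (assoc_graded UL)" 
        using alg_homD(1)[OF UF.symbol_map_hom] by (auto simp: env_phi_piS)
      show "carrier (assoc_graded UL) \<subseteq> \<phi>U ` range piS"
      proof
        fix f assume "f \<in> carrier (assoc_graded UL)"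
        then obtain p where "f = symbol_map UL pU p" using UF.symbol_map_surj[of f] unfolding filt_U by blast
        then show "f \<in> \<phi>U ` range piS" by (auto simp: env_phi_piS[symmetric])
      qed
    qed
  qed
  fix n g
  show "\<phi>U ` sym_homog \<epsilon> scale V n g = assoc_graded_homog UL n g"
  proof (intro equalityI subsetI)
    fix x assume "x \<in> \<phi>U ` sym_homog \<epsilon> scale V n g"
    then obtain p where p: "keys p \<subseteq> {w. length w = n} \<inter> hwords g" "x = symbol_map UL pU p"
      unfolding sym_homog by (auto simp: env_phi_piS)
    then have "x = gr_class UL n (pU p)" using UF.symbol_map_keys[of p n] by simp
    moreover have "pU p \<in> filt UL n" using p by (intro UF.filt_keys) auto
    moreover have "pU p \<in> homog UL g" unfolding homog_U using p by blast
    ultimately show "x \<in> assoc_graded_homog UL n g" unfolding assoc_graded_homog_def by blast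
  next
    fix x assume "x \<in> assoc_graded_homog UL n g"
    then obtain y where y: "x = gr_class UL n y" "y \<in> filt UL n" "y \<in> homog UL g"
      unfolding assoc_graded_homog_def by blast
    then obtain p q where p: "y = pU p" "keys p \<subseteq> {w. length w \<le> n}" and q: "y = pU q" "keys q \<subseteq> hwords g"
      unfolding filt_U homog_U by blast
    \<comment> \<open>Here p has bounded length and q the right degree, and they may differ; their
      common normal form has both properties.\<close>
    let ?s = "nf p"
    have s: "keys ?s \<subseteq> {w. length w \<le> n}" "keys ?s \<subseteq> {w. wdeg w = g}" "keys ?s \<subseteq> lists hB"
      using keys_nf_length[OF p(2)] keys_nf_hwords[OF q(2)] p(1) q(1) keys_nf[of p]
      by (auto simp: pU_eq_iff normal_def)
    have "x = gr_class UL n (pU (lcomp n ?s))"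
      unfolding UF.gr_class_lcomp[OF s(1)] y(1) p(1) pU_nf ..
    then have "x = \<phi>U (piS (lcomp n ?s))"
      unfolding env_phi_piS by (subst UF.symbol_map_keys[where n = n]) (auto simp: keys_pcomp)
    moreover have "keys (lcomp n ?s) \<subseteq> {w. length w = n} \<inter> hwords g"
      using s hB_hwords by (auto simp: keys_pcomp subset_iff)
    ultimately show "x \<in> \<phi>U ` sym_homog \<epsilon> scale V n g" unfolding sym_homog by blast
  qed
qed

end

section \<open>Presentations of objects\<close>

context color_space begin

text \<open>A lift of V into F_1 A, namely the vectors \<open>h (mon [v])\<close>, together with its
  multiplicative extension; it is linear, graded, and compatible with \<phi> on leading
  terms.\<close>

definition presents :: "('k, 'a, 'g) graded_filtered \<Rightarrow> (('v, 'k) tensors set \<Rightarrow> nat \<Rightarrow> 'a set) \<Rightarrow>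
    (('v list \<Rightarrow>\<^sub>0 'k) \<Rightarrow> 'a) \<Rightarrow> bool" where
  "presents A \<phi> h \<longleftrightarrow> filtered_hom A h \<and> (\<forall>p\<in>lin_gens. h p = h 0) \<and>
     (\<forall>p. \<phi> (piS p) = symbol_map A h p) \<and> (\<forall>g. \<forall>w\<in>hwords g. h (mon w) \<in> homog A g)"

lemma presentsD:
  assumes "presents A \<phi> h"
  shows "filtered_hom A h" "p \<in> lin_gens \<Longrightarrow> h p = h 0" "\<phi> (piS p) = symbol_map A h p"
    "w \<in> hwords g \<Longrightarrow> h (mon w) \<in> homog A g"
  using assms by (auto simp: presents_def)

lemma presents_homog:
  assumes "presents A \<phi> h" "keys p \<subseteq> hwords g"
  shows "h p \<in> homog A g"
proof -
  interpret filtered_hom A h by (rule presentsD[OF assms(1)])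
  note s = subspaceD[OF homog_subspace]
  show ?thesis using assms(2)
    by (induction p rule: free_induct) (auto simp: zero add sm s presentsD(4)[OF assms(1)] simp del: sm_single)
qed

lemma objectD:
  assumes "(A, \<phi>) \<in> Obj"
  shows "gfa A" "\<phi> \<in> alg_hom Sym (assoc_graded A)" "\<phi> (piS p) = \<phi> (piS q) \<Longrightarrow> piS p = piS q"
    "f \<in> carrier (assoc_graded A) \<Longrightarrow> \<exists>p. f = \<phi> (piS p)"
    "\<phi> ` sym_homog \<epsilon> scale V n g = assoc_graded_homog A n g"
proof -
  have o: "graded_filtered_algebra A" "\<phi> \<in> alg_hom Sym (assoc_graded A)"
     "bij_betw \<phi> (range piS) (carrier (assoc_graded A))"
     "\<forall>n g. \<phi> ` sym_homog \<epsilon> scale V n g = assoc_graded_homog A n g"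
    using assms unfolding range_piS by (auto simp: R_objects_def)
  show "gfa A" using o(1) by (simp add: gfa_def gfa_axioms_def graded_filtered_algebra_def graded_algebra_def)
  show "\<phi> \<in> alg_hom Sym (assoc_graded A)" by (rule o(2))
  show "\<phi> (piS p) = \<phi> (piS q) \<Longrightarrow> piS p = piS q" using o(3) by (auto simp: bij_betw_def dest: inj_onD)
  show "f \<in> carrier (assoc_graded A) \<Longrightarrow> \<exists>p. f = \<phi> (piS p)" using o(3) unfolding bij_betw_def by blast
  show "\<phi> ` sym_homog \<epsilon> scale V n g = assoc_graded_homog A n g" using o(4) by blast
qed

context
  fixes A :: "('k, 'a, 'g) graded_filtered" and \<phi> h
  assumes obj: "(A, \<phi>) \<in> Obj" and pres: "presents A \<phi> h"
begin

interpretation filtered_hom A h by (rule presentsD(1)[OF pres])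

text \<open>Surjectivity of \<phi> provides an element of length n with the same leading class;
  subtracting it lowers the filtration degree.\<close>

lemma object_filt: "x \<in> filt A n \<Longrightarrow> \<exists>p. keys p \<subseteq> {w. length w \<le> n} \<and> x = h p"
proof (induction n arbitrary: x)
  have lift: "\<exists>p. keys p \<subseteq> {w. length w = n} \<and> x \<ominus>\<^bsub>A\<^esub> h p \<in> filt_pred A n" if x: "x \<in> filt A n" for x n
  proof -
    have "finite {m. gr_class A n x m \<noteq> filt_pred A m}"
      by (rule finite_subset[of _ "{n}"]) (auto simp: gr_class_def)
    moreover have "\<exists>y\<in>filt A m. gr_class A n x m = filt_pred A m +>\<^bsub>A\<^esub> y" for m
      using x subspaceD(2)[OF filt_subspace[of m]] coset_zero[OF pred_subspace[of m]]
      by (cases "m = n") (auto simp: gr_class_def)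
    ultimately have "gr_class A n x \<in> carrier (assoc_graded A)" by (simp add: assoc_graded_def)
    then obtain p where "gr_class A n x = symbol_map A h p"
      using objectD(4)[OF obj] presentsD(3)[OF pres] by metis
    from fun_cong[OF this, of n] have "x \<ominus>\<^bsub>A\<^esub> h (lcomp n p) \<in> filt_pred A n"
      using subspaceD(1)[OF filt_subspace x] by (simp add: gr_class_def symbol_map_def coset_eq_iff[OF pred_subspace])
    then show ?thesis by (intro exI[of _ "lcomp n p"]) (auto simp: keys_pcomp)
  qed
  {
    case 0
    then show ?case using lift[OF 0] subspaceD(1)[OF filt_subspace 0] by (auto simp: pred_0 minus_zero_iff)
  next
    case (Suc n)
    obtain p where p: "keys p \<subseteq> {w. length w = Suc n}" "x \<ominus>\<^bsub>A\<^esub> h p \<in> filt A n"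
      using lift[OF Suc.prems] by (auto simp: pred_Suc)
    obtain q where q: "keys q \<subseteq> {w. length w \<le> n}" "x \<ominus>\<^bsub>A\<^esub> h p = h q" using Suc.IH[OF p(2)] by blast
    have "x = h (q + p)"
      using subspaceD(1)[OF filt_subspace Suc.prems] by (simp add: add q(2)[symmetric] a_minus_def a_assoc l_neg)
    moreover have "keys (q + p) \<subseteq> {w. length w \<le> Suc n}" using p q by (intro keys_subset_closed) auto
    ultimately show ?case by blast
  }
qed

lemma object_surj: "range h = carrier A"
  using object_filt filt_Union by auto blast

text \<open>The sum of V and the scalars in F_1 A is direct: the class modulo F_0 determines the
  vector, and then the scalar is determined, both by injectivity of \<phi> and
  \<open>piS_low\<close>. Equations between such elements thus split into a vector part and a scalar
  part.\<close>

lemma object_low_inj: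
  assumes "h (mon [v] + sm c 1) = h (mon [w] + sm d 1)"
  shows "v = w" "c = d"
proof -
  have k: "keys (sm c (1 :: 'v list \<Rightarrow>\<^sub>0 'k)) \<subseteq> {w. length w = 0}" for c
    by (intro keys_subset_closed(3)) (simp add: zero_list_def)
  have "h (mon [v]) \<ominus>\<^bsub>A\<^esub> h (mon [w]) = h (sm (d - c) 1)"
  proof -
    have "h (mon [v] - mon [w] - sm (d - c) 1) = \<zero>\<^bsub>A\<^esub>"
      using assms unfolding eq_iff by (simp add: algebra_simps smv.scale_left_diff_distrib del: sm_single)
    then show ?thesis unfolding eq_iff[symmetric] by (simp add: diff)
  qed
  then have "h (mon [v]) \<ominus>\<^bsub>A\<^esub> h (mon [w]) \<in> filt_pred A 1"
    using filt_keys[of "sm (d - c) 1" 0] k pred_Suc[of 0] by simp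
  then have "gr_class A 1 (h (mon [v])) = gr_class A 1 (h (mon [w]))"
    by (simp add: gr_class_def coset_eq_iff[OF pred_subspace] fun_eq_iff)
  then have "\<phi> (piS (mon [v])) = \<phi> (piS (mon [w]))"
    unfolding presentsD(3)[OF pres] by (subst (1 2) symbol_map_keys[where n = 1]) auto
  then have "piS (mon [v]) = piS (mon [w])" by (rule objectD(3)[OF obj])
  from piS_low(2)[OF this] show "v = w" by (simp add: vector_part_mon)
  with assms have "h (sm c 1) = h (sm d 1)"
    unfolding eq_iff by (simp add: algebra_simps del: sm_single)
  then have "\<phi> (piS (sm c 1)) = \<phi> (piS (sm d 1))"
    unfolding presentsD(3)[OF pres] symbol_map_keys[OF k] by (rule arg_cong)
  then have "piS (sm c 1) = piS (sm d 1)" by (rule objectD(3)[OF obj])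
  from piS_low(1)[OF this] show "c = d" by (simp add: lookup_one zero_list_def)
qed

end

lemma presents_morphism:
  assumes "presents A \<phi> h" "(B, \<psi>) \<in> Obj" "M \<in> Mor (A, \<phi>) (B, \<psi>)"
  shows "presents B \<psi> (\<lambda>p. M (h p))"
proof -
  interpret filtered_hom A h by (rule presentsD(1)[OF assms(1)])
  interpret B: gfa B by (rule objectD[OF assms(2)])
  have M: "M \<in> alg_hom A B" "\<And>g. M ` homog A g \<subseteq> homog B g" "\<And>n. M ` filt A n \<subseteq> filt B n"
    "\<And>s. s \<in> carrier Sym \<Longrightarrow> assoc_graded_map B M (\<phi> s) = \<psi> s"
    using assms(3) by (auto simp: R_morphisms_def)
  have fh: "filtered_hom B (\<lambda>p. M (h p))"
    unfolding filtered_hom_def filtered_hom_axioms_def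
    using M(3) filt_word by (auto intro!: free_homI B.k_algebra_axioms B.gfa_axioms alg_hom_comp[OF hom M(1)])
  show ?thesis
    unfolding presents_def
  proof (intro conjI fh ballI allI)
    show "M (h p) = M (h 0)" if "p \<in> lin_gens" for p using presentsD(2)[OF assms(1) that] by simp
    show "\<psi> (piS p) = symbol_map B (\<lambda>p. M (h p)) p" for p
      using M(4)[of "piS p"] assoc_graded_map_symbol_map[OF B.gfa_axioms M(1,3)] presentsD(3)[OF assms(1)] by simp
    show "M (h (mon w)) \<in> homog B g" if "w \<in> hwords g" for w g using presentsD(4)[OF assms(1) that] M(2) by blast
  qed
qed

section \<open>Change of the lift by a linear form\<close>

definition shift :: "('v \<Rightarrow> 'k) \<Rightarrow> ('v list \<Rightarrow>\<^sub>0 'k) \<Rightarrow> 'v list \<Rightarrow>\<^sub>0 'k" where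
  "shift f = alift free_algebra (\<lambda>v. mon [v] + sm (f v) 1)"

lemma shift_hom: "shift f \<in> alg_hom free_algebra free_algebra"
  unfolding shift_def by (rule k_algebra.alift_hom[OF k_algebra_free]) simp

lemma shift_mon: "shift f (mon [v]) = mon [v] + sm (f v) 1"
  unfolding shift_def by (rule k_algebra.alift_mon[OF k_algebra_free]) simp

lemma free_hom_shift: "free_hom free_algebra (shift f)"
  by (intro free_homI k_algebra_free shift_hom)

lemma shift_0: "shift f 0 = 0" and shift_diff: "shift f (p - q) = shift f p - shift f q"
  using free_hom.zero[OF free_hom_shift] free_hom.diff[OF free_hom_shift] by simp_all

lemmas shift_simps = alg_homD[OF shift_hom, simplified]

lemma shift_Cons: "shift f (mon (a # w)) = mon [a] * shift f (mon w) + sm (f a) (shift f (mon w))"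
proof -
  have "mon (a # w) = mon [a] * (mon w :: 'v list \<Rightarrow>\<^sub>0 'k)" by (simp add: mon_append)
  then have "shift f (mon (a # w)) = (mon [a] + sm (f a) 1) * shift f (mon w)"
    by (simp only: shift_simps(2) shift_mon)
  then show ?thesis by (simp only: distrib_right sm_mult mult_1_left)
qed

lemma shift_Nil: "shift f (mon []) = mon []"
  using shift_simps(4) by (simp add: zero_list_def[symmetric])

lemma keys_mon_mult: "keys (mon [a] * p) \<subseteq> (#) a ` keys p"
  by (auto elim!: keys_mult_listE)

lemma keys_shift_length: "keys (shift f (mon w)) \<subseteq> {x. length x \<le> length w}"
proof (induction w)
  case (Cons a w)
  show ?case unfolding shift_Cons using keys_mon_mult[of a "shift f (mon w)"] Cons
    by (intro keys_subset_closed) fastforce+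
qed (simp add: shift_Nil)

context
  fixes f :: "'v \<Rightarrow> 'k"
  assumes f: "\<And>g x. g \<noteq> 0 \<Longrightarrow> x \<in> V g \<Longrightarrow> f x = 0"
begin

lemma keys_shift_hwords: "w \<in> hwords g \<Longrightarrow> keys (shift f (mon w)) \<subseteq> hwords g"
proof (induction w arbitrary: g)
  case (Cons a w)
  then obtain k where k: "a \<in> V k" "w \<in> hwords (g - k)" by (auto simp: hwords_Cons)
  have "keys (mon [a] * shift f (mon w)) \<subseteq> hwords g" using keys_mon_mult[of a "shift f (mon w)"] Cons.IH[OF k(2)] k(1)
    by (auto simp: hwords_Cons dest!: subsetD)
  moreover have "keys (sm (f a) (shift f (mon w))) \<subseteq> hwords g"
    using f[OF _ k(1)] Cons.IH[OF k(2)] by (cases "k = 0") (simp_all add: keys_subset_closed)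
  ultimately show ?case unfolding shift_Cons by (rule keys_subset_closed(2))
qed (simp add: shift_Nil)

text \<open>As f lives in degree 0, the scalar f(a) commutes with b also in the color sense, so the
  shifts cancel in the commutator. Only the shift of the bracket remains, and it is a
  coboundary.\<close>

lemma shift_env_rel:
  assumes ab: "a \<in> V g" "b \<in> V k"
  shows "shift f (env_rel L \<omega> g k a b) = env_rel L (\<lambda>x y. \<omega> x y + f (L x y)) g k a b"
proof -
  have a: "\<epsilon> g k * f a = f a" using f[OF _ ab(1)] by (cases "g = 0") auto
  have b: "\<epsilon> g k * f b = f b" using f[OF _ ab(2)] by (cases "k = 0") auto
  have "shift f (env_rel L \<omega> g k a b) = (mon [a] + sm (f a) 1) * (mon [b] + sm (f b) 1)
     - sm (\<epsilon> g k) ((mon [b] + sm (f b) 1) * (mon [a] + sm (f a) 1)) - (mon [L a b] + sm (f (L a b)) 1) - sm (\<omega> a b) 1"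
    unfolding env_rel_def by (simp only: shift_simps shift_diff shift_mon)
  also have "\<dots> = env_rel L (\<lambda>x y. \<omega> x y + f (L x y)) g k a b"
    unfolding env_rel_def distrib_left distrib_right sm_mult mult_1_left mult_1_right smv.scale_right_distrib
      smv.scale_scale a b mult.assoc[symmetric]
    by (simp add: smv.scale_left_distrib algebra_simps a b del: sm_single)
  finally show ?thesis .
qed

end

text \<open>A scalar added to a lift is invisible modulo F_0, and f adds scalars only in degree 0,
  so leading terms and degrees are kept.\<close>

lemma presents_shift:
  assumes obj: "(A, \<phi>) \<in> Obj" and pres: "presents A \<phi> h"
    and f: "Vector_Spaces.linear scale (*) f" "\<And>g x. g \<noteq> 0 \<Longrightarrow> x \<in> V g \<Longrightarrow> f x = 0"
  shows "presents A \<phi> (\<lambda>p. h (shift f p))"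
proof -
  interpret filtered_hom A h by (rule presentsD(1)[OF pres])
  interpret f: Vector_Spaces.linear scale "(*)" f by (rule f(1))
  have hom': "(\<lambda>p. h (shift f p)) \<in> alg_hom free_algebra A" by (rule alg_hom_comp[OF shift_hom hom])
  interpret H: filtered_hom A "\<lambda>p. h (shift f p)"
  proof unfold_locales
    show "h (shift f (mon w)) \<in> filt A (length w)" for w by (rule filt_keys[OF keys_shift_length])
  qed (rule hom')
  note lin = hom_linear[OF free_hom_axioms presentsD(2)[OF pres]]
  show ?thesis
    unfolding presents_def
  proof (intro conjI ballI allI)
    show "filtered_hom A (\<lambda>p. h (shift f p))" by (rule H.filtered_hom_axioms)
    show "h (shift f (mon w)) \<in> homog A g" if "w \<in> hwords g" for w g
      by (rule presents_homog[OF pres keys_shift_hwords[OF f(2) that]])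
    show "h (shift f p) = h (shift f 0)" if "p \<in> lin_gens" for p
    proof -
      have 1: "h (mon [v + w] + sm (f (v + w)) 1) = h ((mon [v] + sm (f v) 1) + (mon [w] + sm (f w) 1))" for v w
        unfolding f.add smv.scale_left_distrib by (simp add: add lin(1) a_ac smv.scale_left_distrib del: sm_single)
      have 2: "h (mon [c *s v] + sm (f (c *s v)) 1) = h (sm c (mon [v] + sm (f v) 1))" for c v
        unfolding f.scale smv.scale_right_distrib by (simp add: add lin(2) del: sm_single)
      show ?thesis using that unfolding lin_gens_def
      proof (elim UnE CollectE exE conjE)
        fix v w assume p: "p = mon [v + w] - mon [v] - mon [w]"
        show ?thesis unfolding p shift_diff shift_mon shift_0 unfolding diff_diff_eq using 1[of v w] unfolding eq_iff by (simp add: zero)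
      next
        fix c v assume p: "p = mon [c *s v] - sm c (mon [v])"
        show ?thesis unfolding p shift_diff shift_simps(5) shift_mon shift_0 using 2[of c v] unfolding eq_iff by (simp add: zero)
      qed
    qed
    show "\<phi> (piS p) = symbol_map A (\<lambda>p. h (shift f p)) p" for p
    proof (rule alg_hom_free_eqI[of "\<lambda>p. \<phi> (piS p)" "assoc_graded A" _ UNIV])
      show "(\<lambda>p. \<phi> (piS p)) \<in> alg_hom free_algebra (assoc_graded A)"
        by (rule alg_hom_comp[OF S.hom objectD(2)[OF obj]])
      show "symbol_map A (\<lambda>p. h (shift f p)) \<in> alg_hom free_algebra (assoc_graded A)" by (rule H.symbol_map_hom)
      fix v
      have "\<phi> (piS (mon [v])) = gr_class A 1 (h (mon [v]))"
        unfolding presentsD(3)[OF pres] by (rule symbol_map_keys) simp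
      also have "h (mon [v]) = h (lcomp 1 (mon [v] + sm (f v) 1))"
        by (simp add: pcomp_add pcomp_sm pcomp_single zero_list_def flip: single_one)
      also have "gr_class A 1 \<dots> = gr_class A 1 (h (mon [v] + sm (f v) 1))"
        using keys_shift_length[of f "[v]"] by (intro gr_class_lcomp) (simp add: shift_mon del: sm_single)
      also have "\<dots> = symbol_map A (\<lambda>p. h (shift f p)) (mon [v])"
        by (subst H.symbol_map_keys[where n = 1]) (simp_all add: shift_mon)
      finally show "\<phi> (piS (mon [v])) = symbol_map A (\<lambda>p. h (shift f p)) (mon [v])" .
    qed auto
  qed
qed

end

lemma linear_mapI:
  assumes "vector_space s" "vector_space t" "\<And>x y. f (x + y) = f x + f y" "\<And>c x. f (s c x) = t c (f x)"
  shows "Vector_Spaces.linear s t f"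
  using assms unfolding Vector_Spaces.linear_def module_hom_def module_hom_axioms_def
  by (simp add: module_iff_vector_space)

text \<open>Associativity alone makes the cyclic sum of nested color commutators vanish. Here u, s,
  t are \<epsilon>(c,a), \<epsilon>(a,b), \<epsilon>(b,c), and m, n, l pair one element with the
  product of the other two.\<close>

lemma jacobi_identity:
  fixes A B C :: "'w::monoid_add \<Rightarrow>\<^sub>0 'k::field"
  assumes "u * m = s" "s * n = t" "t * l = u"
  shows "sm u (A * (B * C - sm t (C * B)) - sm m ((B * C - sm t (C * B)) * A))
    + sm s (B * (C * A - sm u (A * C)) - sm n ((C * A - sm u (A * C)) * B))
    + sm t (C * (A * B - sm s (B * A)) - sm l ((A * B - sm s (B * A)) * C)) = 0"
proof -
  have "u * (m * t) = s * t" "s * (n * u) = t * u" "t * (l * s) = u * s"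
    using assms by (simp_all add: mult.assoc[symmetric])
  note eqs = this assms
  show ?thesis
    unfolding right_diff_distrib left_diff_distrib sm_mult smv.scale_right_diff_distrib
      smv.scale_right_distrib smv.scale_scale mult.assoc eqs
    by (simp add: algebra_simps)
qed

section \<open>The lift, the bracket and the form of a given object\<close>

context color_space begin

lemma eps_cancel: "\<epsilon> a b * \<epsilon> b (c + a) = \<epsilon> b c"
proof -
  have "\<epsilon> a b * \<epsilon> b (c + a) = \<epsilon> b c * (\<epsilon> a b * \<epsilon> b a)" by (simp add: eps_add)
  then show ?thesis by (simp only: eps_inv mult_1_right)
qed

context
  fixes A :: "('k, 'a, 'g) graded_filtered" and \<phi>
  assumes obj: "(A, \<phi>) \<in> Obj"
begin

interpretation gfa A by (rule objectD(1)[OF obj])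

text \<open>As \<phi> is unital and bigraded, the class of 1 is the class of some y in F_0 of degree
  e; below F_0 there is only 0, so y is 1 itself.\<close>

lemma object_one: "\<one>\<^bsub>A\<^esub> \<in> filt A 0" "\<one>\<^bsub>A\<^esub> \<in> homog A 0"
proof -
  have "piS 1 \<in> sym_homog \<epsilon> scale V 0 0"
    unfolding sym_homog by (intro imageI) (simp add: zero_list_def hwords_Nil)
  moreover have "\<phi> (piS 1) = \<one>\<^bsub>assoc_graded A\<^esub>" unfolding S.one by (rule alg_homD(4)[OF objectD(2)[OF obj]])
  ultimately have "\<one>\<^bsub>assoc_graded A\<^esub> \<in> assoc_graded_homog A 0 0"
    using objectD(5)[OF obj, of 0 0] by (metis imageI)
  then obtain y where y: "y \<in> filt A 0" "y \<in> homog A 0" "\<one>\<^bsub>assoc_graded A\<^esub> = gr_class A 0 y"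
    by (auto simp: assoc_graded_homog_def)
  from fun_cong[OF y(3), of 0] have "\<one>\<^bsub>A\<^esub> \<ominus>\<^bsub>A\<^esub> y \<in> filt_pred A 0"
    using subspaceD(1)[OF filt_subspace y(1)]
    by (simp add: assoc_graded_def gr_class_def coset_eq_iff[OF pred_subspace])
  then have "\<one>\<^bsub>A\<^esub> = y" using subspaceD(1)[OF filt_subspace y(1)] by (simp add: pred_0 minus_zero_iff)
  then show "\<one>\<^bsub>A\<^esub> \<in> filt A 0" "\<one>\<^bsub>A\<^esub> \<in> homog A 0" using y by auto
qed

lemma lcomp_expand: "lcomp n (expand p) = expand (lcomp n p)"
proof (induction p rule: free_induct_UNIV)
  case (mon w)
  show ?case using keys_expand_mon[of w] by (auto simp: pcomp_single intro!: pcomp_id pcomp_none)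
qed (simp_all add: expand_add pcomp_add expand_sm pcomp_sm del: sm_single)

text \<open>Bigradedness of \<phi> provides homogeneous lifts of the basis vectors. Precomposing
  with \<open>expand\<close> extends them linearly to all vectors.\<close>

lemma object_presentation: "\<exists>h. presents A \<phi> h"
proof -
  have "\<exists>y. y \<in> filt A 1 \<and> y \<in> homog A (deg b) \<and> \<phi> (piS (mon [b])) = gr_class A 1 y" if b: "b \<in> hB" for b
  proof -
    have "piS (mon [b]) \<in> sym_homog \<epsilon> scale V 1 (deg b)"
      unfolding sym_homog using hB_V[OF b] by (intro imageI) (simp add: hwords_Cons hwords_Nil)
    then have "\<phi> (piS (mon [b])) \<in> assoc_graded_homog A 1 (deg b)" using objectD(5)[OF obj] by (metis imageI)
    then show ?thesis by (auto simp: assoc_graded_homog_def)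
  qed
  then obtain y where y: "\<And>b. b \<in> hB \<Longrightarrow> y b \<in> filt A 1" "\<And>b. b \<in> hB \<Longrightarrow> y b \<in> homog A (deg b)"
    "\<And>b. b \<in> hB \<Longrightarrow> \<phi> (piS (mon [b])) = gr_class A 1 (y b)" by metis
  \<comment> \<open>Zero is a safe default outside the basis: it lies in F_1, so the filtration
    condition holds for all words.\<close>
  define z where "z b = (if b \<in> hB then y b else \<zero>\<^bsub>A\<^esub>)" for b
  have zf: "z b \<in> filt A 1" for b using y(1) subspaceD(2)[OF filt_subspace] by (simp add: z_def)
  then have zc: "z b \<in> carrier A" for b using subspaceD(1)[OF filt_subspace] by blast
  define h0 where "h0 = alift A z"
  have hom0: "h0 \<in> alg_hom free_algebra A" unfolding h0_def by (rule alift_hom[OF zc])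
  have mon0: "h0 (mon [b]) = z b" for b unfolding h0_def by (rule alift_mon[OF zc])
  have Cons: "h0 (mon (a # w)) = z a \<otimes>\<^bsub>A\<^esub> h0 (mon w)" for a w
  proof -
    have "mon (a # w) = mon [a] * (mon w :: 'v list \<Rightarrow>\<^sub>0 'k)" by (simp add: mon_append)
    then show ?thesis using alg_homD(2)[OF hom0] mon0 by simp
  qed
  have Nil: "h0 (mon []) = \<one>\<^bsub>A\<^esub>" using alg_homD(4)[OF hom0] by (simp add: zero_list_def[symmetric])
  interpret H0: filtered_hom A h0
  proof unfold_locales
    fix w show "h0 (mon w) \<in> filt A (length w)"
    proof (induction w)
      case (Cons a w)
      then show ?case using filt_mult[OF zf, of "h0 (mon w)" "length w" a] by (simp add: \<open>\<And>w a. h0 (mon (a # w)) = _\<close>)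
    qed (simp add: Nil object_one)
  qed (rule hom0)
  have lenEf: "keys (expand (mon w)) \<subseteq> {x. length x \<le> length w}" for w using keys_expand_mon[of w] by auto
  interpret H: filtered_hom A "\<lambda>p. h0 (expand p)"
  proof unfold_locales
    show "h0 (expand (mon w)) \<in> filt A (length w)" for w by (rule H0.filt_keys[OF lenEf])
  qed (rule alg_hom_comp[OF expand_hom hom0])
  have hg0: "h0 (mon w) \<in> homog A (wdeg w)" if "w \<in> lists hB" for w
    using that
  proof (induction w)
    case (Cons a w)
    then show ?case using homog_mult[of "z a" "deg a" "h0 (mon w)" "wdeg w"] y(2) 
      by (simp add: \<open>\<And>w a. h0 (mon (a # w)) = _\<close> z_def)
  qed (simp add: Nil object_one)
  have hg: "h0 p \<in> homog A g" if "keys p \<subseteq> {w \<in> lists hB. wdeg w = g}" for p g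
    using that by (induction p rule: free_induct)
      (use hg0 in \<open>auto simp: H0.zero H0.add H0.sm subspaceD[OF homog_subspace] simp del: sm_single\<close>)
  have piS_Ef: "piS (expand p) = piS p" for p
    by (rule hom_expand[OF S.free_hom_axioms]) (simp add: piS_piU piU_presentation(3))
  have gam: "\<phi> (piS p) = symbol_map A h0 p" if "keys p \<subseteq> lists hB" for p
  proof (rule alg_hom_free_eqI[of "\<lambda>p. \<phi> (piS p)" "assoc_graded A" _ hB])
    show "(\<lambda>p. \<phi> (piS p)) \<in> alg_hom free_algebra (assoc_graded A)"
      by (rule alg_hom_comp[OF S.hom objectD(2)[OF obj]])
    show "\<phi> (piS (mon [b])) = symbol_map A h0 (mon [b])" if "b \<in> hB" for b
      using y(3)[OF that] that by (subst H0.symbol_map_keys[where n = 1]) (simp_all add: mon0 z_def)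
  qed (use that H0.symbol_map_hom in auto)
  have "presents A \<phi> (\<lambda>p. h0 (expand p))"
    unfolding presents_def
  proof (intro conjI ballI allI)
    show "h0 (expand p) = h0 (expand 0)" if "p \<in> lin_gens" for p
      using that by (auto simp: lin_gens_def expand_diff expand_mon expand_sm e_add e_scale simp del: sm_single)
    show "\<phi> (piS p) = symbol_map A (\<lambda>p. h0 (expand p)) p" for p
      using gam[OF keys_expand_all] by (simp add: piS_Ef symbol_map_def lcomp_expand)
    show "h0 (expand (mon w)) \<in> homog A g" if "w \<in> hwords g" for w g
      using keys_expand_mon[of w] keys_expand_hwords[OF that] by (intro hg) blast
  qed (rule H.filtered_hom_axioms)
  then show ?thesis by blast
qed

text \<open>Color commutators of lifts lie in F_1 A, and \<open>object_low_inj\<close> turns each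
  identity in A into one for L and one for \<omega>.\<close>

lemma object_structure:
  assumes pres: "presents A \<phi> h"
  shows "\<exists>L \<omega>. color_Lie scale \<epsilon> V L \<omega> \<and> (\<forall>p\<in>env_gens L \<omega>. h p = h 0)"
proof -
  interpret filtered_hom A h by (rule presentsD(1)[OF pres])
  note lin = hom_linear[OF free_hom_axioms presentsD(2)[OF pres]]
  note hEf = hom_expand[OF free_hom_axioms presentsD(2)[OF pres]]
  note inj = object_low_inj[OF obj pres]
  \<comment> \<open>The leading term of a homogeneous element can be represented by homogeneous
    words of the same degree, because \<phi> is bigraded.\<close>
  have gr: "\<exists>p. keys p \<subseteq> {w. length w = n} \<inter> hwords g \<and> x \<ominus>\<^bsub>A\<^esub> h p \<in> filt_pred A n"
    if x: "x \<in> filt A n" "x \<in> homog A g" for x n g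
  proof -
    have "gr_class A n x \<in> \<phi> ` sym_homog \<epsilon> scale V n g"
      unfolding objectD(5)[OF obj] assoc_graded_homog_def using x by blast
    then obtain p where p: "keys p \<subseteq> {w. length w = n} \<inter> hwords g" "gr_class A n x = symbol_map A h p"
      unfolding sym_homog using presentsD(3)[OF pres] by auto
    have "symbol_map A h p = gr_class A n (h p)" using p(1) by (intro symbol_map_keys) auto
    from fun_cong[OF p(2)[unfolded this], of n] show ?thesis
      using p(1) subspaceD(1)[OF filt_subspace x(1)] by (auto simp: gr_class_def coset_eq_iff[OF pred_subspace])
  qed
  have F0: "\<exists>c. x = h (sm c 1) \<and> (g \<noteq> 0 \<longrightarrow> c = 0)" if x: "x \<in> filt A 0" "x \<in> homog A g" for x g
  proof -
    obtain p where p: "keys p \<subseteq> {w. length w = 0} \<inter> hwords g" "x = h p"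
      using gr[OF x] subspaceD(1)[OF filt_subspace x(1)] by (auto simp: pred_0 minus_zero_iff)
    have "p = sm (lookup p []) 1"
      using p(1) by (intro poly_mapping_eqI) (auto simp: lookup_one zero_list_def when_def in_keys_iff subset_iff)
    moreover have "g \<noteq> 0 \<longrightarrow> lookup p [] = 0" using p(1) by (auto simp: in_keys_iff hwords_Nil subset_iff)
    ultimately show ?thesis using p(2) by metis
  qed
  have F1: "\<exists>v c. v \<in> V g \<and> x = h (mon [v] + sm c 1) \<and> (g \<noteq> 0 \<longrightarrow> c = 0)" if x: "x \<in> filt A 1" "x \<in> homog A g" for x g
  proof -
    obtain p where p: "keys p \<subseteq> {w. length w = 1} \<inter> hwords g" "x \<ominus>\<^bsub>A\<^esub> h p \<in> filt A 0"
      using gr[OF x] pred_Suc[of 0] by auto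
    have hp: "h p = h (mon [vector_part p])"
      using p(1) by (intro hom_vector_part[OF free_hom_axioms presentsD(2)[OF pres]]) auto
    have "h p \<in> homog A g" using p(1) by (intro presents_homog[OF pres]) auto
    then have "x \<ominus>\<^bsub>A\<^esub> h p \<in> homog A g" using x(2) subspaceD(6)[OF homog_subspace] by blast
    then obtain c where c: "x \<ominus>\<^bsub>A\<^esub> h p = h (sm c 1)" "g \<noteq> 0 \<longrightarrow> c = 0" using F0[OF p(2)] by blast
    have "x = h (sm c 1) \<oplus>\<^bsub>A\<^esub> h p"
      using subspaceD(1)[OF filt_subspace x(1)] by (simp add: c(1)[symmetric] a_minus_def a_assoc l_neg)
    then have "x = h (mon [vector_part p] + sm c 1)" by (simp add: add hp a_comm)
    then show ?thesis using vector_part_V[OF p(1)] c(2) by blast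
  qed
  let ?k = "\<lambda>g k a b. mon [a] * mon [b] - sm (\<epsilon> g k) (mon [b] * mon [a])"
  interpret triv: color_Lie scale \<epsilon> V "\<lambda>_ _. 0" "\<lambda>_ _. 0" by (rule triv)
  have comm: "\<exists>v c. v \<in> V (g + k) \<and> h (?k g k a b) = h (mon [v] + sm c 1) \<and> (g + k \<noteq> 0 \<longrightarrow> c = 0)"
    if ab: "a \<in> V g" "b \<in> V k" for a b g k
  proof (rule F1)
    \<comment> \<open>In S(V) the commutator is zero, so its symbol in degree 2 vanishes and it
      drops from F_2 to F_1.\<close>
    have "piS (?k g k a b) = piS (mon [0])" using triv.pU_comm[OF ab] by (simp add: piS_piU)
    also have "\<dots> = piS 0"
      by (rule hom_linear(3)[OF S.free_hom_axioms]) (simp add: piS_piU piU_presentation(3))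
    finally have "symbol_map A h (?k g k a b) = symbol_map A h 0" using presentsD(3)[OF pres] by metis
    then have "h (lcomp 2 (?k g k a b - 0)) \<in> filt_pred A 2" unfolding symbol_map_eq_iff by blast
    moreover have "lcomp 2 (?k g k a b) = ?k g k a b"
      by (simp add: mon_append pcomp_diff pcomp_single)
    ultimately show "h (?k g k a b) \<in> filt A 1" using pred_Suc[of 1] by (simp add: numeral_2_eq_2)
    have "[a] @ [b] \<in> hwords (g + k)" "[b] @ [a] \<in> hwords (k + g)"
      using ab by (intro hwords_append; simp add: hwords_Cons hwords_Nil)+
    then have "keys (?k g k a b) \<subseteq> hwords (g + k)"
      unfolding mon_append by (intro keys_subset_closed(3,4)) (simp_all add: add.commute)
    then show "h (?k g k a b) \<in> homog A (g + k)" by (rule presents_homog[OF pres])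
  qed
  \<comment> \<open>Values are chosen for pairs of basis vectors only and extended bilinearly;
    \<open>hR\<close> shows that the extension describes the commutators of all homogeneous
    vectors.\<close>
  have "\<exists>v c. v \<in> V (deg a + deg b) \<and> h (?k (deg a) (deg b) a b) = h (mon [v] + sm c 1) \<and> (deg a + deg b \<noteq> 0 \<longrightarrow> c = 0)"
    if "a \<in> hB" "b \<in> hB" for a b using comm[OF hB_V hB_V] that by blast
  then obtain l w where l: "\<And>a b. a \<in> hB \<Longrightarrow> b \<in> hB \<Longrightarrow> l a b \<in> V (deg a + deg b)"
    and lw: "\<And>a b. a \<in> hB \<Longrightarrow> b \<in> hB \<Longrightarrow> h (?k (deg a) (deg b) a b) = h (mon [l a b] + sm (w a b) 1)"
    and w: "\<And>a b. a \<in> hB \<Longrightarrow> b \<in> hB \<Longrightarrow> deg a + deg b \<noteq> 0 \<Longrightarrow> w a b = 0"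
    by metis
  interpret vv: vector_space_pair scale scale by unfold_locales
  interpret vk: vector_space_pair scale "(*)" by unfold_locales (simp_all add: algebra_simps)
  define L where "L x y = vv.construct hB (\<lambda>a. vv.construct hB (l a) y) x" for x y
  define \<omega> where "\<omega> x y = vk.construct hB (\<lambda>a. vk.construct hB (w a) y) x" for x y
  have L1: "Vector_Spaces.linear scale scale (\<lambda>x. L x y)" for y
    unfolding L_def by (rule vv.linear_construct[OF hB(2)])
  have \<omega>1: "Vector_Spaces.linear scale (*) (\<lambda>x. \<omega> x y)" for y
    unfolding \<omega>_def by (rule vk.linear_construct[OF hB(2)])
  have L2: "Vector_Spaces.linear scale scale (L x)" for x
    by (rule linear_mapI) (unfold_locales, unfold_locales,
      simp_all add: L_def vv.linear_add[OF vv.linear_construct[OF hB(2)]] vv.linear_scale[OF vv.linear_construct[OF hB(2)]]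
        vv.construct_add[OF hB(2)] vv.construct_scale[OF hB(2)])
  have \<omega>2: "Vector_Spaces.linear scale (*) (\<omega> x)" for x
    by (rule linear_mapI) (unfold_locales, unfold_locales,
      simp_all add: \<omega>_def vk.linear_add[OF vk.linear_construct[OF hB(2)]] vk.linear_scale[OF vk.linear_construct[OF hB(2)]]
        vk.construct_add[OF hB(2)] vk.construct_scale[OF hB(2)])
  have Lb: "L a b = l a b" "\<omega> a b = w a b" if "a \<in> hB" "b \<in> hB" for a b
    using that by (simp_all add: L_def \<omega>_def vv.construct_basis[OF hB(2)] vk.construct_basis[OF hB(2)])
  note L = vv.linear_add[OF L1] vv.linear_add[OF L2] vv.linear_scale[OF L1] vv.linear_scale[OF L2]
    vv.linear_0[OF L1] vv.linear_0[OF L2]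
  note \<omega> = vk.linear_add[OF \<omega>1] vk.linear_add[OF \<omega>2] vk.linear_scale[OF \<omega>1] vk.linear_scale[OF \<omega>2]
    vk.linear_0[OF \<omega>1] vk.linear_0[OF \<omega>2]
  have LV: "L x y \<in> V (g + k)" if "x \<in> V g" "y \<in> V k" for x y g k
    using that(1)
  proof (induction x rule: V_induct)
    case (basis a)
    show ?case using that(2)
    proof (induction y rule: V_induct)
      case (basis b)
      then show ?case using l[of a b] Lb[of a b] \<open>a \<in> hB\<close> \<open>a \<in> V g\<close> by (simp add: deg_eq hB_nz)
    qed (simp_all add: L V_closed)
  qed (simp_all add: L V_closed)
  have \<omega>V: "\<omega> x y = 0" if "x \<in> V g" "y \<in> V k" "g + k \<noteq> 0" for x y g k
    using that(1)
  proof (induction x rule: V_induct)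
    case (basis a)
    show ?case using that(2)
    proof (induction y rule: V_induct)
      case (basis b)
      then show ?case using w[of a b] Lb[of a b] \<open>a \<in> hB\<close> \<open>a \<in> V g\<close> that(3) by (simp add: deg_eq hB_nz)
    qed (simp_all add: \<omega>)
  qed (simp_all add: \<omega>)
  let ?R = "\<lambda>g k x y. e x * e y - sm (\<epsilon> g k) (e y * e x) - e (L x y) - sm (\<omega> x y) 1"
  have R: "expand (env_rel L \<omega> g k x y) = ?R g k x y" for g k x y
    by (simp add: env_rel_def expand_diff expand_mult expand_sm expand_mon expand_one del: sm_single)
  have Rlin: "?R g k (x + x') y = ?R g k x y + ?R g k x' y" "?R g k x (y + y') = ?R g k x y + ?R g k x y'"
    "?R g k (c *s x) y = sm c (?R g k x y)" "?R g k x (c *s y) = sm c (?R g k x y)"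
    "?R g k 0 y = 0" "?R g k x 0 = 0" for g k x x' y y' c
    by (simp_all add: L \<omega> e_add e_scale algebra_simps sm_mult
      smv.scale_right_distrib smv.scale_right_diff_distrib smv.scale_left_distrib)
  have hR: "h (?R g k x y) = \<zero>\<^bsub>A\<^esub>" if "x \<in> V g" "y \<in> V k" for x y g k
    using that(1)
  proof (induction x rule: V_induct)
    case (basis a)
    show ?case using that(2)
    proof (induction y rule: V_induct)
      case (basis b)
      have d: "deg a = g" "deg b = k" using \<open>a \<in> hB\<close> \<open>a \<in> V g\<close> basis by (auto simp: deg_eq hB_nz)
      have "h (env_rel L \<omega> g k a b) = \<zero>\<^bsub>A\<^esub>"
        using lw[OF \<open>a \<in> hB\<close> \<open>b \<in> hB\<close>] unfolding eq_iff d env_rel_def Lb[OF \<open>a \<in> hB\<close> \<open>b \<in> hB\<close>]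
        by (simp add: diff_diff_eq add.assoc del: sm_single)
      then show ?case using hEf[of "env_rel L \<omega> g k a b"] R by simp
    qed (simp_all only: Rlin add sm zero smult_zero l_zero zero_closed)
  qed (simp_all only: Rlin add sm zero smult_zero l_zero zero_closed)
  have rel: "h (env_rel L \<omega> g k x y) = h 0" if "x \<in> V g" "y \<in> V k" for x y g k
    using hR[OF that] hEf[of "env_rel L \<omega> g k x y"] R by (simp add: zero)
  let ?q = "\<lambda>x y. mon [L x y] + sm (\<omega> x y) 1"
  have hk: "h (?k g k x y) = h (?q x y)" if "x \<in> V g" "y \<in> V k" for x y g k
    using rel[OF that] unfolding eq_iff by (simp add: env_rel_def diff_diff_eq add.assoc zero del: sm_single)
  have q_sm: "h (sm c (mon [v] + sm d 1)) = h (mon [c *s v] + sm (c * d) 1)" for c d v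
    unfolding smv.scale_right_distrib smv.scale_scale by (intro eq_add lin(2)[symmetric] refl)
  have q_add: "h ((mon [v] + sm c 1) + (mon [v'] + sm d 1)) = h (mon [v + v'] + sm (c + d) 1)" for c d v v'
  proof -
    have "(mon [v] + sm c 1) + (mon [v'] + sm d 1) = (mon [v] + mon [v']) + (sm (c + d) 1 :: 'v list \<Rightarrow>\<^sub>0 'k)"
      by (simp add: smv.scale_left_distrib algebra_simps del: sm_single)
    then show ?thesis using eq_add[OF lin(1)[symmetric] refl] by metis
  qed
  \<comment> \<open>One identity between commutators in A yields the antisymmetry of the bracket and
    of the form at once, through \<open>inj\<close>.\<close>
  have anti: "L x y = - \<epsilon> g k *s L y x \<and> \<omega> x y = - \<epsilon> g k * \<omega> y x" if xy: "x \<in> V g" "y \<in> V k" for x y g k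
  proof -
    have "?k g k x y = sm (- \<epsilon> g k) (?k k g y x)"
      by (simp add: smv.scale_right_diff_distrib eps_inv smv.scale_minus_left del: sm_single)
    then have "h (?q x y) = h (sm (- \<epsilon> g k) (?k k g y x))" using hk[OF xy] by simp
    also have "\<dots> = h (sm (- \<epsilon> g k) (?q y x))" by (rule eq_sm[OF hk[OF xy(2,1)]])
    also have "\<dots> = h (mon [- \<epsilon> g k *s L y x] + sm (- \<epsilon> g k * \<omega> y x) 1)" by (rule q_sm)
    finally show ?thesis using inj by blast
  qed
  \<comment> \<open>The scalar part of the inner commutator drops out: \<omega>(y,z) is nonzero only
    if the degrees of y and z cancel, and then x commutes with scalars without a factor.\<close>
  have nested: "h (mon [x] * ?k h' k y z - sm (\<epsilon> g (h' + k)) (?k h' k y z * mon [x])) = h (?q x (L y z))"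
    if xyz: "x \<in> V g" "y \<in> V h'" "z \<in> V k" for x y z g h' k
  proof -
    have "sm (\<omega> y z) (mon [x]) = sm (\<epsilon> g (h' + k) * \<omega> y z) (mon [x])"
      using \<omega>V[OF xyz(2,3)] by (cases "h' + k = 0") auto
    then have "mon [x] * ?q y z - sm (\<epsilon> g (h' + k)) (?q y z * mon [x]) = ?k g (h' + k) x (L y z)"
      by (simp add: distrib_left distrib_right sm_mult smv.scale_right_distrib del: sm_single)
    moreover have "h (mon [x] * ?k h' k y z - sm (\<epsilon> g (h' + k)) (?k h' k y z * mon [x]))
      = h (mon [x] * ?q y z - sm (\<epsilon> g (h' + k)) (?q y z * mon [x]))"
      by (intro eq_diff eq_mult eq_sm refl hk xyz)
    ultimately show ?thesis using hk[OF xyz(1) LV[OF xyz(2,3)]] by simp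
  qed
  have jac: "\<epsilon> k g *s L a (L b c) + \<epsilon> g h' *s L b (L c a) + \<epsilon> h' k *s L c (L a b) = 0 \<and>
    \<epsilon> k g * \<omega> a (L b c) + \<epsilon> g h' * \<omega> b (L c a) + \<epsilon> h' k * \<omega> c (L a b) = 0"
    if abc: "a \<in> V g" "b \<in> V h'" "c \<in> V k" for a b c g h' k
  proof -
    have e: "\<epsilon> k g * \<epsilon> g (h' + k) = \<epsilon> g h'" "\<epsilon> g h' * \<epsilon> h' (k + g) = \<epsilon> h' k" "\<epsilon> h' k * \<epsilon> k (g + h') = \<epsilon> k g"
      by (rule eps_cancel)+
    note J = jacobi_identity[OF e, of "mon [a]" "mon [b]" "mon [c]"]
    let ?lhs = "mon [\<epsilon> k g *s L a (L b c) + \<epsilon> g h' *s L b (L c a) + \<epsilon> h' k *s L c (L a b)]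
      + sm (\<epsilon> k g * \<omega> a (L b c) + \<epsilon> g h' * \<omega> b (L c a) + \<epsilon> h' k * \<omega> c (L a b)) 1"
    have "h ?lhs = h (sm (\<epsilon> k g) (?q a (L b c)) + sm (\<epsilon> g h') (?q b (L c a)) + sm (\<epsilon> h' k) (?q c (L a b)))"
      unfolding q_add[symmetric] by (intro eq_add q_sm[symmetric] trans[OF q_add[symmetric]])
    also have "\<dots> = h 0"
      unfolding J[symmetric] by (intro eq_add eq_sm nested[symmetric] abc)
    also have "\<dots> = h (mon [0] + sm 0 1)" using lin(3) by simp
    finally show ?thesis using inj by blast
  qed
  have "color_Lie scale \<epsilon> V L \<omega>"
  proof unfold_locales
    have bil: "bilinear_map scale scale L" "bilinear_map scale (*) \<omega>"
      unfolding bilinear_map_def using L1 L2 \<omega>1 \<omega>2 by blast+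
    show "L \<in> color_Lie_structures \<epsilon> scale V"
      unfolding color_Lie_structures_def
    proof (intro CollectI conjI allI ballI)
      show "L a b = - (\<epsilon> g k *s L b a)" if "a \<in> V g" "b \<in> V k" for g k a b
        using anti[OF that] by (simp only: scale_minus_left)
    qed (use bil LV jac in blast)+
    show "\<omega> \<in> Z2_gr \<epsilon> scale V L"
      unfolding Z2_gr_def
    proof (intro CollectI conjI allI ballI impI)
      show "\<omega> x y = 0" if "g + k \<noteq> 0" "x \<in> V g" "y \<in> V k" for g k x y using \<omega>V that by blast
    qed (use bil anti jac in blast)+
  qed
  moreover have "\<forall>p\<in>env_gens L \<omega>. h p = h 0" using rel by (auto simp: env_gens_def)
  ultimately show ?thesis by blast
qed

end

end

section \<open>The classification\<close>

lemma (in k_algebra) add_minus_cancel: "x \<in> carrier A \<Longrightarrow> y \<in> carrier A \<Longrightarrow> x \<oplus> (y \<ominus> x) = y"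
  by (simp add: a_minus_def a_lcomm[of x y] r_neg)

lemma (in gfa) decomposition_single:
  assumes "y \<in> homog A g"
  shows "homogeneous_decomposition A (homog A) y (\<lambda>k. if k = g then y else \<zero>)"
proof -
  have y: "y \<in> carrier A" by (rule subspaceD(1)[OF homog_subspace assms])
  have "{k. (if k = g then y else \<zero>) \<noteq> \<zero>} = (if y = \<zero> then {} else {g})" by auto
  then show ?thesis
    using assms y subspaceD(2)[OF homog_subspace]
    by (auto simp: homogeneous_decomposition_def finsum_insert[of "{}"])
qed

lemma (in gfa) homog_disjoint:
  assumes "y \<in> homog A g" "y \<in> homog A k" "g \<noteq> k"
  shows "y = \<zero>"
proof -
  have "(\<lambda>j. if j = g then y else \<zero>) = (\<lambda>j. if j = k then y else \<zero>)"
    using homog_decomp[OF subspaceD(1)[OF homog_subspace assms(1)]]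
      decomposition_single[OF assms(1)] decomposition_single[OF assms(2)] by blast
  from fun_cong[OF this, of g] show ?thesis using assms(3) by simp
qed

section \<open>Comparison of an enveloping algebra with an object\<close>

context color_Lie begin

lemma presents_env: "presents UL \<phi>U pU"
  unfolding presents_def
proof (intro conjI ballI allI)
  show "pU (mon w) \<in> homog UL g" if "w \<in> hwords g" for w g
    unfolding homog_U using that by (intro imageI) simp
qed (rule UF.filtered_hom_axioms piU_presentation(3) env_phi_piS; assumption?)+

text \<open>The relations make h factor through U; injectivity follows from leading terms of normal
  forms, surjectivity from \<open>object_surj\<close>. That the inverse is filtered and graded comes
  from representatives of bounded length and from components of normal forms.\<close>

lemma isomorphic_env:
  assumes obj: "(A, \<phi>) \<in> Obj" and pres: "presents A \<phi> h"
    and rel: "\<And>p. p \<in> env_gens L \<omega> \<Longrightarrow> h p = h 0"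
  shows "Iso (UL, \<phi>U) (A, \<phi>)"
proof -
  interpret filtered_hom A h by (rule presentsD(1)[OF pres])
  have kernel: "h p = h q" if "pU p = pU q" for p q
  proof -
    have "fideal {p. h p = \<zero>\<^bsub>A\<^esub>}" by (auto simp: fideal_def zero add mult)
    then have "p - q \<in> {p. h p = \<zero>\<^bsub>A\<^esub>}"
      using presentsD(2)[OF pres] rel that by (intro piU_presentation(5)) (auto simp: zero)
    then show ?thesis using eq_iff by blast
  qed
  have hnf: "h (nf p) = h p" for p using kernel pU_nf by blast
  \<comment> \<open>The longest part of a normal element in the kernel has symbol zero, hence is
    zero in S(V), where its words are normal too; so it vanishes and the length bound drops.\<close>
  have nf0: "r = 0" if "h r = h 0" "keys r \<subseteq> normal" "keys r \<subseteq> {w. length w < n}" for r n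
    using that
  proof (induction n)
    case (Suc n)
    interpret triv: color_Lie scale \<epsilon> V "\<lambda>_ _. 0" "\<lambda>_ _. 0" by (rule triv)
    let ?s = "lcomp n r"
    have k: "keys ?s \<subseteq> {w. length w = n}" by (auto simp: keys_pcomp)
    have r: "keys r \<subseteq> {w. length w \<le> n}" using Suc.prems(3) by auto
    have "symbol_map A h ?s = gr_class A n (h r)" unfolding symbol_map_keys[OF k] by (rule gr_class_lcomp[OF r])
    also have "\<dots> = symbol_map A h 0" using Suc.prems(1) by (subst symbol_map_keys[where n = n]) simp_all
    finally have "piS ?s = piS 0"
      using objectD(3)[OF obj] presentsD(3)[OF pres] by metis
    then have "triv.nf ?s = triv.nf 0" unfolding piS_piU triv.pU_eq_iff .
    moreover have "triv.nf ?s = ?s" by (rule triv.nf_normal) (use Suc.prems(2) in \<open>auto simp: keys_pcomp\<close>)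
    ultimately have "?s = 0" by simp
    then have "{w \<in> keys r. length w = n} = {}" using keys_pcomp[of "\<lambda>w. length w = n" r] by simp
    then have "keys r \<subseteq> {w. length w < n}" using r by (auto simp: le_less)
    then show ?case using Suc by blast
  qed simp
  have inj: "pU p = pU q" if "h p = h q" for p q
  proof -
    have "h (nf (p - q)) = h 0" using that by (simp add: hnf diff zero eq_iff[symmetric] minus_zero_iff)
    moreover have "keys (nf (p - q)) \<subseteq> {w. length w < Suc (Max (insert 0 (length ` keys (nf (p - q)))))}"
      by (auto simp: less_Suc_eq_le)
    ultimately have "nf (p - q) = 0" using nf0 keys_nf by blast
    then show ?thesis by (simp add: pU_eq_iff nf_diff)
  qed
  define M where "M x = h (SOME p. pU p = x)" for x
  define N where "N y = pU (SOME p. h p = y)" for y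
  have M: "M (pU p) = h p" for p
    unfolding M_def by (rule kernel) (rule someI[of "\<lambda>q. pU q = pU p"], simp)
  have N: "N (h p) = pU p" for p
    unfolding N_def by (rule inj) (rule someI[of "\<lambda>q. h q = h p"], simp)
  note surj = object_surj[OF obj pres]
  have homM: "M \<in> alg_hom UL A" by (rule alg_hom_factor[OF U.hom piU_presentation(2) hom M])
  have homN: "N \<in> alg_hom A UL" by (rule alg_hom_factor[OF hom surj U.hom N])
  have filtM: "M ` filt UL n \<subseteq> filt A n" for n
    unfolding filt_U by (auto simp: M intro: filt_keys)
  have filtN: "N ` filt A n \<subseteq> filt UL n" for n
    using object_filt[OF obj pres] unfolding filt_U by (fastforce simp: N)
  have gM: "M ` homog UL g \<subseteq> homog A g" for g
    unfolding homog_U by (auto simp: M intro: presents_homog[OF pres])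
  have gN: "N ` homog A g \<subseteq> homog UL g" for g
  proof
    fix x assume "x \<in> N ` homog A g"
    then obtain p where p: "x = pU p" "h p \<in> homog A g"
      using surj subspaceD(1)[OF homog_subspace] N by (metis imageE rangeE)
    \<comment> \<open>Sorting the normal form by degree decomposes the image in A, and uniqueness
      there singles out the component of degree g.\<close>
    have "homogeneous_decomposition A (homog A) (h (nf p)) (\<lambda>g. h (gcomp g (nf p)))"
      by (intro decomposition_pcomp presents_homog[OF pres] keys_normal_gcomp)
    then have "(\<lambda>g. h (gcomp g (nf p))) = (\<lambda>k. if k = g then h p else \<zero>\<^bsub>A\<^esub>)"
      using homog_decomp[OF closed] decomposition_single[OF p(2)] unfolding hnf by blast
    from fun_cong[OF this, of g] have "h (gcomp g (nf p)) = h p" by simp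
    then have "x = pU (gcomp g (nf p))" using p(1) inj by metis
    then show "x \<in> homog UL g" unfolding homog_U using keys_normal_gcomp by blast
  qed
  have Mm: "M \<in> Mor (UL, \<phi>U) (A, \<phi>)"
    unfolding R_morphisms_def
  proof (simp add: homM filtM gM, intro ballI)
    fix s assume "s \<in> carrier Sym"
    then obtain p where s: "s = piS p" using range_piS by blast
    show "assoc_graded_map A M (\<phi>U s) = \<phi> s"
      unfolding s env_phi_piS presentsD(3)[OF pres] UF.assoc_graded_map_symbol_map[OF gfa_axioms homM filtM]
      by (simp add: M)
  qed
  have Nm: "N \<in> Mor (A, \<phi>) (UL, \<phi>U)"
    unfolding R_morphisms_def
  proof (simp add: homN filtN gN, intro ballI)
    fix s assume "s \<in> carrier Sym"
    then obtain p where s: "s = piS p" using range_piS by blast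
    show "assoc_graded_map UL N (\<phi> s) = \<phi>U s"
      unfolding s env_phi_piS presentsD(3)[OF pres] assoc_graded_map_symbol_map[OF UF.gfa_axioms homN filtN]
      by (simp add: N)
  qed
  have "N (M x) = x" if "x \<in> carrier UL" for x using that M N carrier_U by auto
  moreover have "M (N y) = y" if "y \<in> carrier A" for y using that M N surj by (metis rangeE)
  ultimately show ?thesis unfolding R_isomorphic_def by (intro bexI[OF _ Mm] bexI[OF _ Nm]) simp
qed

end

section \<open>Uniqueness of the bracket and of the cohomology class\<close>

context color_space begin

lemma bilinear_ext:
  assumes "\<And>x. Vector_Spaces.linear scale t (b x)" "\<And>y. Vector_Spaces.linear scale t (\<lambda>x. b x y)"
    and "\<And>x. Vector_Spaces.linear scale t (b' x)" "\<And>y. Vector_Spaces.linear scale t (\<lambda>x. b' x y)"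
    and eq: "\<And>g k x y. x \<in> V g \<Longrightarrow> y \<in> V k \<Longrightarrow> b x y = b' x y"
  shows "b x y = b' x y"
proof -
  interpret t: vector_space_pair scale t
    using assms(1)[of 0] by (simp add: vector_space_pair_def Vector_Spaces.linear_def)
  note l = t.linear_add[OF assms(1)] t.linear_add[OF assms(2)] t.linear_add[OF assms(3)] t.linear_add[OF assms(4)]
    t.linear_scale[OF assms(1)] t.linear_scale[OF assms(2)] t.linear_scale[OF assms(3)] t.linear_scale[OF assms(4)]
    t.linear_0[OF assms(1)] t.linear_0[OF assms(2)] t.linear_0[OF assms(3)] t.linear_0[OF assms(4)]
  show ?thesis
  proof (induction x rule: all_induct)
    case (hom x g)
    show ?case
      by (induction y rule: all_induct) (auto simp: l eq[OF hom])
  qed (simp_all add: l)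
qed

text \<open>Both lifts have the same class modulo F_0, so they differ by a function f with scalar
  values. It is linear and vanishes outside degree e, the second homomorphism is the first after
  \<open>shift f\<close>, and comparing the relations leaves the coboundary of f.\<close>

lemma presents_unique:
  assumes obj: "(A, \<phi>) \<in> Obj"
    and pres: "presents A \<phi> h" and C: "color_Lie scale \<epsilon> V L \<omega>" and rel: "\<And>p. p \<in> env_gens L \<omega> \<Longrightarrow> h p = h 0"
    and pres': "presents A \<phi> h'" and C': "color_Lie scale \<epsilon> V L' \<omega>'" and rel': "\<And>p. p \<in> env_gens L' \<omega>' \<Longrightarrow> h' p = h' 0"
  shows "L = L'" "(\<omega>, \<omega>') \<in> Coh L"
proof -
  interpret filtered_hom A h by (rule presentsD(1)[OF pres])
  interpret H': filtered_hom A h' by (rule presentsD(1)[OF pres'])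
  note lin = hom_linear[OF free_hom_axioms presentsD(2)[OF pres]]
  note lin' = hom_linear[OF H'.free_hom_axioms presentsD(2)[OF pres']]
  note inj = object_low_inj[OF obj pres]
  have "\<exists>c. h' (mon [v]) = h (mon [v] + sm c 1)" for v
  proof -
    have "symbol_map A h' (mon [v]) = symbol_map A h (mon [v])" using presentsD(3)[OF pres] presentsD(3)[OF pres'] by metis
    from fun_cong[OF this, of 1] have "h' (mon [v]) \<ominus>\<^bsub>A\<^esub> h (mon [v]) \<in> filt A 0"
      using pred_Suc[of 0] by (simp add: symbol_map_def coset_eq_iff[OF filt_subspace] pcomp_single)
    then obtain p where p: "keys p \<subseteq> {w. length w \<le> 0}" "h' (mon [v]) \<ominus>\<^bsub>A\<^esub> h (mon [v]) = h p"
      using object_filt[OF obj pres] by metis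
    have "p = sm (lookup p []) 1"
      using p(1) by (intro poly_mapping_eqI) (auto simp: lookup_one zero_list_def when_def in_keys_iff subset_iff)
    moreover have "h' (mon [v]) = h (mon [v] + p)"
      by (simp add: add p(2)[symmetric] add_minus_cancel)
    ultimately show ?thesis by metis
  qed
  then obtain f where f: "\<And>v. h' (mon [v]) = h (mon [v] + sm (f v) 1)" by metis
  have "h (mon [v + w] + sm (f (v + w)) 1) = h (mon [v + w] + sm (f v + f w) 1)" for v w
  proof -
    have "h (mon [v + w] + sm (f (v + w)) 1) = h' (mon [v] + mon [w])" by (simp add: f[symmetric] lin'(1))
    also have "\<dots> = h ((mon [v] + sm (f v) 1) + (mon [w] + sm (f w) 1))" by (simp only: H'.add f add)
    also have "(mon [v] + sm (f v) 1) + (mon [w] + sm (f w) 1) = (mon [v] + mon [w]) + (sm (f v + f w) 1 :: 'v list \<Rightarrow>\<^sub>0 'k)"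
      by (simp add: smv.scale_left_distrib algebra_simps del: sm_single)
    also have "h \<dots> = h (mon [v + w] + sm (f v + f w) 1)" by (intro eq_add lin(1)[symmetric] refl)
    finally show ?thesis .
  qed
  then have f_add: "f (v + w) = f v + f w" for v w by (rule inj(2))
  have "h (mon [c *s v] + sm (f (c *s v)) 1) = h (mon [c *s v] + sm (c * f v) 1)" for c v
  proof -
    have "h (mon [c *s v] + sm (f (c *s v)) 1) = h' (sm c (mon [v]))" by (simp only: f[symmetric] lin'(2))
    also have "\<dots> = h (sm c (mon [v] + sm (f v) 1))" by (simp only: H'.sm f sm)
    also have "\<dots> = h (mon [c *s v] + sm (c * f v) 1)"
      unfolding smv.scale_right_distrib smv.scale_scale by (intro eq_add lin(2)[symmetric] refl)
    finally show ?thesis .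
  qed
  then have f_scale: "f (c *s v) = c * f v" for c v by (rule inj(2))
  interpret vk: vector_space_pair scale "(*)" by unfold_locales (simp_all add: algebra_simps)
  have f_lin: "Vector_Spaces.linear scale (*) f"
    by (rule linear_mapI) (unfold_locales, unfold_locales, rule f_add, rule f_scale)
  \<comment> \<open>The scalar f(x) is a difference of two lifts of x, so it has degree g in A as
    well as degree 0.\<close>
  have f_V: "f x = 0" if "g \<noteq> 0" "x \<in> V g" for g x
  proof -
    have x: "[x] \<in> hwords g" using that by (simp add: hwords_Cons hwords_Nil)
    have "h (sm (f x) 1) = h' (mon [x]) \<ominus>\<^bsub>A\<^esub> h (mon [x])"
      unfolding f add by (simp add: a_minus_def a_ac r_neg)
    also have "\<dots> \<in> homog A g"
      using presentsD(4)[OF pres x] presentsD(4)[OF pres' x] by (rule subspaceD(6)[OF homog_subspace, rotated])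
    finally have 1: "h (sm (f x) 1) \<in> homog A g" .
    have "keys (sm (f x) (1 :: 'v list \<Rightarrow>\<^sub>0 'k)) \<subseteq> hwords 0" 
      by (intro keys_subset_closed(3)) (simp add: zero_list_def hwords_Nil)
    then have "h (sm (f x) 1) \<in> homog A 0" by (rule presents_homog[OF pres])
    then have "h (sm (f x) 1) = \<zero>\<^bsub>A\<^esub>" using homog_disjoint[OF 1] that(1) by blast
    then have "h (mon [0] + sm (f x) 1) = h (mon [0] + sm 0 1)" by (simp add: add zero)
    then show ?thesis by (rule inj(2))
  qed
  have h': "h' p = h (shift f p)" for p
    by (rule alg_hom_free_eqI[OF H'.hom alg_hom_comp[OF shift_hom hom], of UNIV]) (simp_all add: f shift_mon)
  interpret C: color_Lie scale \<epsilon> V L \<omega> by (rule C)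
  interpret C': color_Lie scale \<epsilon> V L' \<omega>' by (rule C')
  have eq: "L x y = L' x y \<and> \<omega> x y = \<omega>' x y + f (L' x y)" if "x \<in> V g" "y \<in> V k" for x y g k
  proof -
    have "env_rel L \<omega> g k x y \<in> env_gens L \<omega>" "env_rel L' \<omega>' g k x y \<in> env_gens L' \<omega>'"
      using that by (auto simp: env_gens_def)
    then have "h (env_rel L \<omega> g k x y) = \<zero>\<^bsub>A\<^esub>" "h (shift f (env_rel L' \<omega>' g k x y)) = \<zero>\<^bsub>A\<^esub>"
      using rel rel' by (simp_all add: zero H'.zero flip: h')
    then have e: "h (env_rel L \<omega> g k x y) = h (env_rel L' (\<lambda>x y. \<omega>' x y + f (L' x y)) g k x y)"
      by (simp add: shift_env_rel[OF f_V that])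
    let ?k = "mon [x] * mon [y] - sm (\<epsilon> g k) (mon [y] * mon [x])"
    have "h (?k - env_rel L \<omega> g k x y) = h (?k - env_rel L' (\<lambda>x y. \<omega>' x y + f (L' x y)) g k x y)"
      by (rule eq_diff[OF refl e])
    moreover have "?k - env_rel l w g k x y = mon [l x y] + sm (w x y) 1" for l w
      by (simp add: env_rel_def algebra_simps del: sm_single)
    ultimately have "h (mon [L x y] + sm (\<omega> x y) 1) = h (mon [L' x y] + sm (\<omega>' x y + f (L' x y)) 1)" by simp
    then show ?thesis using inj by blast
  qed
  show LL: "L = L'"
    by (intro ext) (rule bilinear_ext[OF C.linL C'.linL], use eq in blast)
  have "\<omega> x y - \<omega>' x y = f (L x y)" for x y
  proof -
    interpret f: Vector_Spaces.linear scale "(*)" f by (rule f_lin)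
    show ?thesis
    proof (rule bilinear_ext[where t = "(*)" and b = "\<lambda>x y. \<omega> x y - \<omega>' x y" and b' = "\<lambda>x y. f (L x y)"])
      show "Vector_Spaces.linear scale (*) (\<lambda>y. \<omega> x y - \<omega>' x y)" "Vector_Spaces.linear scale (*) (\<lambda>x. \<omega> x y - \<omega>' x y)" for x y
        by (rule vk.linear_compose_sub C.lin\<omega> C'.lin\<omega>)+
      show "Vector_Spaces.linear scale (*) (\<lambda>y. f (L x y))" "Vector_Spaces.linear scale (*) (\<lambda>x. f (L x y))" for x y
        by (rule linear_mapI; (unfold_locales)?; simp add: C.L_add C.L_scale f_add f_scale)+
    qed (use eq LL in auto)
  qed
  then have "(\<lambda>x y. \<omega> x y - \<omega>' x y) \<in> B2_gr scale V L"
    unfolding B2_gr_def using f_lin f_V by auto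
  then show "(\<omega>, \<omega>') \<in> Coh L"
    using C.\<omega> C'.\<omega> LL by (simp add: cohomologous_def)
qed

text \<open>If \<omega> - \<omega>' is the coboundary of f, shifting the lift by f turns the
  relations for \<omega>' into those for \<omega>.\<close>

lemma presents_cohomologous:
  assumes obj: "(A, \<phi>) \<in> Obj" and pres: "presents A \<phi> h"
    and rel: "\<And>p. p \<in> env_gens L \<omega> \<Longrightarrow> h p = h 0" and coh: "(\<omega>, \<omega>') \<in> Coh L"
  shows "\<exists>h'. presents A \<phi> h' \<and> (\<forall>p\<in>env_gens L \<omega>'. h' p = h' 0)"
proof -
  interpret filtered_hom A h by (rule presentsD(1)[OF pres])
  obtain f where f: "(\<lambda>x y. \<omega> x y - \<omega>' x y) = (\<lambda>x y. f (L x y))" "Vector_Spaces.linear scale (*) f"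
     "\<And>g x. g \<noteq> 0 \<Longrightarrow> x \<in> V g \<Longrightarrow> f x = 0"
    using coh unfolding cohomologous_def B2_gr_def by blast
  have \<omega>: "(\<lambda>x y. \<omega>' x y + f (L x y)) = \<omega>"
    using f(1) by (auto simp: fun_eq_iff algebra_simps)
  have p: "presents A \<phi> (\<lambda>p. h (shift f p))" by (rule presents_shift[OF obj pres f(2,3)])
  have "h (shift f p) = h (shift f 0)" if "p \<in> env_gens L \<omega>'" for p
  proof -
    obtain g k a b where ab: "a \<in> V g" "b \<in> V k" "p = env_rel L \<omega>' g k a b" using \<open>p \<in> _\<close> by (auto simp: env_gens_def)
    then have "shift f p = env_rel L \<omega> g k a b" using shift_env_rel[OF f(3) ab(1,2), where L = L and \<omega> = \<omega>'] \<omega> by simp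
    moreover have "env_rel L \<omega> g k a b \<in> env_gens L \<omega>" using ab by (auto simp: env_gens_def)
    ultimately show ?thesis using rel by (simp add: shift_0)
  qed
  then show ?thesis using p by blast
qed

section \<open>Isomorphism in the category and cohomology as equivalence relations\<close>

lemma R_isomorphic_refl: "(A, \<phi>) \<in> Obj \<Longrightarrow> Iso (A, \<phi>) (A, \<phi>)"
proof -
  assume obj: "(A, \<phi>) \<in> Obj"
  obtain h where pres: "presents A \<phi> h" using object_presentation[OF obj] by blast
  interpret filtered_hom A h by (rule presentsD(1)[OF pres])
  have id: "(\<lambda>x. x) \<in> alg_hom A A" by (rule alg_homI) auto
  have "assoc_graded_map A (\<lambda>x. x) (\<phi> s) = \<phi> s" if s: "s \<in> carrier Sym" for s
  proof -
    obtain p where "s = piS p" using s range_piS by blast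
    then show ?thesis using assoc_graded_map_symbol_map[OF gfa_axioms id] by (simp add: presentsD(3)[OF pres])
  qed
  then have "(\<lambda>x. x) \<in> Mor (A, \<phi>) (A, \<phi>)" using id by (simp add: R_morphisms_def)
  then show ?thesis unfolding R_isomorphic_def by (intro bexI[of _ "\<lambda>x. x"]) simp_all
qed

lemma R_isomorphic_sym: "Iso X Y \<Longrightarrow> Iso Y X"
  unfolding R_isomorphic_def by blast

text \<open>Compatibility of the composite with \<phi> is checked on symbols: a presentation of A is
  carried along both morphisms to one of C.\<close>

lemma R_morphisms_comp:
  assumes obj: "(A, \<phi>) \<in> Obj" "(B, \<psi>) \<in> Obj" "(C, \<chi>) \<in> Obj"
    and M: "M \<in> Mor (A, \<phi>) (B, \<psi>)" and N: "N \<in> Mor (B, \<psi>) (C, \<chi>)"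
  shows "(\<lambda>x. N (M x)) \<in> Mor (A, \<phi>) (C, \<chi>)"
proof -
  obtain h where pres: "presents A \<phi> h" using object_presentation[OF obj(1)] by blast
  interpret filtered_hom A h by (rule presentsD(1)[OF pres])
  interpret C: gfa C by (rule objectD(1)[OF obj(3)])
  have pres'': "presents C \<chi> (\<lambda>p. N (M (h p)))"
    by (rule presents_morphism[OF presents_morphism[OF pres obj(2) M] obj(3) N])
  have hom: "(\<lambda>x. N (M x)) \<in> alg_hom A C"
    by (rule alg_hom_comp[of M A B]) (use M N in \<open>simp_all add: R_morphisms_def\<close>)
  have g: "(\<lambda>x. N (M x)) ` homog A g \<subseteq> homog C g" "(\<lambda>x. N (M x)) ` filt A n \<subseteq> filt C n" for g n
    using M N by (auto simp: R_morphisms_def image_subset_iff)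
  have "assoc_graded_map C (\<lambda>x. N (M x)) (\<phi> s) = \<chi> s" if s: "s \<in> carrier Sym" for s
  proof -
    obtain p where "s = piS p" using s range_piS by blast
    then show ?thesis
      using assoc_graded_map_symbol_map[OF C.gfa_axioms hom g(2)] by (simp add: presentsD(3)[OF pres] presentsD(3)[OF pres''])
  qed
  then show ?thesis using hom g by (simp add: R_morphisms_def)
qed

lemma R_isomorphic_trans:
  assumes obj: "X \<in> Obj" "Y \<in> Obj" "Z \<in> Obj"
    and iso: "Iso X Y" "Iso Y Z"
  shows "Iso X Z"
proof -
  obtain A \<phi> B \<psi> C \<chi> where X: "X = (A, \<phi>)" "Y = (B, \<psi>)" "Z = (C, \<chi>)" by (metis surj_pair)
  obtain M M' where M: "M \<in> Mor X Y" "M' \<in> Mor Y X"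
    "\<forall>x\<in>carrier A. M' (M x) = x" "\<forall>y\<in>carrier B. M (M' y) = y"
    using iso(1) unfolding R_isomorphic_def X by auto
  obtain N N' where N: "N \<in> Mor Y Z" "N' \<in> Mor Z Y"
    "\<forall>x\<in>carrier B. N' (N x) = x" "\<forall>y\<in>carrier C. N (N' y) = y"
    using iso(2) unfolding R_isomorphic_def X by auto
  have "M \<in> alg_hom A B" "N' \<in> alg_hom C B" using M N X by (auto simp: R_morphisms_def)
  then have c: "\<And>x. x \<in> carrier A \<Longrightarrow> M x \<in> carrier B" "\<And>x. x \<in> carrier C \<Longrightarrow> N' x \<in> carrier B"
    by (auto intro: alg_homD(1))
  show ?thesis
    unfolding R_isomorphic_def X fst_conv
  proof (intro bexI conjI ballI)
    show "(\<lambda>x. N (M x)) \<in> Mor (A, \<phi>) (C, \<chi>)"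
      using R_morphisms_comp obj M N unfolding X by blast
    show "(\<lambda>x. M' (N' x)) \<in> Mor (C, \<chi>) (A, \<phi>)"
      using R_morphisms_comp obj M N unfolding X by blast
  qed (use c M N in auto)
qed

lemma equiv_R_isomorphic:
  "equiv (Obj) {(X, Y). X \<in> Obj \<and> Y \<in> Obj \<and> Iso X Y}"
proof (rule equivI)
  show "refl_on (Obj) {(X, Y). X \<in> Obj \<and> Y \<in> Obj \<and> Iso X Y}"
    using R_isomorphic_refl by (auto simp: refl_on_def)
  show "sym {(X, Y). X \<in> Obj \<and> Y \<in> Obj \<and> Iso X Y}"
    using R_isomorphic_sym by (auto simp: sym_def)
  show "trans {(X, Y). X \<in> Obj \<and> Y \<in> Obj \<and> Iso X Y}"
    using R_isomorphic_trans by (intro transI) blast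
qed auto

lemma equiv_cohomologous: "equiv (Z2_gr \<epsilon> scale V L) (Coh L)"
proof (rule equivI)
  interpret vk: vector_space_pair scale "(*)" by unfold_locales (simp_all add: algebra_simps)
  show "Coh L \<subseteq> Z2_gr \<epsilon> scale V L \<times> Z2_gr \<epsilon> scale V L" by (auto simp: cohomologous_def)
  have "(\<lambda>x y. 0) \<in> B2_gr scale V L"
    unfolding B2_gr_def by (intro CollectI exI[of _ "\<lambda>_. 0"]) (simp add: vk.linear_zero)
  then show "refl_on (Z2_gr \<epsilon> scale V L) (Coh L)" by (auto simp: refl_on_def cohomologous_def)
  show "sym (Coh L)"
  proof (rule symI)
    fix \<omega> \<omega>' assume c: "(\<omega>, \<omega>') \<in> Coh L"
    then obtain f where f: "(\<lambda>x y. \<omega> x y - \<omega>' x y) = (\<lambda>x y. f (L x y))" "Vector_Spaces.linear scale (*) f"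
       "\<forall>g. g \<noteq> 0 \<longrightarrow> (\<forall>x\<in>V g. f x = 0)"
      unfolding cohomologous_def B2_gr_def by blast
    have "(\<lambda>x y. \<omega>' x y - \<omega> x y) = (\<lambda>x y. - f (L x y))"
      using f(1) by (simp add: fun_eq_iff) (metis minus_diff_eq)
    then have "(\<lambda>x y. \<omega>' x y - \<omega> x y) \<in> B2_gr scale V L"
      unfolding B2_gr_def using vk.linear_compose_neg[OF f(2)] f(3) by (intro CollectI exI[of _ "\<lambda>x. - f x"]) simp
    then show "(\<omega>', \<omega>) \<in> Coh L" using c by (simp add: cohomologous_def)
  qed
  show "trans (Coh L)"
  proof (rule transI)
    fix \<omega> \<omega>' \<omega>'' assume c: "(\<omega>, \<omega>') \<in> Coh L" and d: "(\<omega>', \<omega>'') \<in> Coh L"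
    obtain f where f: "(\<lambda>x y. \<omega> x y - \<omega>' x y) = (\<lambda>x y. f (L x y))" "Vector_Spaces.linear scale (*) f"
       "\<forall>g. g \<noteq> 0 \<longrightarrow> (\<forall>x\<in>V g. f x = 0)"
      using c unfolding cohomologous_def B2_gr_def by blast
    obtain f' where f': "(\<lambda>x y. \<omega>' x y - \<omega>'' x y) = (\<lambda>x y. f' (L x y))" "Vector_Spaces.linear scale (*) f'"
       "\<forall>g. g \<noteq> 0 \<longrightarrow> (\<forall>x\<in>V g. f' x = 0)"
      using d unfolding cohomologous_def B2_gr_def by blast
    have "\<omega> x y - \<omega>'' x y = f (L x y) + f' (L x y)" for x y
    proof -
      have "f (L x y) = \<omega> x y - \<omega>' x y" "f' (L x y) = \<omega>' x y - \<omega>'' x y" 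
        using fun_cong[OF fun_cong[OF f(1), of x], of y] fun_cong[OF fun_cong[OF f'(1), of x], of y] by simp_all
      then show ?thesis by simp
    qed
    then have "(\<lambda>x y. \<omega> x y - \<omega>'' x y) \<in> B2_gr scale V L"
      unfolding B2_gr_def using vk.linear_compose_add[OF f(2) f'(2)] f(3) f'(3)
      by (intro CollectI exI[of _ "\<lambda>x. f x + f' x"]) simp
    then show "(\<omega>, \<omega>'') \<in> Coh L" using c d by (simp add: cohomologous_def)
  qed
qed

end

context color_space begin

lemma color_LieI: "L \<in> color_Lie_structures \<epsilon> scale V \<Longrightarrow> \<omega> \<in> Z2_gr \<epsilon> scale V L \<Longrightarrow> color_Lie scale \<epsilon> V L \<omega>"
  by unfold_locales

text \<open>The type of the elements of A is arbitrary; this gives the surjectivity of the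
  correspondence as well as the reduction of all types to one.\<close>

lemma object_isomorphic_env:
  assumes obj: "(A, \<phi>) \<in> Obj"
  obtains L \<omega> where "L \<in> color_Lie_structures \<epsilon> scale V" "\<omega> \<in> Z2_gr \<epsilon> scale V L"
    "Iso (U L \<omega>, env_phi \<epsilon> scale V L \<omega>) (A, \<phi>)"
proof -
  obtain h where h: "presents A \<phi> h" using object_presentation[OF obj] by blast
  then obtain L \<omega> where C: "color_Lie scale \<epsilon> V L \<omega>" and rel: "\<forall>p\<in>env_gens L \<omega>. h p = h 0"
    using object_structure[OF obj] by blast
  interpret color_Lie scale \<epsilon> V L \<omega> by (rule C)
  show ?thesis using that[OF L \<omega>] isomorphic_env[OF obj h] rel by blast
qed

lemma env_isomorphic_cohomologous:
  assumes "color_Lie scale \<epsilon> V L \<omega>" and coh: "(\<omega>, \<omega>') \<in> Coh L"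
  shows "Iso (U L \<omega>', env_phi \<epsilon> scale V L \<omega>') (U L \<omega>, env_phi \<epsilon> scale V L \<omega>)"
proof -
  interpret color_Lie scale \<epsilon> V L \<omega> by fact
  interpret C': color_Lie scale \<epsilon> V L \<omega>' using L coh by (intro color_LieI) (auto simp: cohomologous_def)
  show ?thesis
    using presents_cohomologous[OF env_algebra_object presents_env piU_presentation(4) coh]
      C'.isomorphic_env[OF env_algebra_object] by blast
qed

text \<open>The morphism carries the presentation of the first algebra to the second, which then has
  two presentations; \<open>presents_unique\<close> compares them.\<close>

lemma env_isomorphic_unique:
  assumes C: "color_Lie scale \<epsilon> V L \<omega>" and C': "color_Lie scale \<epsilon> V L' \<omega>'"
    and iso: "Iso (U L \<omega>, env_phi \<epsilon> scale V L \<omega>) (U L' \<omega>', env_phi \<epsilon> scale V L' \<omega>')"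
  shows "L = L'" "(\<omega>, \<omega>') \<in> Coh L"
proof -
  interpret color_Lie scale \<epsilon> V L \<omega> by (rule C)
  interpret C': color_Lie scale \<epsilon> V L' \<omega>' by (rule C')
  obtain M where M: "M \<in> Mor (UL, \<phi>U) (C'.UL, C'.\<phi>U)"
    using iso unfolding R_isomorphic_def by blast
  have "M (pU p) = M (pU 0)" if "p \<in> env_gens L \<omega>" for p using piU_presentation(4)[OF that] by simp
  then show "L = L'" "(\<omega>, \<omega>') \<in> Coh L"
    using presents_unique[OF C'.env_algebra_object presents_morphism[OF presents_env C'.env_algebra_object M] C _
        C'.presents_env C' piU_presentation(4)] by blast+
qed

end

(* The objects of the category live in all types at once, so their isomorphism classes are taken
   inside the type carrying the generalized enveloping algebras; the last conjunct says that, for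
   an arbitrary type 'a, every object on 'a is isomorphic to an object on that type. *)
theorem theorem3p1:
  fixes \<epsilon> :: "'g::ab_group_add \<Rightarrow> 'g \<Rightarrow> 'k::field_char_0"
    and scale :: "'k \<Rightarrow> 'v::ab_group_add \<Rightarrow> 'v"
    and V :: "'g \<Rightarrow> 'v set"
  assumes "antisymmetric_bicharacter \<epsilon>"
    and "graded_vector_space scale V"
  shows "(\<exists>\<Theta>. bij_betw \<Theta> (SIGMA L : color_Lie_structures \<epsilon> scale V. H2_gr \<epsilon> scale V L)
               (R_iso_classes \<epsilon> scale V
                  :: (('k, ('v, 'k) tensors set, 'g) graded_filtered
                      \<times> (('v, 'k) tensors set \<Rightarrow> nat \<Rightarrow> ('v, 'k) tensors set set)) set set) \<and>
            (\<forall>L \<in> color_Lie_structures \<epsilon> scale V. \<forall>\<omega> \<in> Z2_gr \<epsilon> scale V L.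
               (env_algebra \<epsilon> scale V L \<omega>, env_phi \<epsilon> scale V L \<omega>) \<in> \<Theta> (L, H2_class \<epsilon> scale V L \<omega>)))
       \<and> (\<forall>X \<in> (R_objects \<epsilon> scale V
                  :: (('k, 'a, 'g) graded_filtered
                      \<times> (('v, 'k) tensors set \<Rightarrow> nat \<Rightarrow> 'a set)) set).
            \<exists>Y \<in> (R_objects \<epsilon> scale V
                  :: (('k, ('v, 'k) tensors set, 'g) graded_filtered
                      \<times> (('v, 'k) tensors set \<Rightarrow> nat \<Rightarrow> ('v, 'k) tensors set set)) set).
              R_isomorphic \<epsilon> scale V X Y)"
proof
  have "vector_space scale" using assms(2) by (simp add: graded_vector_space_def)
  then interpret color_space scale \<epsilon> V
    using assms by (simp add: color_space_def color_space_axioms_def)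
  define E where "E L \<omega> = (U L \<omega>, env_phi \<epsilon> scale V L \<omega>)" for L \<omega>
  let ?CL = "color_Lie_structures \<epsilon> scale V" and ?Z = "Z2_gr \<epsilon> scale V" and ?coh = "Coh"
  have E_obj: "E L \<omega> \<in> Obj" if "L \<in> ?CL" "\<omega> \<in> ?Z L" for L \<omega>
    unfolding E_def by (rule color_Lie.env_algebra_object[OF color_LieI[OF that]])
  have E_coh: "Iso (E L \<omega>') (E L \<omega>)" if "L \<in> ?CL" "(\<omega>, \<omega>') \<in> ?coh L" for L \<omega> \<omega>'
    unfolding E_def using that by (intro env_isomorphic_cohomologous color_LieI) (auto simp: cohomologous_def)
  have E_unique: "L = L' \<and> (\<omega>, \<omega>') \<in> ?coh L"
    if "L \<in> ?CL" "\<omega> \<in> ?Z L" "L' \<in> ?CL" "\<omega>' \<in> ?Z L'" "Iso (E L \<omega>) (E L' \<omega>')" for L \<omega> L' \<omega>'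
    using env_isomorphic_unique[OF color_LieI[OF that(1,2)] color_LieI[OF that(3,4)]] that(5)
    unfolding E_def by blast
  show "\<forall>X \<in> (Obj :: (('k, 'a, 'g) graded_filtered \<times> (('v, 'k) tensors set \<Rightarrow> nat \<Rightarrow> 'a set)) set).
            \<exists>Y \<in> (Obj
                  :: (('k, ('v, 'k) tensors set, 'g) graded_filtered
                      \<times> (('v, 'k) tensors set \<Rightarrow> nat \<Rightarrow> ('v, 'k) tensors set set)) set).
              Iso X Y"
  proof
    fix X :: "('k, 'a, 'g) graded_filtered \<times> (('v, 'k) tensors set \<Rightarrow> nat \<Rightarrow> 'a set)"
    assume "X \<in> Obj"
    then obtain L \<omega> where "L \<in> ?CL" "\<omega> \<in> ?Z L" "Iso (E L \<omega>) X"
      using object_isomorphic_env[of "fst X" "snd X"] unfolding E_def by (metis prod.collapse)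
    then show "\<exists>Y \<in> (Obj
                  :: (('k, ('v, 'k) tensors set, 'g) graded_filtered
                      \<times> (('v, 'k) tensors set \<Rightarrow> nat \<Rightarrow> ('v, 'k) tensors set set)) set).
              Iso X Y"
      using E_obj R_isomorphic_sym by blast
  qed
  let ?O = "Obj :: (('k, ('v, 'k) tensors set, 'g) graded_filtered
                      \<times> (('v, 'k) tensors set \<Rightarrow> nat \<Rightarrow> ('v, 'k) tensors set set)) set"
  define R where "R = {(X, Y). X \<in> ?O \<and> Y \<in> ?O \<and> Iso X Y}"
  have R: "equiv ?O R" unfolding R_def by (rule equiv_R_isomorphic)
  \<comment> \<open>A cocycle representing the class. By \<open>E_coh\<close> other representatives
    give isomorphic objects, so the value at a class contains the object of each of its
    cocycles.\<close>
  define pick :: "('v \<Rightarrow> 'v \<Rightarrow> 'k) set \<Rightarrow> 'v \<Rightarrow> 'v \<Rightarrow> 'k" where "pick c = (SOME \<omega>. \<omega> \<in> c)" for c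
  have pick: "pick c \<in> c" "pick c \<in> ?Z L" if "c \<in> H2_gr \<epsilon> scale V L" for c L
  proof -
    have "c \<noteq> {}" "c \<subseteq> ?Z L"
      using that in_quotient_imp_non_empty[OF equiv_cohomologous] in_quotient_imp_subset[OF equiv_cohomologous]
      unfolding H2_gr_def by blast+
    then show "pick c \<in> c" "pick c \<in> ?Z L" unfolding pick_def using some_in_eq by blast+
  qed
  have pick_coh: "(\<omega>, pick (H2_class \<epsilon> scale V L \<omega>)) \<in> ?coh L" if "\<omega> \<in> ?Z L" for L \<omega>
    using pick(1)[of "H2_class \<epsilon> scale V L \<omega>" L] that
    by (auto simp: H2_gr_def H2_class_def intro: quotientI)
  define \<Theta> where "\<Theta> = (\<lambda>(L, c). R `` {E L (pick c)})"
  show "\<exists>\<Theta>. bij_betw \<Theta> (SIGMA L : ?CL. H2_gr \<epsilon> scale V L) (R_iso_classes \<epsilon> scale V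
                  :: (('k, ('v, 'k) tensors set, 'g) graded_filtered
                      \<times> (('v, 'k) tensors set \<Rightarrow> nat \<Rightarrow> ('v, 'k) tensors set set)) set set) \<and>
            (\<forall>L \<in> ?CL. \<forall>\<omega> \<in> ?Z L.
               (env_algebra \<epsilon> scale V L \<omega>, env_phi \<epsilon> scale V L \<omega>) \<in> \<Theta> (L, H2_class \<epsilon> scale V L \<omega>))"
  proof (intro exI[of _ \<Theta>] conjI ballI)
    show "bij_betw \<Theta> (SIGMA L : ?CL. H2_gr \<epsilon> scale V L) (R_iso_classes \<epsilon> scale V)"
      unfolding bij_betw_def
    proof
      show "inj_on \<Theta> (SIGMA L : ?CL. H2_gr \<epsilon> scale V L)"
      proof (rule inj_onI, clarify)
        fix L c L' c' assume L: "L \<in> ?CL" "c \<in> H2_gr \<epsilon> scale V L" and L': "L' \<in> ?CL" "c' \<in> H2_gr \<epsilon> scale V L'"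
          and "\<Theta> (L, c) = \<Theta> (L', c')"
        then have "(E L (pick c), E L' (pick c')) \<in> R"
          using E_obj pick(2) unfolding \<Theta>_def by (intro eq_equiv_class[OF _ R]) auto
        then have eq: "L = L'" "(pick c, pick c') \<in> ?coh L"
          using E_unique[OF L(1) pick(2)[OF L(2)] L'(1) pick(2)[OF L'(2)]] by (auto simp: R_def)
        have "c = c'"
          using quotient_eqI[OF equiv_cohomologous L(2)[unfolded H2_gr_def] _ pick(1)[OF L(2)] pick(1)[OF L'(2)] eq(2)]
            L'(2) eq(1) by (simp add: H2_gr_def)
        then show "L = L' \<and> c = c'" using eq by simp
      qed
      show "\<Theta> ` (SIGMA L : ?CL. H2_gr \<epsilon> scale V L) = R_iso_classes \<epsilon> scale V"
      proof (intro equalityI subsetI)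
        fix C assume "C \<in> \<Theta> ` (SIGMA L : ?CL. H2_gr \<epsilon> scale V L)"
        then obtain L c where "L \<in> ?CL" "c \<in> H2_gr \<epsilon> scale V L" "C = R `` {E L (pick c)}" by (auto simp: \<Theta>_def)
        then show "C \<in> R_iso_classes \<epsilon> scale V"
          unfolding R_iso_classes_def R_def[symmetric] using E_obj pick(2) by (auto intro: quotientI)
      next
        fix C assume "C \<in> (R_iso_classes \<epsilon> scale V :: (('k, ('v, 'k) tensors set, 'g) graded_filtered
                      \<times> (('v, 'k) tensors set \<Rightarrow> nat \<Rightarrow> ('v, 'k) tensors set set)) set set)"
        then obtain Y where Y: "Y \<in> ?O" "C = R `` {Y}"
          unfolding R_iso_classes_def R_def[symmetric] by (rule quotientE)
        then obtain L \<omega> where L: "L \<in> ?CL" "\<omega> \<in> ?Z L" "Iso (E L \<omega>) Y"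
          using object_isomorphic_env[of "fst Y" "snd Y"] unfolding E_def by (metis prod.collapse)
        let ?c = "H2_class \<epsilon> scale V L \<omega>"
        have c: "?c \<in> H2_gr \<epsilon> scale V L" using L(2) by (simp add: H2_gr_def H2_class_def quotientI)
        have "(E L (pick ?c), E L \<omega>) \<in> R" "(E L \<omega>, Y) \<in> R"
          using E_coh[OF L(1) pick_coh[OF L(2)]] E_obj[OF L(1)] pick(2)[OF c] L Y(1) by (auto simp: R_def)
        then have "(E L (pick ?c), Y) \<in> R" using R by (meson equivE transD)
        then have "C = \<Theta> (L, ?c)" using equiv_class_eq[OF R] Y(2) by (simp add: \<Theta>_def)
        then show "C \<in> \<Theta> ` (SIGMA L : ?CL. H2_gr \<epsilon> scale V L)" using L(1) c by blast
      qed
    qed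
    fix L \<omega> assume L: "L \<in> ?CL" "\<omega> \<in> ?Z L"
    let ?c = "H2_class \<epsilon> scale V L \<omega>"
    have c: "?c \<in> H2_gr \<epsilon> scale V L" using L(2) by (simp add: H2_gr_def H2_class_def quotientI)
    have "(E L (pick ?c), E L \<omega>) \<in> R"
      using E_coh[OF L(1) pick_coh[OF L(2)]] E_obj[OF L(1)] pick(2)[OF c] L by (auto simp: R_def)
    then show "(env_algebra \<epsilon> scale V L \<omega>, env_phi \<epsilon> scale V L \<omega>) \<in> \<Theta> (L, ?c)"
      by (simp add: \<Theta>_def E_def)
  qed
qed

end
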